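(* Let $(\alpha_0,\beta_0)$ and $(\alpha_1,\beta_1)$ be points of the set $\{(\alpha,\beta): \alpha,\beta>1,\ \alpha^{-1}+\beta^{-1}\ge1\}$ such that $\alpha_1\ge\alpha_0$, $\beta_1\ge\beta_0$, and at least one of these two inequalities is strict. Let $\alpha:[0,1]\to[\alpha_0,\alpha_1]$ and $\beta:[0,1]\to[\beta_0,\beta_1]$ be functions in $C^1([0,1])$ such that $(\alpha(0),\beta(0))=(\alpha_0,\beta_0)$, $(\alpha(1),\beta(1))=(\alpha_1,\beta_1)$ and, for all $a\in[0,1]$, if $\alpha_0\ne\alpha_1$ then $\alpha'(a)>0$ and if $\beta_0\neq\beta_1$ then $\beta'(a)>0$. Let $T_a=T_{\alpha(a),\beta(a)}:[0,1]\to[0,1]$, $a\in[0,1]$, be the corresponding skew tent maps, and let $\mu_a$ be the unique absolutely continuous invariant probability measure of $T_a$. Then the turning point of $T_a$ is typical for $\mu_a$ for Lebesgue a.e. $a\in[0,1]$.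
   Context: For $\alpha,\beta>1$ with $\alpha^{-1}+\beta^{-1}\ge1$, the skew tent map $T_{\alpha,\beta}:[0,1]\to[0,1]$ is the continuous map with turning point $c=1-1/\beta$, affine with slope $\alpha$ on $[0,c]$ and affine with slope $-\beta$ on $[c,1]$, normalized by $T_{\alpha,\beta}(c)=1$ and $T_{\alpha,\beta}(1)=0$. It has a unique absolutely continuous invariant probability measure. A point $x$ is typical for $\mu_a$ if $\frac1n\sum_{i=0}^{n-1}\delta_{T_a^i(x)}\to\mu_a$ weak-$*$ as $n\to\infty$. *)

theory Defs
  imports "HOL-Probability.Probability"
begin

definition skew_tent_params :: "(real \<times> real) set" where
  "skew_tent_params = {(\<alpha>, \<beta>). \<alpha> > 1 \<and> \<beta> > 1 \<and> inverse \<alpha> + inverse \<beta> \<ge> 1}"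

definition turning_point :: "real \<Rightarrow> real" where
  "turning_point \<beta> = 1 - 1 / \<beta>"

text \<open>The two affine branches are written around the turning point, where both take the value 1.
  The formula makes sense on all of the real line, but only its values on \<open>{0..1}\<close> matter.\<close>

definition skew_tent :: "real \<Rightarrow> real \<Rightarrow> real \<Rightarrow> real" where
  "skew_tent \<alpha> \<beta> x =
     (if x \<le> turning_point \<beta> then 1 + \<alpha> * (x - turning_point \<beta>)
      else 1 - \<beta> * (x - turning_point \<beta>))"

lemma skew_tent_turning_point: "skew_tent \<alpha> \<beta> (turning_point \<beta>) = 1"
  by (simp add: skew_tent_def)

lemma skew_tent_one: "\<beta> > 1 \<Longrightarrow> skew_tent \<alpha> \<beta> 1 = 0"
  by (simp add: skew_tent_def turning_point_def)

lemma skew_tent_unit_interval: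
  assumes "(\<alpha>, \<beta>) \<in> skew_tent_params" and x: "x \<in> {0..1}"
  shows "skew_tent \<alpha> \<beta> x \<in> {0..1}"
proof (cases "x \<le> turning_point \<beta>")
  case True
  have a: "\<alpha> > 1" "\<beta> > 1" "inverse \<alpha> + inverse \<beta> \<ge> 1"
    using assms(1) by (auto simp: skew_tent_params_def)
  have "\<alpha> * (inverse \<alpha> + inverse \<beta>) \<ge> \<alpha> * 1"
    using a by (intro mult_left_mono) auto
  then have "\<alpha> * turning_point \<beta> \<le> 1"
    using a by (simp add: turning_point_def algebra_simps inverse_eq_divide)
  moreover have "\<alpha> * x \<ge> 0" "\<alpha> * x \<le> \<alpha> * turning_point \<beta>"
    using a x True by (auto intro: mult_left_mono)
  ultimately show ?thesis
    using True by (simp add: skew_tent_def algebra_simps)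
next
  case False
  have b: "\<beta> > 1" using assms(1) by (auto simp: skew_tent_params_def)
  have "\<beta> * turning_point \<beta> = \<beta> - 1"
    using b by (simp add: turning_point_def field_simps)
  moreover have "\<beta> * x \<le> \<beta> * 1" "\<beta> * turning_point \<beta> \<le> \<beta> * x"
    using b x False by (auto intro!: mult_left_mono)
  ultimately show ?thesis
    using False by (simp add: skew_tent_def algebra_simps)
qed

abbreviation unit_borel :: "real measure" where
  "unit_borel \<equiv> restrict_space borel {0..1}"

definition acip :: "(real \<Rightarrow> real) \<Rightarrow> real measure \<Rightarrow> bool" where
  "acip T \<mu> \<longleftrightarrow>
     prob_space \<mu> \<and> sets \<mu> = sets unit_borel \<and>
     absolutely_continuous (restrict_space lborel {0..1}) \<mu> \<and>
     T \<in> measurable \<mu> \<mu> \<and> distr \<mu> \<mu> T = \<mu>"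

text \<open>The averaged sum of Dirac measures along the first \<open>n\<close> points of the orbit of \<open>x\<close>, obtained
  as the image of the uniform distribution on the indices \<open>{..<n}\<close>; see
  \<open>emeasure_empirical_measure\<close>. For \<open>n = 0\<close> this is the null measure.\<close>

definition empirical_measure :: "(real \<Rightarrow> real) \<Rightarrow> real \<Rightarrow> nat \<Rightarrow> real measure" where
  "empirical_measure T x n =
     distr (uniform_count_measure {..<n}) unit_borel (\<lambda>i. (T ^^ i) x)"

definition weak_star_conv :: "(nat \<Rightarrow> real measure) \<Rightarrow> real measure \<Rightarrow> bool" where
  "weak_star_conv M \<mu> \<longleftrightarrow>
     (\<forall>f :: real \<Rightarrow> real. continuous_on {0..1} f \<longrightarrow>
        (\<lambda>n. integral\<^sup>L (M n) f) \<longlonglongrightarrow> integral\<^sup>L \<mu> f)"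

definition typical :: "(real \<Rightarrow> real) \<Rightarrow> real measure \<Rightarrow> real \<Rightarrow> bool" where
  "typical T \<mu> x \<longleftrightarrow> weak_star_conv (empirical_measure T x) \<mu>"

lemma funpow_unit_interval:
  fixes T :: "real \<Rightarrow> real"
  assumes "T \<in> {0..1} \<rightarrow> {0..1}" "x \<in> {0..1}"
  shows "(T ^^ i) x \<in> {0..1}"
proof (induction i)
  case (Suc i)
  then show ?case using assms(1) by (auto simp: Pi_iff)
qed (use assms in simp)

lemma emeasure_empirical_measure:
  assumes "T \<in> {0..1} \<rightarrow> {0..1}" "x \<in> {0..1}" "n > 0" "A \<in> sets unit_borel"
  shows "emeasure (empirical_measure T x n) A =
    (\<Sum>i<n. emeasure (return unit_borel ((T ^^ i) x)) A) / of_nat n"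
proof -
  have m: "(\<lambda>i. (T ^^ i) x) \<in> measurable (uniform_count_measure {..<n}) unit_borel"
    using funpow_unit_interval[OF assms(1,2)]
    by (auto simp: measurable_def space_uniform_count_measure sets_uniform_count_measure
        space_restrict_space)
  let ?S = "(\<lambda>i. (T ^^ i) x) -` A \<inter> {..<n}"
  have "emeasure (empirical_measure T x n) A = emeasure (uniform_count_measure {..<n}) ?S"
    using m assms(4) by (simp add: empirical_measure_def emeasure_distr space_uniform_count_measure)
  also have "\<dots> = ennreal (real (card ?S) / real n)"
    by (subst emeasure_uniform_count_measure) auto
  also have "\<dots> = of_nat (card ?S) / of_nat n"
    using assms(3) by (simp add: divide_ennreal[symmetric] ennreal_of_nat_eq_real_of_nat)
  also have "(of_nat (card ?S) :: ennreal) = (\<Sum>i<n. indicator A ((T ^^ i) x))"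
  proof -
    have "(\<Sum>i<n. indicator A ((T ^^ i) x)) = (\<Sum>i\<in>?S. 1 :: ennreal)"
      by (intro sum.mono_neutral_cong_right) (auto simp: indicator_def)
    then show ?thesis by simp
  qed
  finally show ?thesis using assms(4) by simp
qed

end

theory Submission imports Defs begin

text \<open>
  By compactness it suffices that for almost every parameter \<open>a\<close> the orbit of the turning point
  visits each interval \<open>B\<close> with upper frequency at most \<open>C |B|\<close>: every limit of the empirical measures is
  then invariant and absolutely continuous, hence equal to \<open>\<mu> a\<close>.

  The derivative with respect to \<open>a\<close> of the \<open>n\<close>-th iterate of the turning point is unbounded; for maps that
  are not renormalizable this follows by estimating a geometric-type series, and the other maps reduce to
  these by renormalization. Hence all but countably many parameters have a turning point whose orbit has no
  coincidences, and near such a parameter the iterates are expanding functions of \<open>a\<close> with bounded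
  distortion. Cut a small parameter interval into the cells on which the first \<open>n\<close> iterates avoid the turning
  point. An end of a cell created after level \<open>n\<close> is mapped onto the critical orbit, so new cells have long images
  except near the two ends of the old cell; this yields a Lyapunov inequality for the reciprocal of the length of
  the image. Two supermartingales together with Borel-Cantelli then bound first the frequency of short
  images and then the frequency of visits to \<open>B\<close>.

  The same analysis in phase space shows that a set of positive measure that is invariant up to null sets
  contains, up to a null set, a neighbourhood of the turning point. Two different absolutely continuous
  invariant measures would give two disjoint sets of this kind.
\<close>

section \<open>Transversality\<close>

text \<open>In the coordinate \<open>y = \<beta> (x - c)\<close> the turning point is \<open>0\<close> and the branches become
  \<open>1 + \<alpha> y\<close> and \<open>1 - \<beta> y\<close>. Here \<open>y\<close> is the orbit of the critical value and \<open>d\<close> its derivative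
  in the parameter direction \<open>(a', b')\<close>. Both branches are allowed at \<open>y n = 0\<close>, because
  renormalization reverses orientation and so exchanges the two sides of \<open>0\<close>.\<close>

definition pseudo_orbit :: "real \<Rightarrow> real \<Rightarrow> real \<Rightarrow> real \<Rightarrow> (nat \<Rightarrow> real) \<Rightarrow> (nat \<Rightarrow> real) \<Rightarrow> bool" where
  "pseudo_orbit a b a' b' y d \<longleftrightarrow> y 0 = 1 \<and> d 0 = 0 \<and>
     (\<forall>n. y n \<le> 0 \<and> y (Suc n) = 1 + a * y n \<and> d (Suc n) = a * d n + a' * y n
        \<or> y n \<ge> 0 \<and> y (Suc n) = 1 - b * y n \<and> d (Suc n) = - b * d n - b' * y n)"

text \<open>With \<open>s\<close> the slopes along the orbit, \<open>wsum\<close> gives \<open>d\<close> divided by the product of the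
  slopes. Its part coming from \<open>b'\<close> is bounded directly; for the part coming from \<open>a'\<close> the terms
  of the first run of left branches, collected in \<open>lsum\<close>, dominate the rest.\<close>

primrec wsum :: "(nat \<Rightarrow> real) \<Rightarrow> (nat \<Rightarrow> real) \<Rightarrow> nat \<Rightarrow> nat \<Rightarrow> real" where
  "wsum g s 0 i = 0"
| "wsum g s (Suc k) i = g i + wsum g s k (Suc i) / s i"

primrec lsum :: "real \<Rightarrow> nat \<Rightarrow> real \<Rightarrow> real" where
  "lsum a 0 y = 0"
| "lsum a (Suc k) y = (if y < 0 then - y + lsum a k (1 + a * y) / a else 0)"

lemma lsum_nonneg: "a > 0 \<Longrightarrow> lsum a k y \<ge> 0"
proof (induction k arbitrary: y)
  case (Suc k)
  then have "lsum a k (1 + a * y) / a \<ge> 0" by simp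
  then show ?case by (simp del: zero_le_divide_iff)
qed simp

lemma lsum_antimono: "a > 0 \<Longrightarrow> y \<le> y' \<Longrightarrow> lsum a k y' \<le> lsum a k y"
proof (induction k arbitrary: y y')
  case (Suc k)
  have *: "lsum a k (1 + a * y') / a \<le> lsum a k (1 + a * y) / a"
    using Suc by (intro divide_right_mono Suc.IH) auto
  have "lsum a k (1 + a * y) / a \<ge> 0"
    using Suc.prems lsum_nonneg by simp
  with * Suc.prems show ?case by auto
qed simp

lemma lsum_mono: "a > 0 \<Longrightarrow> lsum a k y \<le> lsum a (Suc k) y"
proof (induction k arbitrary: y)
  case (Suc k)
  have "lsum a k (1 + a * y) / a \<le> lsum a (Suc k) (1 + a * y) / a"
    using Suc by (intro divide_right_mono) auto
  then show ?case by (simp del: lsum.simps(2) add: lsum.simps(2)[of a k y] lsum.simps(2)[of a "Suc k" y])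
qed auto

locale signed_orbit =
  fixes a b :: real and y s :: "nat \<Rightarrow> real"
  assumes a: "a > 1" and b: "b > 1" and ab: "a * b \<le> a + b"
    and y0: "y 0 = 1"
    and step: "\<And>n. y n \<le> 0 \<and> s n = a \<or> y n \<ge> 0 \<and> s n = - b"
    and ySuc: "\<And>n. y (Suc n) = 1 + s n * y n"
begin

lemma range: "1 - b \<le> y n" "y n \<le> 1"
proof -
  have "1 - b \<le> y n \<and> y n \<le> 1"
  proof (induction n)
    case (Suc n)
    then have h: "1 - b \<le> y n" "y n \<le> 1" by auto
    show ?case using step[of n]
    proof
      assume A: "y n \<le> 0 \<and> s n = a"
      then have "a * y n \<le> 0" using a by (simp add: mult_nonneg_nonpos)
      moreover have "a * (1 - b) \<le> a * y n" using h a by (intro mult_left_mono) auto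
      ultimately show ?thesis using A ySuc[of n] ab by (simp add: algebra_simps)
    next
      assume A: "y n \<ge> 0 \<and> s n = - b"
      then have "0 \<le> b * y n" "b * y n \<le> b * 1" using h b by (auto intro: mult_left_mono)
      then show ?thesis using A ySuc[of n] by simp
    qed
  qed (use y0 b in auto)
  then show "1 - b \<le> y n" "y n \<le> 1" by auto
qed

abbreviation "neg \<equiv> wsum (\<lambda>i. max 0 (- y i)) s"
abbreviation "pos \<equiv> wsum (\<lambda>i. max 0 (y i)) s"

lemma s0: "s 0 = - b" using step[of 0] y0 by auto
lemma y1: "y (Suc 0) = 1 - b" using ySuc[of 0] s0 y0 by simp
lemma s1: "s (Suc 0) = a" using step[of "Suc 0"] y1 b by auto

lemma pos_bounds:
  defines "M \<equiv> b\<^sup>2 / (b\<^sup>2 - 1)"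
  shows "- M / b \<le> pos k i \<and> pos k i \<le> M"
proof (induction k arbitrary: i)
  have b2: "b\<^sup>2 > 1" using b by (simp add: one_less_power)
  have "X / (X - 1) > 0 \<and> X / (X - 1) = 1 + X / (X - 1) / X" if "X > 1" for X :: real
    using that by (simp add: divide_simps)
  from this[OF b2] have M: "M > 0" "M = 1 + M / b\<^sup>2"
    unfolding M_def by blast+
  {
    case 0
    then show ?case using M b by simp
  next
    case (Suc k)
    have ih: "- M / b \<le> pos k (Suc i)" "pos k (Suc i) \<le> M" using Suc by auto
    show ?case using step[of i]
    proof
      assume A: "y i \<le> 0 \<and> s i = a"
      have "- M / b \<le> (- M / b) / a" using M a b by (simp add: field_simps)
      also have "\<dots> \<le> pos k (Suc i) / a" using ih a by (intro divide_right_mono) auto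
      finally have 1: "- M / b \<le> pos k (Suc i) / a" .
      have "pos k (Suc i) / a \<le> M / a" using ih a by (intro divide_right_mono) auto
      also have "\<dots> \<le> M" using M a by (simp add: field_simps)
      finally show ?thesis using A 1 by simp
    next
      assume A: "y i \<ge> 0 \<and> s i = - b"
      have 1: "pos k (Suc i) / b \<le> M / b" using ih b by (intro divide_right_mono) auto
      have "(- M / b) / b \<le> pos k (Suc i) / b" using ih b by (intro divide_right_mono) auto
      then have "- M / b\<^sup>2 \<le> pos k (Suc i) / b" by (simp add: power2_eq_square)
      then show ?thesis using A 1 M(2) range(2)[of i] by simp
    qed
  }
qed

lemma pos_lower: "pos (Suc (Suc k)) 0 \<ge> 1 - b / (a * (b\<^sup>2 - 1))"
proof -
  have b2: "b\<^sup>2 > 1" using b by (simp add: one_less_power)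
  have "pos k (Suc (Suc 0)) \<le> b\<^sup>2 / (b\<^sup>2 - 1)" using pos_bounds by auto
  then have "pos k (Suc (Suc 0)) / (a * b) \<le> b\<^sup>2 / (b\<^sup>2 - 1) / (a * b)"
    using a b by (intro divide_right_mono) auto
  also have "\<dots> = b / (a * (b\<^sup>2 - 1))" using a b by (simp add: power2_eq_square)
  finally show ?thesis using y0 y1 s0 s1 a b by simp
qed

lemma neg_bounds:
  assumes ab2: "1 + b < a * b\<^sup>2"
  defines "M \<equiv> \<lambda>k. lsum a k (1 - b) * (a * b\<^sup>2 / (a * b\<^sup>2 - 1))"
  shows "if y i \<le> 0 \<and> s i = a
    then lsum a k (y i) - M k / (a * b) \<le> neg k i \<and> neg k i \<le> lsum a k (y i) + M k / (a * b\<^sup>2)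
    else - M k / b \<le> neg k i \<and> neg k i \<le> M k / b\<^sup>2"
proof (induction k arbitrary: i)
  case 0
  then show ?case by (simp add: M_def)
next
  case (Suc k)
  have q: "a * b\<^sup>2 - 1 > 0" using ab2 b by simp
  have M0: "M k \<ge> 0" for k using q a lsum_nonneg[of a k "1-b"] by (simp add: M_def)
  have Mm: "M k \<le> M (Suc k)" using q a lsum_mono[of a k "1-b"] unfolding M_def by (intro mult_right_mono) auto
  have Meq: "M k = lsum a k (1 - b) + M k / (a * b\<^sup>2)" for k
  proof -
    have "w * (X / (X - 1)) = w + w * (X / (X - 1)) / X" if "X > 1" for w X :: real
      using that by (simp add: divide_simps) (simp add: algebra_simps)
    from this[of "a * b\<^sup>2" "lsum a k (1 - b)"] show ?thesis using ab2 b unfolding M_def by linarith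
  qed
  have b1: "M k / b\<^sup>2 \<le> M k" "M k / b\<^sup>2 \<ge> 0" using M0[of k] b by (auto simp: divide_le_eq mult_le_cancel_left1)
  have b2: "M k / (a * b) \<le> M k / b" using M0[of k] a b
    by (intro divide_left_mono) auto
  have dm: "M k / c \<le> M (Suc k) / c" if "c > 0" for c using Mm that by (intro divide_right_mono) auto
  have U: "neg k j \<le> M k" and L: "- M k / b \<le> neg k j" for j
  proof -
    have "lsum a k (y j) \<le> lsum a k (1 - b)" using range a by (intro lsum_antimono) auto
    then show "neg k j \<le> M k" using Suc[of j] b1 Meq[of k] by (auto split: if_splits)
    have "0 \<le> lsum a k (y j)" using a by (intro lsum_nonneg) auto
    then show "- M k / b \<le> neg k j" using Suc[of j] b2 by (auto split: if_splits)
  qed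
  show ?case
  proof (cases "y i \<le> 0 \<and> s i = a")
    case True
    let ?j = "Suc i"
    have yj: "y ?j = 1 + a * y i" using True ySuc by auto
    have n: "neg (Suc k) i = - y i + neg k ?j / a" using True by simp
    have l: "lsum a (Suc k) (y i) = - y i + (if y i < 0 then lsum a k (y ?j) / a else 0)"
      using True yj by auto
    have "lsum a k (y ?j) = 0" if "y ?j > 0" using that by (cases k) auto
    then have l: "lsum a (Suc k) (y i) = - y i + lsum a k (y ?j) / a"
      using l True yj by (cases "y i = 0") auto
    have "lsum a k (y ?j) - M k / b \<le> neg k ?j \<and> neg k ?j \<le> lsum a k (y ?j) + M k / b\<^sup>2"
    proof (cases "y ?j \<le> 0 \<and> s ?j = a")
      case True
      have "M k / (a * b\<^sup>2) \<le> M k / b\<^sup>2"  using M0[of k] a b by (intro divide_left_mono) auto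
      then show ?thesis using True Suc[of ?j] b2 by auto
    next
      case False
      have "lsum a k (y ?j) = 0" using step[of ?j] False by (cases k) auto
      then show ?thesis using False Suc[of ?j] by auto
    qed
    then have "(lsum a k (y ?j) - M k / b) / a \<le> neg k ?j / a"
      "neg k ?j / a \<le> (lsum a k (y ?j) + M k / b\<^sup>2) / a"
      using a by (auto intro!: divide_right_mono)
    then have "lsum a k (y ?j) / a - M k / (a * b) \<le> neg k ?j / a \<and>
       neg k ?j / a \<le> lsum a k (y ?j) / a + M k / (a * b\<^sup>2)"
      using a by (simp add: add_divide_distrib diff_divide_distrib mult.commute)
    then show ?thesis using True n l dm[of "a * b"] dm[of "a * b\<^sup>2"] a b by auto
  next
    case False
    then have F: "y i \<ge> 0" "s i = - b" using step[of i] by auto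
    then have n: "neg (Suc k) i = - (neg k (Suc i) / b)" by simp
    have "neg k (Suc i) / b \<le> M k / b" "(- M k / b) / b \<le> neg k (Suc i) / b"
      using U[of "Suc i"] L[of "Suc i"] b by (auto intro: divide_right_mono simp only:)
    then show ?thesis using False n dm[of b] dm[of "b\<^sup>2"] b by (auto simp: power2_eq_square)
  qed
qed

lemma neg_lower:
  assumes ab2: "1 + b < a * b\<^sup>2"
  shows "neg (Suc (Suc k)) 0 \<le> - (1 - b / (a * b\<^sup>2 - 1)) * (b - 1) / b"
proof -
  define S where "S = lsum a (Suc k) (1 - b)"
  have q: "a * b\<^sup>2 - 1 > 0" using ab2 b by simp
  have S: "S \<ge> b - 1" using b a lsum_nonneg[of a k] by (simp add: S_def)
  have "neg (Suc k) (Suc 0) \<ge> S - S * (a * b\<^sup>2 / (a * b\<^sup>2 - 1)) / (a * b)"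
    using neg_bounds[OF ab2, of "Suc 0" "Suc k"] y1 s1 b unfolding S_def by (auto simp del: lsum.simps wsum.simps)
  also have "S - S * (a * b\<^sup>2 / (a * b\<^sup>2 - 1)) / (a * b) = S * (1 - b / (a * b\<^sup>2 - 1))"
    using q a b by (simp add: field_simps power2_eq_square)
  finally have 1: "neg (Suc k) (Suc 0) \<ge> S * (1 - b / (a * b\<^sup>2 - 1))" .
  have "1 - b / (a * b\<^sup>2 - 1) \<ge> 0" using ab2 q by (simp add: field_simps)
  then have "(1 - b / (a * b\<^sup>2 - 1)) * (b - 1) \<le> neg (Suc k) (Suc 0)"
    using mult_right_mono[OF S, of "1 - b / (a * b\<^sup>2 - 1)"] 1 by (simp add: mult.commute)
  then have "(1 - b / (a * b\<^sup>2 - 1)) * (b - 1) / b \<le> neg (Suc k) (Suc 0) / b"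
    using b by (intro divide_right_mono) auto
  moreover have "neg (Suc (Suc k)) 0 = - (neg (Suc k) (Suc 0) / b)"
    using y0 s0 by (simp del: wsum.simps add: wsum.simps(2)[of _ _ "Suc k"])
  ultimately show ?thesis by (simp del: wsum.simps only: minus_divide_left[symmetric] mult_minus_left neg_le_iff_le)
qed

end

lemma pseudo_orbit_unfold:
  assumes "pseudo_orbit a b a' b' y d" "a > 1" "b > 1"
  obtains s where "\<And>n. y n \<le> 0 \<and> s n = a \<or> y n \<ge> 0 \<and> s n = - b"
    "\<And>n. y (Suc n) = 1 + s n * y n"
    "\<And>n. d (Suc n) = s n * (d n - a' / a * max 0 (- y n) + b' / b * max 0 (y n))"
proof -
  have "\<forall>n. \<exists>s. (y n \<le> 0 \<and> s = a \<or> y n \<ge> 0 \<and> s = - b) \<and> y (Suc n) = 1 + s * y n \<and>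
    d (Suc n) = s * (d n - a' / a * max 0 (- y n) + b' / b * max 0 (y n))"
  proof
    fix n
    have "y n \<le> 0 \<and> y (Suc n) = 1 + a * y n \<and> d (Suc n) = a * d n + a' * y n
        \<or> y n \<ge> 0 \<and> y (Suc n) = 1 - b * y n \<and> d (Suc n) = - b * d n - b' * y n"
      using assms(1) unfolding pseudo_orbit_def by blast
    then show "\<exists>s. (y n \<le> 0 \<and> s = a \<or> y n \<ge> 0 \<and> s = - b) \<and> y (Suc n) = 1 + s * y n \<and>
      d (Suc n) = s * (d n - a' / a * max 0 (- y n) + b' / b * max 0 (y n))"
    proof
      assume "y n \<le> 0 \<and> y (Suc n) = 1 + a * y n \<and> d (Suc n) = a * d n + a' * y n"
      then show ?thesis using assms(2) by (intro exI[of _ a]) (auto simp: field_simps max_def)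
    next
      assume "y n \<ge> 0 \<and> y (Suc n) = 1 - b * y n \<and> d (Suc n) = - b * d n - b' * y n"
      then show ?thesis using assms(3) by (intro exI[of _ "-b"]) (auto simp: distrib_left)
    qed
  qed
  from choice[OF this] show ?thesis using that by blast
qed

lemma linear_recursion:
  fixes d s g :: "nat \<Rightarrow> real"
  assumes "\<And>n. d (Suc n) = s n * (d n + g n)" "\<And>n. s n \<noteq> 0"
  shows "d (i + k) = (\<Prod>j=i..<i+k. s j) * (d i + wsum g s k i)"
proof (induction k arbitrary: i)
  case (Suc k)
  have "d (i + Suc k) = d (Suc i + k)" by simp
  also have "\<dots> = (\<Prod>j=Suc i..<Suc i+k. s j) * (d (Suc i) + wsum g s k (Suc i))" by (rule Suc)
  also have "\<dots> = (\<Prod>j=Suc i..<Suc i+k. s j) * s i * (d i + g i + wsum g s k (Suc i) / s i)"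
    using assms(2)[of i] unfolding assms(1)[of i] by (simp add: field_simps)
  also have "(\<Prod>j=Suc i..<Suc i+k. s j) * s i = (\<Prod>j=i..<i+Suc k. s j)"
    by (simp add: prod.atLeast_Suc_lessThan[of i "Suc (i+k)"] mult.commute del: prod.op_ivl_Suc)
  finally show ?case by (simp add: add.assoc)
qed simp

lemma wsum_linear: "wsum (\<lambda>i. p * g i + q * h i) s k i = p * wsum g s k i + q * wsum h s k i"
  by (induction k arbitrary: i) (auto simp: algebra_simps add_divide_distrib)

lemma pseudo_orbit_growth_nonrenorm:
  assumes po: "pseudo_orbit a b a' b' y d" and a: "a > 1" and b: "b > 1" and ab: "a * b \<le> a + b"
    and a': "a' \<ge> 0" and b': "b' \<ge> 0" and nz: "a' > 0 \<or> b' > 0" and nr: "a + b < a * b\<^sup>2"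
  shows "\<exists>n. \<bar>d n\<bar> > K"
proof -
  obtain s where s: "\<And>n. y n \<le> 0 \<and> s n = a \<or> y n \<ge> 0 \<and> s n = - b"
    "\<And>n. y (Suc n) = 1 + s n * y n"
    "\<And>n. d (Suc n) = s n * (d n - a' / a * max 0 (- y n) + b' / b * max 0 (y n))"
    using pseudo_orbit_unfold[OF po a b] by metis
  have y0: "y 0 = 1" and d0: "d 0 = 0" using po by (auto simp: pseudo_orbit_def)
  interpret signed_orbit a b y s by unfold_locales (use a b ab y0 s in auto)
  define p q where "p = 1 - b / (a * (b\<^sup>2 - 1))" and "q = (1 - b / (a * b\<^sup>2 - 1)) * (b - 1) / b"
  have b2: "b\<^sup>2 > 1" using b by (simp add: one_less_power)
  have ab2: "1 + b < a * b\<^sup>2" using nr a by simp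
  have p: "p > 0" using nr b2 a by (simp add: p_def field_simps)
  have "1 - b / (a * b\<^sup>2 - 1) > 0" using ab2 b by (simp add: field_simps)
  then have q: "q > 0" using b by (simp add: q_def)
  define \<kappa> where "\<kappa> = a' / a * q + b' / b * p"
  have \<kappa>: "\<kappa> > 0"
  proof -
    have "a' / a * q \<ge> 0" "b' / b * p \<ge> 0" using a b a' b' p q by auto
    moreover have "a' / a * q > 0 \<or> b' / b * p > 0" using nz a b p q by auto
    ultimately show ?thesis unfolding \<kappa>_def by linarith
  qed
  have W: "wsum (\<lambda>n. - (a' / a) * max 0 (- y n) + b' / b * max 0 (y n)) s (Suc (Suc k)) 0 \<ge> \<kappa>" for k
  proof -
    have "neg (Suc (Suc k)) 0 \<le> - q" using neg_lower[OF ab2, of k] unfolding q_def minus_divide_left minus_mult_left .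
    then have "a' / a * neg (Suc (Suc k)) 0 \<le> a' / a * (- q)" using a a' by (intro mult_left_mono) auto
    moreover have "b' / b * pos (Suc (Suc k)) 0 \<ge> b' / b * p"
      using pos_lower[of k] b b' unfolding p_def by (intro mult_left_mono) auto
    ultimately show ?thesis unfolding wsum_linear \<kappa>_def by (simp del: wsum.simps)
  qed
  have sn: "\<bar>s n\<bar> \<ge> min a b" for n using s(1)[of n] a b by auto
  have snz: "s n \<noteq> 0" for n using sn[of n] a b by auto
  have "d (0 + k) = (\<Prod>j=0..<0+k. s j) *
     (d 0 + wsum (\<lambda>n. - (a' / a) * max 0 (- y n) + b' / b * max 0 (y n)) s k 0)" for k
    by (rule linear_recursion) (use s(3) snz in auto)
  then have dk: "d k = (\<Prod>j=0..<k. s j) *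
     wsum (\<lambda>n. - (a' / a) * max 0 (- y n) + b' / b * max 0 (y n)) s k 0" for k using d0 by simp
  have pr: "\<bar>\<Prod>j=0..<k. s j\<bar> \<ge> (min a b) ^ k" for k
  proof -
    have "(\<Prod>j=0..<k. min a b) \<le> (\<Prod>j=0..<k. \<bar>s j\<bar>)"
      using sn a b by (intro prod_mono) auto
    then show ?thesis by (simp add: abs_prod)
  qed
  obtain k where k: "K / \<kappa> < (min a b) ^ k" using real_arch_pow[of "min a b" "K / \<kappa>"] a b by auto
  have "K < (min a b) ^ k * \<kappa>" using k \<kappa> by (simp add: field_simps)
  also have "\<dots> \<le> (min a b) ^ (Suc (Suc k)) * \<kappa>"
    using a b \<kappa> by (intro mult_right_mono power_increasing) auto
  also have "\<dots> \<le> \<bar>d (Suc (Suc k))\<bar>"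
    unfolding dk abs_mult using pr[of "Suc (Suc k)"] W[of k] \<kappa> a b by (intro mult_mono) auto
  finally show ?thesis by blast
qed

text \<open>If \<open>a b\<^sup>2 \<le> a + b\<close>, the orbit alternates between the two sides of the fixed point
  \<open>1 / (1 + b)\<close>, and rescaling the second iterate by \<open>1 - b\<close> gives again an orbit in normal form.\<close>

lemma pseudo_orbit_renormalize:
  assumes po: "pseudo_orbit a b a' b' y d" and a: "a > 1" and b: "b > 1" and r: "a + b \<ge> a * b\<^sup>2"
  shows "pseudo_orbit (b\<^sup>2) (a * b) (2 * b * b') (a' * b + a * b')
     (\<lambda>n. y (2 * n + 1) / (1 - b)) (\<lambda>n. (d (2 * n + 1) + b' * (y (2 * n + 1) / (1 - b))) / (1 - b))"
proof -
  have y0: "y 0 = 1" and d0: "d 0 = 0" using po by (auto simp: pseudo_orbit_def)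
  have st: "y n \<le> 0 \<and> y (Suc n) = 1 + a * y n \<and> d (Suc n) = a * d n + a' * y n
        \<or> y n \<ge> 0 \<and> y (Suc n) = 1 - b * y n \<and> d (Suc n) = - b * d n - b' * y n" for n
    using po unfolding pseudo_orbit_def by blast
  define p where "p = 1 / (1 + b)"
  have p: "p > 0" "1 - b * p = p" using b by (auto simp: p_def field_simps)
  have ap: "1 + a * (1 - b) \<ge> p" using r b by (simp add: p_def field_simps power2_eq_square)
  have even: "p \<le> y (2 * n) \<and> y (2 * n) \<le> 1" for n
  proof (induction n)
    case 0
    then show ?case using y0 b by (simp add: p_def)
  next
    case (Suc n)
    let ?u = "y (2 * n)" and ?v = "y (Suc (2 * n))"
    have v: "?v = 1 - b * ?u" using st[of "2 * n"] Suc p by auto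
    have "b * p \<le> b * ?u" "b * ?u \<le> b * 1" using Suc b by (auto intro: mult_left_mono simp del: mult_1_right)
    then have v2: "1 - b \<le> ?v" "?v \<le> p" using v p by auto
    have S: "y (2 * Suc n) = y (Suc (Suc (2 * n)))" by simp
    from st[of "Suc (2 * n)"] show ?case
    proof
      assume A: "?v \<le> 0 \<and> y (Suc (Suc (2 * n))) = 1 + a * ?v \<and> d (Suc (Suc (2 * n))) = a * d (Suc (2 * n)) + a' * ?v"
      have "a * (1 - b) \<le> a * ?v" using v2 a by (intro mult_left_mono) auto
      moreover have "a * ?v \<le> 0" using A a by (simp add: mult_nonneg_nonpos)
      ultimately show ?thesis using A ap S by auto
    next
      assume A: "?v \<ge> 0 \<and> y (Suc (Suc (2 * n))) = 1 - b * ?v \<and> d (Suc (Suc (2 * n))) = - b * d (Suc (2 * n)) - b' * ?v"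
      have "b * ?v \<le> b * p" using v2 b by (intro mult_left_mono) auto
      moreover have "0 \<le> b * ?v" using A b by simp
      ultimately show ?thesis using A p S by auto
    qed
  qed
  have rt: "y (Suc (2 * n)) = 1 - b * y (2 * n) \<and> d (Suc (2 * n)) = - b * d (2 * n) - b' * y (2 * n)" for n
    using st[of "2 * n"] even[of n] p by auto
  have 0: "y 1 = 1 - b" "d 1 = - b'" using rt[of 0] y0 d0 by auto
  show ?thesis unfolding pseudo_orbit_def
  proof (intro conjI allI)
    show "y (2 * 0 + 1) / (1 - b) = 1" using 0 b by simp
    show "(d (2 * 0 + 1) + b' * (y (2 * 0 + 1) / (1 - b))) / (1 - b) = 0" using 0 b by simp
  next
    fix n
    let ?z = "\<lambda>n. y (2 * n + 1) / (1 - b)" and ?e = "\<lambda>n. (d (2 * n + 1) + b' * (y (2 * n + 1) / (1 - b))) / (1 - b)"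
    let ?v = "y (2 * n + 1)" and ?dv = "d (2 * n + 1)"
    have nb: "1 - b < 0" "1 - b \<noteq> 0" using b by auto
    have yy: "y (2 * Suc n + 1) = 1 - b * y (Suc (2 * n + 1))"
      and dd: "d (2 * Suc n + 1) = - b * d (Suc (2 * n + 1)) - b' * y (Suc (2 * n + 1))" using rt[of "Suc n"] by auto
    from st[of "2 * n + 1"] show "?z n \<le> 0 \<and> ?z (Suc n) = 1 + b\<^sup>2 * ?z n \<and> ?e (Suc n) = b\<^sup>2 * ?e n + 2 * b * b' * ?z n \<or>
         0 \<le> ?z n \<and> ?z (Suc n) = 1 - a * b * ?z n \<and> ?e (Suc n) = - (a * b) * ?e n - (a' * b + a * b') * ?z n"
    proof
      assume A: "?v \<le> 0 \<and> y (Suc (2 * n + 1)) = 1 + a * ?v \<and> d (Suc (2 * n + 1)) = a * ?dv + a' * ?v"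
      have "0 \<le> ?z n" using A nb by (simp add: divide_nonpos_neg)
      moreover have "?z (Suc n) = 1 - a * b * ?z n" unfolding yy using A nb by (simp add: field_simps)
      moreover have "?e (Suc n) = - (a * b) * ?e n - (a' * b + a * b') * ?z n"
        unfolding yy dd using A nb by (simp add: divide_simps) (simp add: algebra_simps power2_eq_square)
      ultimately show ?thesis by blast
    next
      assume A: "?v \<ge> 0 \<and> y (Suc (2 * n + 1)) = 1 - b * ?v \<and> d (Suc (2 * n + 1)) = - b * ?dv - b' * ?v"
      have "?z n \<le> 0" using A nb by (simp add: divide_nonneg_neg)
      moreover have "?z (Suc n) = 1 + b\<^sup>2 * ?z n" unfolding yy using A nb by (simp add: divide_simps) (simp add: algebra_simps power2_eq_square)
      moreover have "?e (Suc n) = b\<^sup>2 * ?e n + 2 * b * b' * ?z n"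
        unfolding yy dd using A nb by (simp add: divide_simps) (simp add: algebra_simps power2_eq_square)
      ultimately show ?thesis by blast
    qed
  qed
qed

theorem pseudo_orbit_growth:
  assumes "pseudo_orbit a b a' b' y d" "a > 1" "b > 1" "a * b \<le> a + b"
    and "a' \<ge> 0" "b' \<ge> 0" "a' > 0 \<or> b' > 0"
  shows "\<exists>n. \<bar>d n\<bar> > K"
proof -
  have main: "\<exists>n. \<bar>d n\<bar> > K"
    if "pseudo_orbit a b a' b' y d" "a > 1" "b > 1" "a * b \<le> a + b"
      "a' \<ge> 0" "b' \<ge> 0" "a' > 0 \<or> b' > 0" "(min a b) ^ (2 ^ k) \<ge> 2"
    for a b a' b' y d k K
    using that
  proof (induction k arbitrary: a b a' b' y d K)
    case 0
    then have ab: "a \<ge> 2" "b \<ge> 2" by auto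
    have "2 * b \<le> b * b" using ab by (intro mult_right_mono) auto
    then have h: "b * b - 1 > b / 2" "b * b - 1 \<ge> 0" using ab by linarith+
    have "2 * (b * b - 1) \<le> a * (b * b - 1)" using ab h by (intro mult_right_mono) auto
    then have "a + b < a * b\<^sup>2" using h by (simp add: power2_eq_square algebra_simps)
    then show ?case using pseudo_orbit_growth_nonrenorm 0 by blast
  next
    case (Suc k)
    show ?case
    proof (cases "a + b < a * b\<^sup>2")
      case True
      then show ?thesis using pseudo_orbit_growth_nonrenorm Suc.prems by blast
    next
      case False
      then have r: "a + b \<ge> a * b\<^sup>2" by simp
      note ab = Suc.prems(2,3)
      let ?z = "\<lambda>n. y (2 * n + 1) / (1 - b)" and ?e = "\<lambda>n. (d (2 * n + 1) + b' * (y (2 * n + 1) / (1 - b))) / (1 - b)"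
      have po: "pseudo_orbit (b\<^sup>2) (a * b) (2 * b * b') (a' * b + a * b') ?z ?e"
        by (rule pseudo_orbit_renormalize[OF Suc.prems(1) ab r])
      have b2: "b\<^sup>2 > 1" using ab by (simp add: one_less_power)
      have ab1: "a * b > 1" using ab by (simp add: less_1_mult)
      have dom: "b\<^sup>2 * (a * b) \<le> b\<^sup>2 + a * b"
        using mult_left_mono[OF r, of b] ab by (simp add: power2_eq_square algebra_simps)
      have dirs: "2 * b * b' \<ge> 0" "a' * b + a * b' \<ge> 0" "2 * b * b' > 0 \<or> a' * b + a * b' > 0"
        using Suc.prems ab by (auto simp: add_nonneg_nonneg add_pos_nonneg mult.commute)
      have m: "min (b\<^sup>2) (a * b) ^ 2 ^ k \<ge> 2"
      proof -
        have "(min a b)\<^sup>2 \<le> min (b\<^sup>2) (a * b)" using ab by (auto simp: power2_eq_square min_def intro: mult_mono)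
        then have "((min a b)\<^sup>2) ^ 2 ^ k \<le> min (b\<^sup>2) (a * b) ^ 2 ^ k" using ab by (intro power_mono) auto
        then show ?thesis using Suc.prems(8) by (simp add: power_mult[symmetric])
      qed
      obtain s where s: "\<And>n. y n \<le> 0 \<and> s n = a \<or> y n \<ge> 0 \<and> s n = - b"
        "\<And>n. y (Suc n) = 1 + s n * y n"
        using pseudo_orbit_unfold[OF Suc.prems(1) ab] by metis
      have y0: "y 0 = 1" using Suc.prems(1) by (simp add: pseudo_orbit_def)
      interpret signed_orbit a b y s by unfold_locales (use Suc.prems y0 s in auto)
      define K' where "K' = (K + b' * (1 + b) / (b - 1)) / (b - 1)"
      obtain n where n: "\<bar>?e n\<bar> > K'"
        using Suc.IH[OF po b2 ab1 dom dirs m, of K'] by auto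
      have "\<bar>y (2 * n + 1)\<bar> \<le> 1 + b" using range[of "2*n+1"] Suc.prems(2,3) by auto
      then have "b' * \<bar>y (2 * n + 1)\<bar> / (b - 1) \<le> b' * (1 + b) / (b - 1)"
        using Suc.prems(2,3,6) by (intro divide_right_mono mult_left_mono) auto
      then have "\<bar>b' * (y (2 * n + 1) / (1 - b))\<bar> \<le> b' * (1 + b) / (b - 1)"
        using Suc.prems(2,3,6) by (simp add: abs_mult)
      moreover have "\<bar>d (2 * n + 1) + b' * (y (2 * n + 1) / (1 - b))\<bar> > K + b' * (1 + b) / (b - 1)"
        using n Suc.prems(2,3) unfolding K'_def by (simp add: divide_less_eq less_divide_eq abs_minus_commute[of 1 b] del: times_divide_eq_right)
      ultimately have "\<bar>d (2 * n + 1)\<bar> > K" by linarith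
      then show ?thesis by blast
    qed
  qed
  obtain j where j: "2 < (min a b) ^ j" using real_arch_pow[of "min a b" 2] assms by auto
  have "(min a b) ^ j \<le> (min a b) ^ (2 ^ j)"
    using assms by (intro power_increasing) (auto intro: less_imp_le less_exp)
  then show ?thesis using main[OF assms, of j] j by auto
qed

section \<open>Cells and bounded distortion\<close>

definition tent :: "real \<Rightarrow> real \<Rightarrow> real \<Rightarrow> real" where
  "tent a b y = (if y \<le> 0 then 1 + a * y else 1 - b * y)"

lemma tent_range:
  assumes "a > 1" "b > 1" "a * b \<le> a + b" "1 - b \<le> y" "y \<le> 1"
  shows "1 - b \<le> tent a b y" "tent a b y \<le> 1"
proof -
  have "1 - b \<le> tent a b y \<and> tent a b y \<le> 1"
  proof (cases "y \<le> 0")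
    case True
    have "a * (1 - b) \<le> a * y" "a * y \<le> 0" using assms True by (auto intro!: mult_left_mono mult_nonneg_nonpos)
    then show ?thesis using True assms by (simp add: tent_def algebra_simps)
  next
    case False
    have "b * y \<le> b * 1" "0 \<le> b * y" using assms False by (auto intro!: mult_left_mono simp del: mult_1_right)
    then show ?thesis using False by (simp add: tent_def)
  qed
  then show "1 - b \<le> tent a b y" "tent a b y \<le> 1" by auto
qed

lemma tent_altdef: "tent a b y = 1 + a * min y 0 - b * max y 0"
  by (auto simp: tent_def min_def max_def)

type_synonym interval = "real \<times> real"

abbreviation len :: "interval \<Rightarrow> real" where "len w \<equiv> snd w - fst w"
abbreviation ivl :: "interval \<Rightarrow> real set" where "ivl w \<equiv> {fst w<..<snd w}"

lemma sum_len_eq_measure: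
  assumes "finite F" "\<And>w. w \<in> F \<Longrightarrow> fst w < snd w"
    and "disjoint_family_on ivl F"
  shows "(\<Sum>w\<in>F. len w) = measure lborel (\<Union>w\<in>F. ivl w)"
proof -
  have "measure lborel (\<Union>w\<in>F. ivl w) = (\<Sum>w\<in>F. measure lborel (ivl w))"
    by (rule measure_finite_Union) (use assms in \<open>auto simp: emeasure_lborel_Ioo less_imp_le\<close>)
  also have "\<dots> = (\<Sum>w\<in>F. len w)" using assms(2) by (intro sum.cong) (auto simp: less_imp_le)
  finally show ?thesis ..
qed

lemma sum_len_le:
  assumes "finite F" "\<And>w. w \<in> F \<Longrightarrow> fst w < snd w \<and> p \<le> fst w \<and> snd w \<le> q"
    and "disjoint_family_on ivl F" "p \<le> q"
  shows "(\<Sum>w\<in>F. len w) \<le> q - p"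
proof -
  have "(\<Sum>w\<in>F. len w) = measure lborel (\<Union>w\<in>F. ivl w)"
    using assms by (intro sum_len_eq_measure) auto
  also have "\<dots> \<le> measure lborel {p..q}"
  proof (rule measure_mono_fmeasurable)
    show "(\<Union>w\<in>F. ivl w) \<subseteq> {p..q}" using assms(2) by fastforce
    show "(\<Union>w\<in>F. ivl w) \<in> sets lborel" using assms(1) by auto
    show "{p..q} \<in> fmeasurable lborel" using fmeasurable_cbox[of p q] by simp
  qed
  finally show ?thesis using assms(4) by simp
qed

lemma sum_Un_le:
  fixes f :: "'a \<Rightarrow> real"
  assumes "finite A" "finite B" "\<And>x. x \<in> A \<inter> B \<Longrightarrow> f x \<ge> 0"
  shows "sum f (A \<union> B) \<le> sum f A + sum f B"
  using sum.union_inter[OF assms(1,2), of f] sum_nonneg[of "A \<inter> B" f] assms(3) by simp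

text \<open>The curve \<open>t \<mapsto> x0 t\<close> is iterated by the tent map with parameters \<open>(al t, be t)\<close>. Two cases
  matter: \<open>t\<close> is the parameter and \<open>x0\<close> a late iterate of the turning point, so that \<open>x0'\<close> is large;
  or the parameters are constant (\<open>L = 0\<close>) and \<open>t\<close> runs through phase space.\<close>

locale tent_curve =
  fixes al be al' be' x0 x0' :: "real \<Rightarrow> real" and u0 v0 lam Lam L K0 :: real
  assumes uv: "u0 < v0" and lam: "lam > 1"
    and params: "\<And>t. t \<in> {u0..v0} \<Longrightarrow>
      lam \<le> al t \<and> al t \<le> Lam \<and> lam \<le> be t \<and> be t \<le> Lam \<and> al t * be t \<le> al t + be t"
    and al_deriv: "\<And>t. t \<in> {u0..v0} \<Longrightarrow> (al has_real_derivative al' t) (at t within {u0..v0})"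
    and be_deriv: "\<And>t. t \<in> {u0..v0} \<Longrightarrow> (be has_real_derivative be' t) (at t within {u0..v0})"
    and x0_deriv: "\<And>t. t \<in> {u0..v0} \<Longrightarrow> (x0 has_real_derivative x0' t) (at t within {u0..v0})"
    and L: "\<And>t. t \<in> {u0..v0} \<Longrightarrow> \<bar>al' t\<bar> \<le> L \<and> \<bar>be' t\<bar> \<le> L"
    and x0_range: "\<And>t. t \<in> {u0..v0} \<Longrightarrow> 1 - be t \<le> x0 t \<and> x0 t \<le> 1"
    and K0: "K0 > 0" "4 * L * Lam \<le> K0" "2 * L * Lam \<le> K0 * (lam - 1)"
    and x0'_large: "\<And>t. t \<in> {u0..v0} \<Longrightarrow> K0 \<le> \<bar>x0' t\<bar>"
    and x0'_ratio: "\<And>s t. s \<in> {u0..v0} \<Longrightarrow> t \<in> {u0..v0} \<Longrightarrow> \<bar>x0' s\<bar> \<le> 2 * \<bar>x0' t\<bar>"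
begin

primrec z :: "nat \<Rightarrow> real \<Rightarrow> real" where
  "z 0 t = x0 t"
| "z (Suc n) t = tent (al t) (be t) (z n t)"

primrec d :: "nat \<Rightarrow> real \<Rightarrow> real" where
  "d 0 t = x0' t"
| "d (Suc n) t = (if z n t \<le> 0 then al t * d n t + al' t * z n t else - be t * d n t - be' t * z n t)"

lemma L_nonneg: "L \<ge> 0"
  using L[of u0] uv by auto

lemma Lam: "Lam > 1"
  using params[of u0] uv lam by auto

lemma z_range: "t \<in> {u0..v0} \<Longrightarrow> 1 - be t \<le> z n t \<and> z n t \<le> 1"
proof (induction n)
  case (Suc n)
  then show ?case using tent_range[of "al t" "be t" "z n t"] params[of t] lam by auto
qed (use x0_range in auto)

lemma z_bounds: "t \<in> {u0..v0} \<Longrightarrow> 1 - Lam \<le> z n t \<and> z n t \<le> 1"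
  using z_range[of t n] params[of t] by auto

lemma z_abs: "t \<in> {u0..v0} \<Longrightarrow> \<bar>z n t\<bar> \<le> Lam"
  using z_bounds[of t n] Lam by auto

lemma z_diff: "s \<in> {u0..v0} \<Longrightarrow> t \<in> {u0..v0} \<Longrightarrow> \<bar>z n s - z n t\<bar> \<le> Lam"
  using z_bounds[of t n] z_bounds[of s n] by auto

lemma continuous_params:
  "continuous_on {u0..v0} al" "continuous_on {u0..v0} be" "continuous_on {u0..v0} x0"
  by (rule DERIV_continuous_on, erule al_deriv) (rule DERIV_continuous_on, erule be_deriv, rule DERIV_continuous_on, erule x0_deriv)

lemma continuous_z: "continuous_on {u0..v0} (z n)"
proof (induction n)
  case 0
  then show ?case using continuous_params by (simp add: continuous_on_cong[OF refl z.simps(1)])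
next
  case (Suc n)
  have "continuous_on {u0..v0} (\<lambda>t. 1 + al t * min (z n t) 0 - be t * max (z n t) 0)"
    by (intro continuous_intros continuous_params Suc)
  then show ?case by (simp add: tent_altdef)
qed

definition mu :: real where "mu = (1 + lam) / 2"

lemma mu: "mu > 1" using lam by (simp add: mu_def)

lemma d_large: "t \<in> {u0..v0} \<Longrightarrow> K0 \<le> \<bar>d n t\<bar> \<and> mu * \<bar>d n t\<bar> \<le> \<bar>d (Suc n) t\<bar>"
proof -
  assume t: "t \<in> {u0..v0}"
  have step: "mu * \<bar>d n t\<bar> \<le> \<bar>d (Suc n) t\<bar>" if "K0 \<le> \<bar>d n t\<bar>" for n
  proof -
    have zz: "\<bar>al' t * z n t\<bar> \<le> L * Lam" "\<bar>be' t * z n t\<bar> \<le> L * Lam"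
      using z_abs[OF t, of n] L[OF t] L_nonneg by (auto simp: abs_mult intro!: mult_mono)
    have "lam * \<bar>d n t\<bar> \<le> al t * \<bar>d n t\<bar>" "lam * \<bar>d n t\<bar> \<le> be t * \<bar>d n t\<bar>"
      using params[OF t] by (auto intro!: mult_right_mono)
    moreover have "al t * \<bar>d n t\<bar> = \<bar>al t * d n t\<bar>" "be t * \<bar>d n t\<bar> = \<bar>- be t * d n t\<bar>"
      using params[OF t] lam by (auto simp: abs_mult)
    ultimately have *: "lam * \<bar>d n t\<bar> \<le> \<bar>al t * d n t\<bar>" "lam * \<bar>d n t\<bar> \<le> \<bar>- be t * d n t\<bar>"
      by auto
    have 1: "lam * \<bar>d n t\<bar> - L * Lam \<le> \<bar>d (Suc n) t\<bar>"
    proof (cases "z n t \<le> 0")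
      case True
      then have "d (Suc n) t = al t * d n t + al' t * z n t" by simp
      then show ?thesis using zz * by linarith
    next
      case False
      then have "d (Suc n) t = - be t * d n t - be' t * z n t" by simp
      then show ?thesis using zz * by linarith
    qed
    have "2 * (L * Lam) \<le> \<bar>d n t\<bar> * (lam - 1)"
      using K0(3) mult_right_mono[OF that, of "lam - 1"] lam by linarith
    then show ?thesis using 1 by (simp add: mu_def field_simps)
  qed
  have "K0 \<le> \<bar>d n t\<bar>"
  proof (induction n)
    case (Suc n)
    have "\<bar>d n t\<bar> \<le> mu * \<bar>d n t\<bar>" using mu by (simp add: mult_le_cancel_right1)
    then show ?case using step[OF Suc] Suc by linarith
  qed (use x0'_large[OF t] in auto)
  then show ?thesis using step by blast
qed

lemma d_nonzero: "t \<in> {u0..v0} \<Longrightarrow> d n t \<noteq> 0"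
  using d_large[of t n] K0(1) by auto

lemma d_growth: "t \<in> {u0..v0} \<Longrightarrow> mu ^ k * \<bar>d n t\<bar> \<le> \<bar>d (n + k) t\<bar>"
proof (induction k)
  case (Suc k)
  have "mu * (mu ^ k * \<bar>d n t\<bar>) \<le> mu * \<bar>d (n + k) t\<bar>" using Suc mu by (intro mult_left_mono) auto
  also have "\<dots> \<le> \<bar>d (n + Suc k) t\<bar>" using d_large[OF Suc.prems, of "n + k"] by simp
  finally show ?case by (simp add: mult.assoc)
qed simp

lemma d_growth0: "t \<in> {u0..v0} \<Longrightarrow> K0 * mu ^ n \<le> \<bar>d n t\<bar>"
proof -
  assume t: "t \<in> {u0..v0}"
  have "mu ^ n * K0 \<le> mu ^ n * \<bar>d 0 t\<bar>" using x0'_large[OF t] mu by (intro mult_left_mono) auto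
  also have "\<dots> \<le> \<bar>d n t\<bar>" using d_growth[OF t, of n 0] by simp
  finally show ?thesis by (simp add: mult.commute)
qed

lemma z_deriv:
  assumes "u0 < t" "t < v0" "\<And>i. i < n \<Longrightarrow> z i t \<noteq> 0"
  shows "(z n has_real_derivative d n t) (at t)"
  using assms(3)
proof (induction n)
  case 0
  have "z 0 = x0" by (rule ext) simp
  then show ?case using x0_deriv[of t] assms(1,2) by (simp add: at_within_Icc_at)
next
  case (Suc n)
  have D: "(z n has_real_derivative d n t) (at t)" using Suc by simp
  then have lim: "(z n \<longlongrightarrow> z n t) (nhds t)"
    using DERIV_isCont tendsto_at_iff_tendsto_nhds isCont_def by metis
  have al: "(al has_real_derivative al' t) (at t)" and be: "(be has_real_derivative be' t) (at t)"
    using al_deriv[of t] be_deriv[of t] assms(1,2) by (auto simp: at_within_Icc_at)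
  show ?case
  proof (cases "z n t < 0")
    case True
    have ev: "eventually (\<lambda>s. z n s < 0) (nhds t)" using order_tendstoD(2)[OF lim True] .
    have "((\<lambda>s. 1 + al s * z n s) has_real_derivative d (Suc n) t) (at t)"
      using True by (auto intro!: derivative_eq_intros D al)
    then show ?thesis
      by (subst DERIV_cong_ev[OF refl _ refl]) (use ev in eventually_elim, simp add: tent_def)
  next
    case False
    then have pos: "z n t > 0" using Suc.prems[of n] by simp
    have ev: "eventually (\<lambda>s. z n s > 0) (nhds t)" using order_tendstoD(1)[OF lim pos] .
    have "((\<lambda>s. 1 - be s * z n s) has_real_derivative d (Suc n) t) (at t)"
      using pos by (auto intro!: derivative_eq_intros D be)
    then show ?thesis
      by (subst DERIV_cong_ev[OF refl _ refl]) (use ev in eventually_elim, simp add: tent_def)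
  qed
qed

definition Zs :: "nat \<Rightarrow> real set" where
  "Zs n = {u0, v0} \<union> {t \<in> {u0..v0}. \<exists>i<n. z i t = 0}"

definition cells :: "nat \<Rightarrow> interval set" where
  "cells n = {w. fst w \<in> Zs n \<and> snd w \<in> Zs n \<and> fst w < snd w \<and> ivl w \<inter> Zs n = {}}"

definition subcells :: "nat \<Rightarrow> nat \<Rightarrow> interval \<Rightarrow> interval set" where
  "subcells n k w = {w' \<in> cells (n + k). fst w \<le> fst w' \<and> snd w' \<le> snd w}"

definition img :: "nat \<Rightarrow> interval \<Rightarrow> real" where
  "img n w = \<bar>z n (snd w) - z n (fst w)\<bar>"

text \<open>The Lyapunov function controlling how often the image of a cell is short.\<close>

definition V :: "nat \<Rightarrow> interval \<Rightarrow> real" where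
  "V n w = Lam / img n w"

lemma Zs_subset: "Zs n \<subseteq> {u0..v0}" using uv by (auto simp: Zs_def)

lemma Zs_mono: "m \<le> n \<Longrightarrow> Zs m \<subseteq> Zs n" by (auto simp: Zs_def intro: less_le_trans)

lemma cellD:
  assumes "w \<in> cells n"
  shows "u0 \<le> fst w" "fst w < snd w" "snd w \<le> v0"
    and "\<And>t i. t \<in> ivl w \<Longrightarrow> i < n \<Longrightarrow> z i t \<noteq> 0"
proof -
  show *: "u0 \<le> fst w" "fst w < snd w" "snd w \<le> v0"
    using assms Zs_subset[of n] by (auto simp: cells_def)
  show "z i t \<noteq> 0" if "t \<in> ivl w" "i < n" for t i
    using assms that * by (auto simp: cells_def Zs_def)
qed

lemma cell_mvt:
  assumes w: "w \<in> cells n" and st: "fst w \<le> s" "s < t" "t \<le> snd w" and m: "m \<le> n"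
  obtains r where "s < r" "r < t" "z m t - z m s = (t - s) * d m r"
proof -
  have der: "(z m has_real_derivative d m x) (at x)" if "s < x" "x < t" for x
    using that cellD[OF w] st m by (intro z_deriv) auto
  have "\<exists>l r. s < r \<and> r < t \<and> DERIV (z m) r :> l \<and> z m t - z m s = (t - s) * l"
  proof (rule MVT)
    show "continuous_on {s..t} (z m)"
      by (rule continuous_on_subset[OF continuous_z]) (use cellD[OF w] st in auto)
    show "z m differentiable at x" if "s < x" "x < t" for x
      using der[OF that] real_differentiable_def by blast
  qed (use st in auto)
  then show ?thesis using der DERIV_unique that by metis
qed

lemma cell_inj:
  assumes w: "w \<in> cells n" and st: "fst w \<le> s" "s < t" "t \<le> snd w" and m: "m \<le> n"
  shows "z m s \<noteq> z m t"
proof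
  assume eq: "z m s = z m t"
  obtain r where r: "s < r" "r < t" "z m t - z m s = (t - s) * d m r" by (rule cell_mvt[OF w st m])
  then have "r \<in> {u0..v0}" using cellD[OF w] st by auto
  from d_nonzero[OF this, of m] show False using r eq st by auto
qed

lemma finite_cells: "finite (Zs n) \<Longrightarrow> finite (cells n)"
  by (rule finite_subset[of _ "Zs n \<times> Zs n"]) (auto simp: cells_def mem_Times_iff)

lemma cell_cover_aux:
  assumes fin: "finite (Zs n)" and t: "t \<in> {u0..v0}" "t \<notin> Zs n"
  shows "\<exists>w\<in>cells n. t \<in> ivl w"
proof -
  define a b where "a = Max {x \<in> Zs n. x < t}" and "b = Min {x \<in> Zs n. x > t}"
  have uvZ: "u0 \<in> Zs n" "v0 \<in> Zs n" by (auto simp: Zs_def)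
  then have ne: "u0 < t" "t < v0" using t by (auto simp: less_le)
  have fA: "finite {x \<in> Zs n. x < t}" "{x \<in> Zs n. x < t} \<noteq> {}"
   and fB: "finite {x \<in> Zs n. x > t}" "{x \<in> Zs n. x > t} \<noteq> {}"
    using fin uvZ ne by auto
  have a: "a \<in> Zs n" "a < t" using Max_in[OF fA] by (auto simp: a_def)
  have b: "b \<in> Zs n" "t < b" using Min_in[OF fB] by (auto simp: b_def)
  have "x \<notin> Zs n" if "a < x" "x < b" for x
  proof
    assume x: "x \<in> Zs n"
    show False
    proof (cases "x < t")
      case True
      then have "x \<le> a" using x fA unfolding a_def by (intro Max_ge) auto
      then show False using that by simp
    next
      case False
      then have "x > t" using x t by (cases "x = t") auto
      then have "b \<le> x" using x fB unfolding b_def by (intro Min_le) auto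
      then show False using that by simp
    qed
  qed
  then have "(a, b) \<in> cells n" using a b by (auto simp: cells_def)
  then show ?thesis using a b by (intro bexI[of _ "(a, b)"]) auto
qed

lemma finite_Zs: "finite (Zs n)"
proof (induction n)
  case 0
  then show ?case by (simp add: Zs_def)
next
  case (Suc n)
  have "Zs (Suc n) \<subseteq> Zs n \<union> (\<Union>w\<in>cells n. {t \<in> ivl w. z n t = 0})"
  proof
    fix t assume t: "t \<in> Zs (Suc n)"
    show "t \<in> Zs n \<union> (\<Union>w\<in>cells n. {t \<in> ivl w. z n t = 0})"
    proof (cases "t \<in> Zs n")
      case False
      then have "z n t = 0" using t by (auto simp: Zs_def less_Suc_eq)
      moreover obtain w where "w \<in> cells n" "t \<in> ivl w"
        using cell_cover_aux[OF Suc _ False] t Zs_subset by (metis subsetD)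
      ultimately show ?thesis by auto
    qed auto
  qed
  moreover have fin: "finite {t \<in> ivl w. z n t = 0}" if w: "w \<in> cells n" for w
  proof (cases "{t \<in> ivl w. z n t = 0} = {}")
    case True
    then show ?thesis by (simp only: finite.emptyI)
  next
    case False
    then obtain x where x: "x \<in> ivl w" "z n x = 0" by auto
    have "y = x" if "y \<in> ivl w" "z n y = 0" for y
    proof (rule ccontr)
      assume "y \<noteq> x"
      then consider "x < y" | "y < x" by linarith
      then show False
        by cases (use cell_inj[OF w, of x y n] cell_inj[OF w, of y x n] that x in auto)
    qed
    then have "{t \<in> ivl w. z n t = 0} \<subseteq> {x}" by blast
    then show ?thesis by (rule finite_subset) simp
  qed
  then have "finite (Zs n \<union> (\<Union>w\<in>cells n. {t \<in> ivl w. z n t = 0}))"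
    using Suc finite_cells[OF Suc] by blast
  ultimately show ?case by (rule finite_subset)
qed

lemmas cell_cover = cell_cover_aux[OF finite_Zs]

lemma finite_cells': "finite (cells n)" using finite_cells finite_Zs .

lemma finite_subcells: "finite (subcells n k w)"
  unfolding subcells_def using finite_cells' by auto

lemma cell_unique:
  assumes "w \<in> cells n" "w' \<in> cells n" "t \<in> ivl w" "t \<in> ivl w'"
  shows "w = w'"
proof -
  have "\<not> fst w < fst w'" "\<not> fst w' < fst w" "\<not> snd w < snd w'" "\<not> snd w' < snd w"
    using assms by (auto simp: cells_def disjoint_iff)
  then show ?thesis by (simp add: prod_eq_iff)
qed

lemma cells_disjoint: "F \<subseteq> cells n \<Longrightarrow> disjoint_family_on ivl F"
  unfolding disjoint_family_on_def
proof (intro ballI impI)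
  fix w w' assume F: "F \<subseteq> cells n" and w: "w \<in> F" "w' \<in> F" "w \<noteq> w'"
  show "ivl w \<inter> ivl w' = {}"
  proof (rule ccontr)
    assume "ivl w \<inter> ivl w' \<noteq> {}"
    then obtain t where "t \<in> ivl w" "t \<in> ivl w'" by (meson disjoint_iff)
    then show False using cell_unique[of w n w' t] w F by (meson subsetD)
  qed
qed

lemma cell_nested:
  assumes "w \<in> cells n" "w' \<in> cells (n + k)" "t \<in> ivl w" "t \<in> ivl w'"
  shows "w' \<in> subcells n k w"
proof -
  have "Zs n \<subseteq> Zs (n + k)" by (rule Zs_mono) simp
  then have "fst w \<in> Zs (n + k)" "snd w \<in> Zs (n + k)" using assms(1) by (auto simp: cells_def)
  moreover have "ivl w' \<inter> Zs (n + k) = {}" using assms(2) by (simp add: cells_def)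
  ultimately have "fst w \<notin> ivl w'" "snd w \<notin> ivl w'" by blast+
  then show ?thesis using assms by (simp add: subcells_def)
qed

abbreviation mid :: "interval \<Rightarrow> real" where "mid w \<equiv> (fst w + snd w) / 2"

lemma mid_in: "w \<in> cells n \<Longrightarrow> mid w \<in> ivl w"
  using cellD(2)[of w n] by (auto simp: field_simps)

lemma cell_parent:
  assumes "w' \<in> cells (n + k)"
  obtains w where "w \<in> cells n" "w' \<in> subcells n k w"
proof -
  have m: "mid w' \<in> ivl w'" by (rule mid_in[OF assms])
  have "ivl w' \<inter> Zs (n + k) = {}" using assms by (simp add: cells_def)
  moreover have "Zs n \<subseteq> Zs (n + k)" by (rule Zs_mono) simp
  ultimately have "mid w' \<notin> Zs n" using m by blast
  moreover have "mid w' \<in> {u0..v0}" using m cellD[OF assms] by auto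
  ultimately obtain w where w: "w \<in> cells n" "mid w' \<in> ivl w" using cell_cover[of "mid w'" n] by metis
  show ?thesis by (rule that[OF w(1) cell_nested[OF w(1) assms w(2) m]])
qed

lemma subcells_cells: "w' \<in> subcells n k w \<Longrightarrow> w' \<in> cells (n + k)" by (simp add: subcells_def)

lemma subcells_add: "w \<in> cells n \<Longrightarrow> subcells n (k + l) w \<subseteq> (\<Union>w1\<in>subcells n k w. subcells (n + k) l w1)"
proof
  fix w' assume w: "w \<in> cells n" and w': "w' \<in> subcells n (k + l) w"
  then have c: "w' \<in> cells (n + k + l)" by (metis subcells_cells add.assoc)
  obtain w1 where w1: "w1 \<in> cells (n + k)" "w' \<in> subcells (n + k) l w1" by (rule cell_parent[OF c])
  have m: "mid w' \<in> ivl w'" by (rule mid_in[OF c])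
  have "mid w' \<in> ivl w1" "mid w' \<in> ivl w" using m w1 w' by (auto simp: subcells_def)
  then have "w1 \<in> subcells n k w" by (intro cell_nested[OF w w1(1)])
  then show "w' \<in> (\<Union>w1\<in>subcells n k w. subcells (n + k) l w1)" using w1(2) by (rule UN_I)
qed

lemma sum_subcells_add:
  assumes "w \<in> cells n" "\<And>w'. w' \<in> cells (n + k + l) \<Longrightarrow> f w' \<ge> (0::real)"
  shows "(\<Sum>w'\<in>subcells n (k + l) w. f w') \<le> (\<Sum>w1\<in>subcells n k w. \<Sum>w'\<in>subcells (n + k) l w1. f w')"
proof -
  have "(\<Sum>w'\<in>subcells n (k + l) w. f w') \<le> (\<Sum>w'\<in>(\<Union>w1\<in>subcells n k w. subcells (n + k) l w1). f w')"
  proof (rule sum_mono2)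
    show "finite (\<Union>w1\<in>subcells n k w. subcells (n + k) l w1)" by (intro finite_UN_I finite_subcells)
    show "subcells n (k + l) w \<subseteq> (\<Union>w1\<in>subcells n k w. subcells (n + k) l w1)"
      by (rule subcells_add[OF assms(1)])
    fix b assume "b \<in> (\<Union>w1\<in>subcells n k w. subcells (n + k) l w1) - subcells n (k + l) w"
    then obtain w1 where "b \<in> subcells (n + k) l w1" by blast
    then show "f b \<ge> 0" by (intro assms(2) subcells_cells)
  qed
  also have "\<dots> = (\<Sum>w1\<in>subcells n k w. \<Sum>w'\<in>subcells (n + k) l w1. f w')"
  proof (rule sum.UNION_disjoint)
    show "\<forall>i\<in>subcells n k w. \<forall>j\<in>subcells n k w. i \<noteq> j \<longrightarrow> subcells (n + k) l i \<inter> subcells (n + k) l j = {}"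
    proof (intro ballI impI)
      fix i j assume ij: "i \<in> subcells n k w" "j \<in> subcells n k w" "i \<noteq> j"
      show "subcells (n + k) l i \<inter> subcells (n + k) l j = {}"
      proof (rule ccontr)
        assume "subcells (n + k) l i \<inter> subcells (n + k) l j \<noteq> {}"
        then obtain x where x: "x \<in> subcells (n + k) l i" "x \<in> subcells (n + k) l j" by blast
        have "mid x \<in> ivl x" by (rule mid_in[OF subcells_cells[OF x(1)]])
        then have "mid x \<in> ivl i" "mid x \<in> ivl j" using x by (auto simp: subcells_def)
        then have "i = j" by (intro cell_unique[OF subcells_cells[OF ij(1)] subcells_cells[OF ij(2)]])
        then show False using ij by simp
      qed
    qed
  qed (simp_all add: finite_subcells)
  finally show ?thesis .
qed

lemma sum_len_subcells:
  assumes w: "w \<in> cells n" and F: "F \<subseteq> subcells n k w"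
  shows "(\<Sum>w'\<in>F. len w') \<le> len w"
proof (rule sum_len_le)
  show "finite F" using F finite_subcells finite_subset by blast
  show "disjoint_family_on ivl F" using F by (intro cells_disjoint[of _ "n + k"]) (auto simp: subcells_def)
  show "fst x < snd x \<and> fst w \<le> fst x \<and> snd x \<le> snd w" if "x \<in> F" for x
    using that F cellD(2) by (fastforce simp: subcells_def)
qed (use cellD(2)[OF w] in auto)

lemma img_mvt:
  assumes w: "w \<in> cells n"
  obtains r where "r \<in> ivl w" "img n w = len w * \<bar>d n r\<bar>"
proof -
  obtain r where "fst w < r" "r < snd w" "z n (snd w) - z n (fst w) = (snd w - fst w) * d n r"
    by (rule cell_mvt[OF w, of "fst w" "snd w" n]) (use cellD[OF w] in auto)
  then show ?thesis using that cellD(2)[OF w] by (auto simp: img_def abs_mult)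
qed

lemma ivl_sub: "w \<in> cells n \<Longrightarrow> t \<in> ivl w \<Longrightarrow> t \<in> {u0..v0}"
  using cellD[of w n] by auto

lemma img_pos: "w \<in> cells n \<Longrightarrow> img n w > 0"
proof -
  assume w: "w \<in> cells n"
  obtain r where r: "r \<in> ivl w" "img n w = len w * \<bar>d n r\<bar>" by (rule img_mvt[OF w])
  then show ?thesis using d_nonzero[OF ivl_sub[OF w r(1)], of n] cellD(2)[OF w] by simp
qed

lemma img_le: "w \<in> cells n \<Longrightarrow> img n w \<le> Lam"
  unfolding img_def using cellD[of w n] by (intro z_diff) auto

lemma cell_len: "w \<in> cells n \<Longrightarrow> len w \<le> Lam / (K0 * mu ^ n)"
proof -
  assume w: "w \<in> cells n"
  obtain r where r: "r \<in> ivl w" "img n w = len w * \<bar>d n r\<bar>" by (rule img_mvt[OF w])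
  have "len w * (K0 * mu ^ n) \<le> len w * \<bar>d n r\<bar>"
    using d_growth0[OF ivl_sub[OF w r(1)]] cellD(2)[OF w] by (intro mult_left_mono) auto
  also have "\<dots> \<le> Lam" using img_le[OF w] r(2) by simp
  finally show ?thesis using K0(1) mu by (simp add: pos_le_divide_eq)
qed

lemma V_ge_1: "w \<in> cells n \<Longrightarrow> V n w \<ge> 1"
  using img_pos img_le by (simp add: V_def)

lemma cell_sign:
  assumes w: "w \<in> cells n" and i: "i < n" and st: "s \<in> ivl w" "t \<in> ivl w"
  shows "z i s \<le> 0 \<longleftrightarrow> z i t \<le> 0"
proof -
  have *: "z i r2 \<le> 0" if r: "r1 \<in> ivl w" "r2 \<in> ivl w" "z i r1 \<le> 0" for r1 r2
  proof (rule ccontr)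
    assume n: "\<not> z i r2 \<le> 0"
    have c: "continuous_on {r1..r2} (z i)" "continuous_on {r2..r1} (z i)"
      using r cellD[OF w] by (auto intro!: continuous_on_subset[OF continuous_z])
    have "\<exists>r\<in>ivl w. z i r = 0"
    proof (cases "r1 \<le> r2")
      case True
      then obtain x where "r1 \<le> x" "x \<le> r2" "z i x = 0" using IVT'[of "z i" r1 0 r2] r n c by auto
      then show ?thesis using r by (intro bexI[of _ x]) auto
    next
      case False
      then obtain x where "r2 \<le> x" "x \<le> r1" "z i x = 0" using IVT2'[of "z i" r1 0 r2] r n c by auto
      then show ?thesis using r by (intro bexI[of _ x]) auto
    qed
    then show False using cellD(4)[OF w _ i] by blast
  qed
  show ?thesis using *[OF st] *[OF st(2,1)] by blast
qed

definition D :: real where "D = 2 * exp (mu / (mu - 1))"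

lemma param_lipschitz:
  assumes "s \<in> {u0..v0}" "t \<in> {u0..v0}"
  shows "\<bar>al s - al t\<bar> \<le> L * \<bar>s - t\<bar>" "\<bar>be s - be t\<bar> \<le> L * \<bar>s - t\<bar>"
proof -
  have "norm (al s - al t) \<le> L * norm (s - t)"
    by (rule field_differentiable_bound[of "{u0..v0}" al al']) (use al_deriv L assms in auto)
  then show "\<bar>al s - al t\<bar> \<le> L * \<bar>s - t\<bar>" by simp
  have "norm (be s - be t) \<le> L * norm (s - t)"
    by (rule field_differentiable_bound[of "{u0..v0}" be be']) (use be_deriv L assms in auto)
  then show "\<bar>be s - be t\<bar> \<le> L * \<bar>s - t\<bar>" by simp
qed

lemma distortion_aux:
  assumes "w \<in> cells n" "s \<in> ivl w" "t \<in> ivl w"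
  shows "\<bar>d n s\<bar> \<le> 2 * exp (\<Sum>i<n. (1 / mu) ^ i) * \<bar>d n t\<bar>"
  using assms
proof (induction n arbitrary: w s t)
  case 0
  then show ?case using x0'_ratio[of s t] ivl_sub by simp
next
  case (Suc n)
  obtain w1 where w1: "w1 \<in> cells n" "w \<in> subcells n 1 w1"
    by (rule cell_parent[of w n 1]) (use Suc.prems in auto)
  have st1: "s \<in> ivl w1" "t \<in> ivl w1" using Suc.prems w1 by (auto simp: subcells_def)
  define Dn where "Dn = 2 * exp (\<Sum>i<n. (1 / mu) ^ i)"
  have ih: "\<bar>d n s\<bar> \<le> Dn * \<bar>d n t\<bar>" unfolding Dn_def by (rule Suc.IH[OF w1(1) st1])
  have Dn: "Dn > 0" by (simp add: Dn_def)
  have s: "s \<in> {u0..v0}" and t: "t \<in> {u0..v0}" using Suc.prems ivl_sub by blast+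
  define x where "x = L * Lam / K0 * (1 / mu) ^ n"
  have mun: "mu ^ n \<ge> 1" using mu by (simp add: one_le_power)
  have x0: "x \<ge> 0" using L_nonneg Lam K0 mu by (simp add: x_def)
  have q: "L * Lam / K0 \<le> 1 / 4" using K0 by (simp add: field_simps)
  have x4: "4 * x \<le> (1 / mu) ^ n"
  proof -
    have "0 \<le> 4 * (1 / mu) ^ n" using mu by simp
    moreover have "Q * (4 * P) \<le> 1 / 4 * (4 * P) \<Longrightarrow> 4 * (Q * P) \<le> P" for P Q :: real by simp
    ultimately show ?thesis unfolding x_def using mult_right_mono[OF q] by blast
  qed
  have "(1 / mu) ^ n \<le> 1" using mu by (simp add: power_le_one)
  then have x1: "x \<le> 1 / 4" using x4 by simp
  have dist: "L * \<bar>s - t\<bar> \<le> x"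
  proof (cases "s = t")
    case False
    obtain r where r: "r \<in> {u0..v0}" "\<bar>z n t - z n s\<bar> = \<bar>t - s\<bar> * \<bar>d n r\<bar>"
    proof (cases "s < t")
      case True
      obtain r where "s < r" "r < t" "z n t - z n s = (t - s) * d n r"
        by (rule cell_mvt[OF w1(1), of s t n]) (use st1 True in auto)
      then show ?thesis using that[of r] s t by (auto simp: abs_mult)
    next
      case F: False
      obtain r where "t < r" "r < s" "z n s - z n t = (s - t) * d n r"
        by (rule cell_mvt[OF w1(1), of t s n]) (use st1 False F in auto)
      then show ?thesis using that[of r] s t by (auto simp: abs_mult abs_minus_commute)
    qed
    have "\<bar>t - s\<bar> * (K0 * mu ^ n) \<le> Lam"
      using mult_left_mono[OF d_growth0[OF r(1), of n], of "\<bar>t - s\<bar>"] r(2) z_diff[OF t s, of n] by simp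
    then have "\<bar>t - s\<bar> \<le> Lam / (K0 * mu ^ n)" using K0(1) mu by (simp add: pos_le_divide_eq)
    then have "L * \<bar>t - s\<bar> \<le> L * (Lam / (K0 * mu ^ n))" using L_nonneg by (intro mult_left_mono)
    then show ?thesis by (simp add: x_def power_divide abs_minus_commute)
  qed (use x0 in simp)
  have src: "L * Lam \<le> x * \<bar>d n r\<bar>" if "r \<in> {u0..v0}" for r
    using mult_left_mono[OF d_growth0[OF that, of n], of x] x0 K0 mu by (simp add: x_def power_divide)
  have zz: "\<bar>al' r * z n r\<bar> \<le> L * Lam" "\<bar>be' r * z n r\<bar> \<le> L * Lam" if "r \<in> {u0..v0}" for r
    using z_abs[OF that, of n] L[OF that] L_nonneg by (auto simp: abs_mult intro!: mult_mono)
  have sgn: "z n s \<le> 0 \<longleftrightarrow> z n t \<le> 0" by (rule cell_sign[OF Suc.prems(1) lessI Suc.prems(2,3)])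
  have key: "\<bar>d (Suc n) s\<bar> * (1 - x) \<le> Dn * (1 + 2 * x) * \<bar>d (Suc n) t\<bar>"
    if S: "\<bar>d (Suc n) s\<bar> \<le> ss * \<bar>d n s\<bar> + L * Lam" "ss' * \<bar>d n t\<bar> - L * Lam \<le> \<bar>d (Suc n) t\<bar>"
      "ss \<le> ss' + L * \<bar>s - t\<bar>" "ss' \<ge> 1" for ss ss'
  proof -
    have "ss \<le> ss' + x" using S dist by simp
    then have "ss * \<bar>d n s\<bar> \<le> (ss' + x) * \<bar>d n s\<bar>" by (intro mult_right_mono) auto
    then have 1: "\<bar>d (Suc n) s\<bar> \<le> (ss' + 2 * x) * \<bar>d n s\<bar>"
      using S(1) src[OF s] by (simp add: algebra_simps)
    have "ss' + 2 * x \<le> ss' * (1 + 2 * x)" using S(4) x0 by (simp add: algebra_simps mult_le_cancel_right1)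
    then have "(ss' + 2 * x) * \<bar>d n s\<bar> \<le> ss' * (1 + 2 * x) * (Dn * \<bar>d n t\<bar>)"
      using ih x0 S(4) by (intro mult_mono) auto
    then have A: "\<bar>d (Suc n) s\<bar> \<le> ss' * (1 + 2 * x) * (Dn * \<bar>d n t\<bar>)" using 1 by linarith
    have "x * \<bar>d n t\<bar> \<le> ss' * (x * \<bar>d n t\<bar>)" using S(4) x0 mult_right_mono[of 1 ss' "x * \<bar>d n t\<bar>"] by simp
    then have B: "ss' * \<bar>d n t\<bar> * (1 - x) \<le> \<bar>d (Suc n) t\<bar>"
      using S(2) src[OF t] by (simp add: algebra_simps)
    have "\<bar>d (Suc n) s\<bar> * (1 - x) \<le> ss' * (1 + 2 * x) * (Dn * \<bar>d n t\<bar>) * (1 - x)"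
      using A x1 by (intro mult_right_mono) auto
    also have "\<dots> = Dn * (1 + 2 * x) * (ss' * \<bar>d n t\<bar> * (1 - x))" by (simp add: algebra_simps)
    also have "\<dots> \<le> Dn * (1 + 2 * x) * \<bar>d (Suc n) t\<bar>"
      using B Dn x0 by (intro mult_left_mono) auto
    finally show ?thesis .
  qed
  have main: "\<bar>d (Suc n) s\<bar> * (1 - x) \<le> Dn * (1 + 2 * x) * \<bar>d (Suc n) t\<bar>"
  proof (cases "z n t \<le> 0")
    case True
    show ?thesis
    proof (rule key[of "al s" "al t"])
      have "\<bar>al s * d n s\<bar> = al s * \<bar>d n s\<bar>" "\<bar>al t * d n t\<bar> = al t * \<bar>d n t\<bar>"
        using params[OF s] params[OF t] lam by (auto simp: abs_mult)
      moreover have "d (Suc n) s = al s * d n s + al' s * z n s" "d (Suc n) t = al t * d n t + al' t * z n t"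
        using True sgn by auto
      ultimately show "\<bar>d (Suc n) s\<bar> \<le> al s * \<bar>d n s\<bar> + L * Lam" "al t * \<bar>d n t\<bar> - L * Lam \<le> \<bar>d (Suc n) t\<bar>"
        using zz[OF s] zz[OF t] by linarith+
    qed (use param_lipschitz[OF s t] params[OF t] lam in auto)
  next
    case False
    show ?thesis
    proof (rule key[of "be s" "be t"])
      have "\<bar>be s * d n s\<bar> = be s * \<bar>d n s\<bar>" "\<bar>be t * d n t\<bar> = be t * \<bar>d n t\<bar>"
        using params[OF s] params[OF t] lam by (auto simp: abs_mult)
      moreover have "d (Suc n) s = - be s * d n s - be' s * z n s" "d (Suc n) t = - be t * d n t - be' t * z n t"
        using False sgn by auto
      ultimately show "\<bar>d (Suc n) s\<bar> \<le> be s * \<bar>d n s\<bar> + L * Lam" "be t * \<bar>d n t\<bar> - L * Lam \<le> \<bar>d (Suc n) t\<bar>"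
        using zz[OF s] zz[OF t] by linarith+
    qed (use param_lipschitz[OF s t] params[OF t] lam in auto)
  qed
  have "1 \<le> (1 + 2 * x) * (1 - x)" using x0 x1 mult_left_mono[of x "1/4" x] by (simp add: algebra_simps)
  then have "(1 + 2 * x) * 1 \<le> (1 + 2 * x) * ((1 + 2 * x) * (1 - x))" using x0 by (intro mult_left_mono) auto
  also have "\<dots> \<le> exp (2 * x) * (exp (2 * x) * (1 - x))"
    using x0 x1 exp_ge_add_one_self[of "2 * x"] by (intro mult_mono) auto
  also have "\<dots> = exp (4 * x) * (1 - x)" by (simp add: exp_add[symmetric])
  also have "\<dots> \<le> exp ((1 / mu) ^ n) * (1 - x)" using x4 x1 by (intro mult_right_mono) auto
  finally have "1 + 2 * x \<le> exp ((1 / mu) ^ n) * (1 - x)" by simp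
  then have "Dn * (1 + 2 * x) * \<bar>d (Suc n) t\<bar> \<le> Dn * (exp ((1 / mu) ^ n) * (1 - x)) * \<bar>d (Suc n) t\<bar>"
    using Dn by (intro mult_right_mono mult_left_mono) auto
  with main have "\<bar>d (Suc n) s\<bar> * (1 - x) \<le> (Dn * exp ((1 / mu) ^ n) * \<bar>d (Suc n) t\<bar>) * (1 - x)"
    by (simp add: mult_ac del: d.simps)
  then have "\<bar>d (Suc n) s\<bar> \<le> Dn * exp ((1 / mu) ^ n) * \<bar>d (Suc n) t\<bar>"
    using x1 mult_le_cancel_right_pos[of "1 - x"] by (simp del: d.simps)
  then show ?case by (simp add: Dn_def exp_add mult.assoc del: d.simps)
qed

lemma distortion:
  assumes "w \<in> cells n" "s \<in> ivl w" "t \<in> ivl w"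
  shows "\<bar>d n s\<bar> \<le> D * \<bar>d n t\<bar>"
proof -
  have "(\<Sum>i<n. (1 / mu) ^ i) \<le> (\<Sum>i. (1 / mu) ^ i)"
    using mu by (intro sum_le_suminf summable_geometric) auto
  also have "\<dots> = mu / (mu - 1)" using mu by (subst suminf_geometric) (auto simp: field_simps)
  finally have "2 * exp (\<Sum>i<n. (1 / mu) ^ i) * \<bar>d n t\<bar> \<le> D * \<bar>d n t\<bar>"
    unfolding D_def by (intro mult_right_mono) auto
  then show ?thesis using distortion_aux[OF assms] by linarith
qed

lemma D_pos: "D > 0" by (simp add: D_def)

lemma len_V:
  assumes w: "w \<in> cells n" and r: "r \<in> ivl w"
  shows "Lam \<le> D * (V n w * len w * \<bar>d n r\<bar>)" "V n w * len w * \<bar>d n r\<bar> \<le> D * Lam"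
proof -
  obtain r0 where r0: "r0 \<in> ivl w" "img n w = len w * \<bar>d n r0\<bar>" by (rule img_mvt[OF w])
  have lw: "len w > 0" using cellD(2)[OF w] by simp
  have d0: "\<bar>d n r0\<bar> > 0" "\<bar>d n r\<bar> > 0" using d_nonzero[OF ivl_sub[OF w]] r0 r by auto
  have Vl: "V n w * len w = Lam / \<bar>d n r0\<bar>" using lw by (simp add: V_def r0(2))
  show "Lam \<le> D * (V n w * len w * \<bar>d n r\<bar>)"
    using distortion[OF w r0(1) r] Lam d0 unfolding Vl by (simp add: pos_le_divide_eq mult_ac)
  show "V n w * len w * \<bar>d n r\<bar> \<le> D * Lam"
    using distortion[OF w r r0(1)] Lam d0 unfolding Vl by (simp add: pos_divide_le_eq mult_ac)
qed

definition crit :: "nat \<Rightarrow> real \<Rightarrow> real" where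
  "crit p t = (tent (al t) (be t) ^^ p) 0"

lemma z_after_zero: "z m t = 0 \<Longrightarrow> z (m + p) t = crit p t"
  by (induction p) (auto simp: crit_def)

text \<open>A subcell sharing no endpoint with \<open>w\<close> ends at zeros of two different iterates, so its image
  is bounded by two points of the critical orbit and has length at least \<open>\<delta>\<close>. At most two
  subcells are left, and these gain the expansion \<open>mu ^ N\<close>.\<close>

lemma drift_step:
  assumes w: "w \<in> cells n" and N: "4 * D \<le> mu ^ N" and \<delta>: "\<delta> > 0"
    and sep: "\<And>s t p q. s \<in> {u0..v0} \<Longrightarrow> t \<in> {u0..v0} \<Longrightarrow> 1 \<le> p \<Longrightarrow> p \<le> N \<Longrightarrow> 1 \<le> q \<Longrightarrow> q \<le> N \<Longrightarrow> p \<noteq> q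
      \<Longrightarrow> \<delta> \<le> \<bar>crit p s - crit q t\<bar>"
  shows "(\<Sum>w'\<in>subcells n N w. len w' * V (n + N) w') \<le> (V n w / 2 + Lam / \<delta>) * len w"
proof -
  let ?S = "subcells n N w"
  let ?f = "\<lambda>w'. len w' * V (n + N) w'"
  define A B C where "A = {w'\<in>?S. fst w' = fst w}" and "B = {w'\<in>?S. snd w' = snd w}"
    and "C = {w'\<in>?S. fst w' \<noteq> fst w \<and> snd w' \<noteq> snd w}"
  have fin: "finite A" "finite B" "finite C" using finite_subcells by (auto simp: A_def B_def C_def)
  have f0: "?f w' \<ge> 0" if "w' \<in> ?S" for w'
    using V_ge_1[OF subcells_cells[OF that]] cellD(2)[OF subcells_cells[OF that]] by auto
  have "sum ?f ?S \<le> sum ?f (A \<union> B \<union> C)"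
    by (rule sum_mono2) (use fin f0 in \<open>auto simp: A_def B_def C_def\<close>)
  also have "\<dots> \<le> sum ?f (A \<union> B) + sum ?f C"
    by (rule sum_Un_le) (use fin in simp_all, rule f0, simp add: C_def)
  also have "sum ?f (A \<union> B) \<le> sum ?f A + sum ?f B"
    by (rule sum_Un_le) (use fin in simp_all, rule f0, simp add: A_def)
  finally have split: "sum ?f ?S \<le> sum ?f A + sum ?f B + sum ?f C" by simp
  have lw: "len w > 0" "V n w \<ge> 1" using cellD(2)[OF w] V_ge_1[OF w] by auto
  have one: "?f w' \<le> V n w * len w / 4" if w': "w' \<in> ?S" for w'
  proof -
    have c: "w' \<in> cells (n + N)" by (rule subcells_cells[OF w'])
    obtain r where r: "r \<in> ivl w'" "img (n + N) w' = len w' * \<bar>d (n + N) r\<bar>" by (rule img_mvt[OF c])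
    have rw: "r \<in> ivl w" using r w' by (auto simp: subcells_def)
    note ru = ivl_sub[OF w rw]
    have dp: "\<bar>d n r\<bar> > 0" "\<bar>d (n + N) r\<bar> > 0" using d_nonzero[OF ru] by auto
    have "?f w' = Lam / \<bar>d (n + N) r\<bar>" using cellD(2)[OF c] by (simp add: V_def r(2))
    also have "\<dots> \<le> Lam / (mu ^ N * \<bar>d n r\<bar>)"
      using d_growth[OF ru, of N n] dp mu Lam by (intro divide_left_mono) auto
    also have "\<dots> \<le> Lam / (4 * D * \<bar>d n r\<bar>)"
      using N dp D_pos mu Lam by (intro divide_left_mono mult_right_mono) auto
    also have "\<dots> \<le> V n w * len w / 4"
      using len_V(1)[OF w rw] dp D_pos by (simp add: pos_divide_le_eq mult_ac)
    finally show ?thesis .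
  qed
  have sgl: "sum ?f X \<le> V n w * len w / 4"
    if X: "X \<subseteq> ?S" "finite X" "\<And>x y. x \<in> X \<Longrightarrow> y \<in> X \<Longrightarrow> x = y" for X
  proof (cases "X = {}")
    case False
    then obtain x where "x \<in> X" by auto
    then have "X = {x}" using X(3) by blast
    then show ?thesis using one[of x] X(1) by simp
  qed (use lw in auto)
  have "sum ?f A \<le> V n w * len w / 4"
  proof (rule sgl)
    fix x y assume xy: "x \<in> A" "y \<in> A"
    have c: "x \<in> cells (n + N)" "y \<in> cells (n + N)" using xy unfolding A_def by (blast dest: subcells_cells)+
    have e: "fst x = fst y" using xy by (simp add: A_def)
    define t where "t = fst x + (min (snd x) (snd y) - fst x) / 2"
    have "t \<in> ivl x" "t \<in> ivl y" using e cellD(2)[OF c(1)] cellD(2)[OF c(2)]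
      by (auto simp: t_def min_def field_simps)
    then show "x = y" by (rule cell_unique[OF c])
  qed (use fin in \<open>auto simp: A_def\<close>)
  moreover have "sum ?f B \<le> V n w * len w / 4"
  proof (rule sgl)
    fix x y assume xy: "x \<in> B" "y \<in> B"
    have c: "x \<in> cells (n + N)" "y \<in> cells (n + N)" using xy unfolding B_def by (blast dest: subcells_cells)+
    have e: "snd x = snd y" using xy by (simp add: B_def)
    define t where "t = snd x - (snd x - max (fst x) (fst y)) / 2"
    have "t \<in> ivl x" "t \<in> ivl y" using e cellD(2)[OF c(1)] cellD(2)[OF c(2)]
      by (auto simp: t_def max_def field_simps)
    then show "x = y" by (rule cell_unique[OF c])
  qed (use fin in \<open>auto simp: B_def\<close>)
  moreover have "sum ?f C \<le> (\<Sum>w'\<in>C. Lam / \<delta> * len w')"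
  proof (rule sum_mono)
    fix w' assume w': "w' \<in> C"
    then have wS: "w' \<in> ?S" by (simp add: C_def)
    then have c: "w' \<in> cells (n + N)" by (rule subcells_cells)
    have lt: "fst w < fst w'" "snd w' < snd w" using w' by (auto simp: C_def subcells_def)
    have hit: "\<exists>i<N. z (n + i) t = 0" if t: "t \<in> Zs (n + N)" "t \<in> ivl w" for t
    proof -
      have "t \<notin> Zs n" using w t by (auto simp: cells_def)
      then obtain i where i: "i < n + N" "z i t = 0" using t by (auto simp: Zs_def)
      then have "n \<le> i" using cellD(4)[OF w t(2)] by (meson not_le)
      then show ?thesis using i by (intro exI[of _ "i - n"]) auto
    qed
    have in_w: "fst w' \<in> ivl w" "snd w' \<in> ivl w" using lt cellD(2)[OF c] by auto
    have Zw: "fst w' \<in> Zs (n + N)" "snd w' \<in> Zs (n + N)" using c by (auto simp: cells_def)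
    obtain i where i: "i < N" "z (n + i) (fst w') = 0" using hit[OF Zw(1) in_w(1)] by auto
    obtain j where j: "j < N" "z (n + j) (snd w') = 0" using hit[OF Zw(2) in_w(2)] by auto
    have "i \<noteq> j" using cell_inj[OF c, of "fst w'" "snd w'" "n + i"] i j cellD(2)[OF c] by auto
    moreover have "z (n + N) (fst w') = crit (N - i) (fst w')" "z (n + N) (snd w') = crit (N - j) (snd w')"
      using z_after_zero[OF i(2), of "N - i"] z_after_zero[OF j(2), of "N - j"] i j by auto
    ultimately have "\<delta> \<le> img (n + N) w'"
      using sep[of "snd w'" "fst w'" "N - j" "N - i"] ivl_sub[OF w] in_w i j by (auto simp: img_def)
    then have "V (n + N) w' \<le> Lam / \<delta>" unfolding V_def using \<delta> Lam by (intro divide_left_mono) auto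
    then show "?f w' \<le> Lam / \<delta> * len w'" using mult_left_mono[of "V (n + N) w'" "Lam / \<delta>" "len w'"] cellD(2)[OF c] by (simp only: mult.commute)
  qed
  moreover have "(\<Sum>w'\<in>C. Lam / \<delta> * len w') \<le> Lam / \<delta> * len w"
    unfolding sum_distrib_left[symmetric] using \<delta> Lam
    by (intro mult_left_mono sum_len_subcells[OF w, of _ N]) (auto simp: C_def)
  moreover have "(V n w / 2 + Lam / \<delta>) * len w = V n w * len w / 4 + V n w * len w / 4 + Lam / \<delta> * len w"
    by (simp add: distrib_right)
  ultimately show ?thesis using split by linarith
qed

lemma preimage_diameter:
  assumes w: "w \<in> cells n" and st: "fst w \<le> s" "s \<le> t" "t \<le> snd w"
  shows "t - s \<le> \<bar>z n t - z n s\<bar> * (D / Lam) * V n w * len w"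
proof (cases "s = t")
  case False
  then have "s < t" using st by simp
  obtain r where r: "s < r" "r < t" "z n t - z n s = (t - s) * d n r"
    by (rule cell_mvt[OF w st(1) \<open>s < t\<close> st(3) order_refl])
  have rw: "r \<in> ivl w" using r st by auto
  have "(t - s) * Lam \<le> (t - s) * (D * (V n w * len w * \<bar>d n r\<bar>))"
    using len_V(1)[OF w rw] st by (intro mult_left_mono) auto
  also have "\<dots> = \<bar>z n t - z n s\<bar> * D * V n w * len w" using st by (simp add: r(3) abs_mult)
  finally show ?thesis using Lam by (simp add: pos_le_divide_eq mult_ac)
qed simp

lemma later_cell_small_image:
  assumes w: "w \<in> cells (n + m)" and st: "s \<in> {fst w..snd w}" "t \<in> {fst w..snd w}"
  shows "\<bar>z n t - z n s\<bar> \<le> D * Lam / mu ^ m"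
proof -
  have *: "\<bar>z n t - z n s\<bar> \<le> D * Lam / mu ^ m" if st: "fst w \<le> s" "s < t" "t \<le> snd w" for s t
  proof -
    obtain r where r: "s < r" "r < t" "z n t - z n s = (t - s) * d n r"
      by (rule cell_mvt[OF w st, of n]) auto
    obtain r0 where r0: "r0 \<in> ivl w" "img (n + m) w = len w * \<bar>d (n + m) r0\<bar>" by (rule img_mvt[OF w])
    obtain w1 where w1: "w1 \<in> cells n" "w \<in> subcells n m w1" by (rule cell_parent[OF w])
    have in1: "r \<in> ivl w1" "r0 \<in> ivl w1" using r r0 st w1 by (auto simp: subcells_def)
    have "\<bar>z n t - z n s\<bar> * mu ^ m = (t - s) * \<bar>d n r\<bar> * mu ^ m" using st by (simp add: r(3) abs_mult)
    also have "\<dots> \<le> len w * (D * \<bar>d n r0\<bar>) * mu ^ m"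
      using st mu distortion[OF w1(1) in1] by (intro mult_right_mono mult_mono) auto
    also have "\<dots> = D * len w * (mu ^ m * \<bar>d n r0\<bar>)" by simp
    also have "\<dots> \<le> D * len w * \<bar>d (n + m) r0\<bar>"
      using d_growth[OF ivl_sub[OF w r0(1)], of m n] D_pos cellD(2)[OF w] by (intro mult_left_mono) auto
    also have "\<dots> \<le> D * Lam" using img_le[OF w] D_pos by (simp add: r0(2) mult.assoc)
    finally show ?thesis using mu by (simp add: pos_le_divide_eq)
  qed
  have "0 \<le> D * Lam / mu ^ m" using D_pos Lam mu by simp
  then show ?thesis using *[of s t] *[of t s] st by (cases s t rule: linorder_cases) (auto simp: abs_minus_commute)
qed

text \<open>The time \<open>n\<close> is used for cells \<open>w\<close> of a later level \<open>n + m\<close>: whether the orbit hits \<open>{p..q}\<close> at time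
  \<open>n\<close> is, up to a small enlargement of \<open>{p..q}\<close>, already decided by such a cell.\<close>

definition hit :: "nat \<Rightarrow> real \<Rightarrow> real \<Rightarrow> interval \<Rightarrow> bool" where
  "hit n p q w \<longleftrightarrow> (\<exists>s\<in>ivl w. p \<le> z n s \<and> z n s \<le> q)"

lemma sum_len_hit:
  assumes w: "w \<in> cells n" and pq: "p \<le> q"
  shows "(\<Sum>w'\<in>{w'\<in>subcells n m w. hit n p q w'}. len w')
    \<le> (q - p + 2 * (D * Lam / mu ^ m)) * (D / Lam) * V n w * len w"
proof -
  define F where "F = {w'\<in>subcells n m w. hit n p q w'}"
  define e where "e = D * Lam / mu ^ m"
  have e: "e \<ge> 0" using D_pos Lam mu by (simp add: e_def)
  have fin: "finite F" using finite_subcells by (simp add: F_def)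
  have pos: "(q - p + 2 * e) * (D / Lam) * V n w * len w \<ge> 0"
    using pq e D_pos Lam V_ge_1[OF w] cellD(2)[OF w] by (intro mult_nonneg_nonneg) auto
  show ?thesis
  proof (cases "F = {}")
    case True
    then show ?thesis using pos by (simp only: F_def e_def sum.empty)
  next
    case False
    define P Q where "P = Min (fst ` F)" and "Q = Max (snd ` F)"
    have "P \<in> fst ` F" unfolding P_def by (rule Min_in) (use fin False in simp_all)
    then obtain w1 where w1: "w1 \<in> F" "P = fst w1" by blast
    have "Q \<in> snd ` F" unfolding Q_def by (rule Max_in) (use fin False in simp_all)
    then obtain w2 where w2: "w2 \<in> F" "Q = snd w2" by blast
    have PQ: "P \<le> fst x" "snd x \<le> Q" if "x \<in> F" for x
      using that fin by (auto simp: P_def Q_def)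
    have c: "x \<in> cells (n + m)" if "x \<in> F" for x
      using that unfolding F_def by (blast dest: subcells_cells)
    have le: "P < Q" using PQ(2)[OF w1(1)] cellD(2)[OF c[OF w1(1)]] w1 by simp
    have "sum len F \<le> Q - P"
    proof (rule sum_len_le[OF fin])
      show "fst x < snd x \<and> P \<le> fst x \<and> snd x \<le> Q" if "x \<in> F" for x
        using PQ[OF that] cellD(2)[OF c[OF that]] by simp
      show "disjoint_family_on ivl F" using c by (intro cells_disjoint[of _ "n + m"]) auto
    qed (use le in simp)
    also have "Q - P \<le> \<bar>z n Q - z n P\<bar> * (D / Lam) * V n w * len w"
      by (rule preimage_diameter[OF w]) (use w1 w2 le in \<open>auto simp: F_def subcells_def\<close>)
    also have "\<dots> \<le> (q - p + 2 * e) * (D / Lam) * V n w * len w"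
    proof -
      have near: "p - e \<le> z n t \<and> z n t \<le> q + e" if x: "x \<in> F" "t \<in> {fst x..snd x}" for x t
      proof -
        obtain s where s: "s \<in> ivl x" "p \<le> z n s" "z n s \<le> q" using x by (auto simp: F_def hit_def)
        have "\<bar>z n t - z n s\<bar> \<le> e" unfolding e_def
          by (rule later_cell_small_image[OF c[OF x(1)]]) (use s x in auto)
        then show ?thesis using s by auto
      qed
      have "P \<in> {fst w1..snd w1}" "Q \<in> {fst w2..snd w2}" using cellD(2)[OF c[OF w1(1)]] cellD(2)[OF c[OF w2(1)]] w1(2) w2(2) by auto
      then have "\<bar>z n Q - z n P\<bar> \<le> q - p + 2 * e" using near[OF w1(1)] near[OF w2(1)] by fastforce
      then show ?thesis using D_pos Lam V_ge_1[OF w] cellD(2)[OF w] by (intro mult_right_mono) auto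
    qed
    finally show ?thesis by (simp only: F_def e_def)
  qed
qed

end

locale separated_tent_curve = tent_curve +
  fixes N :: nat and \<delta> :: real
  assumes N: "4 * D \<le> mu ^ N" and \<delta>: "\<delta> > 0"
    and sep: "\<And>s t p q. s \<in> {u0..v0} \<Longrightarrow> t \<in> {u0..v0} \<Longrightarrow> 1 \<le> p \<Longrightarrow> p \<le> N \<Longrightarrow> 1 \<le> q \<Longrightarrow> q \<le> N \<Longrightarrow> p \<noteq> q
      \<Longrightarrow> \<delta> \<le> \<bar>crit p s - crit q t\<bar>"
begin

definition C0 :: real where "C0 = 2 * Lam / \<delta>"

lemma C0_pos: "C0 > 0" using Lam \<delta> by (simp add: C0_def)

lemma drift:
  assumes w: "w \<in> cells n"
  shows "(\<Sum>w'\<in>subcells n (k * N) w. len w' * V (n + k * N) w') \<le> (V n w / 2 ^ k + C0) * len w"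
proof (induction k)
  case 0
  have "subcells n 0 w = {w}"
  proof -
    have "x = w" if "x \<in> subcells n 0 w" for x
    proof -
      have x: "x \<in> cells n" using that by (simp add: subcells_def)
      have "mid x \<in> ivl x" "mid x \<in> ivl w" using mid_in[OF x] that by (auto simp: subcells_def)
      then show ?thesis by (rule cell_unique[OF x w])
    qed
    then show ?thesis using w by (auto simp: subcells_def)
  qed
  moreover have "0 \<le> C0 * len w" using C0_pos cellD(2)[OF w] by simp
  ultimately show ?case by (simp add: algebra_simps)
next
  case (Suc k)
  have "(\<Sum>w'\<in>subcells n (k * N + N) w. len w' * V (n + k * N + N) w')
    \<le> (\<Sum>w1\<in>subcells n (k * N) w. \<Sum>w'\<in>subcells (n + k * N) N w1. len w' * V (n + k * N + N) w')"
    using V_ge_1 cellD(2) by (intro sum_subcells_add[OF w]) (metis diff_ge_0_iff_ge less_imp_le mult_nonneg_nonneg order_trans zero_le_one)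
  also have "\<dots> \<le> (\<Sum>w1\<in>subcells n (k * N) w. (V (n + k * N) w1 / 2 + Lam / \<delta>) * len w1)"
    by (intro sum_mono drift_step[OF subcells_cells N \<delta> sep])
  also have "\<dots> = (\<Sum>w1\<in>subcells n (k * N) w. len w1 * V (n + k * N) w1) / 2
      + Lam / \<delta> * (\<Sum>w1\<in>subcells n (k * N) w. len w1)"
    unfolding sum_distrib_left sum_divide_distrib sum.distrib[symmetric]
    by (intro sum.cong) (simp_all add: algebra_simps)
  also have "\<dots> \<le> (V n w / 2 ^ k + C0) * len w / 2 + Lam / \<delta> * len w"
    using Suc sum_len_subcells[OF w order_refl, of "k * N"] Lam \<delta> by (intro add_mono divide_right_mono mult_left_mono) auto
  also have "\<dots> = (V n w / 2 ^ Suc k + C0) * len w" by (simp add: C0_def field_simps)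
  finally show ?case by (simp add: add.assoc add.commute[of N])
qed

lemma hit_prob:
  assumes w: "w \<in> cells n" and pq: "p \<le> q"
  shows "(\<Sum>w'\<in>{w'\<in>subcells n (k * N + m) w. hit (n + k * N) p q w'}. len w')
    \<le> (q - p + 2 * (D * Lam / mu ^ m)) * (D / Lam) * (V n w / 2 ^ k + C0) * len w"
proof -
  let ?h = "hit (n + k * N) p q"
  let ?c = "(q - p + 2 * (D * Lam / mu ^ m)) * (D / Lam)"
  have c: "?c \<ge> 0" using pq D_pos Lam mu by simp
  have lp: "len x \<ge> 0" if "x \<in> cells i" for x i using cellD(2)[OF that] by simp
  have "(\<Sum>w'\<in>{w'\<in>subcells n (k * N + m) w. ?h w'}. len w') = (\<Sum>w'\<in>subcells n (k * N + m) w. if ?h w' then len w' else 0)"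
    using finite_subcells by (simp add: sum.inter_filter)
  also have "\<dots> \<le> (\<Sum>w1\<in>subcells n (k * N) w. \<Sum>w'\<in>subcells (n + k * N) m w1. if ?h w' then len w' else 0)"
    using lp by (intro sum_subcells_add[OF w]) auto
  also have "\<dots> \<le> (\<Sum>w1\<in>subcells n (k * N) w. ?c * V (n + k * N) w1 * len w1)"
  proof (rule sum_mono)
    fix w1 assume "w1 \<in> subcells n (k * N) w"
    from sum_len_hit[OF subcells_cells[OF this] pq, of m]
    show "(\<Sum>w'\<in>subcells (n + k * N) m w1. if ?h w' then len w' else 0) \<le> ?c * V (n + k * N) w1 * len w1"
      using finite_subcells by (simp add: sum.inter_filter)
  qed
  also have "\<dots> = ?c * (\<Sum>w1\<in>subcells n (k * N) w. len w1 * V (n + k * N) w1)"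
    by (simp add: sum_distrib_left mult_ac)
  also have "\<dots> \<le> ?c * ((V n w / 2 ^ k + C0) * len w)" by (rule mult_left_mono[OF drift[OF w] c])
  finally show ?thesis by (simp add: mult.assoc)
qed

end

section \<open>Frequencies along orbits\<close>

definition upper_density_le :: "(nat \<Rightarrow> bool) \<Rightarrow> real \<Rightarrow> bool" where
  "upper_density_le P c \<longleftrightarrow>
     (\<forall>\<epsilon>>0. \<forall>\<^sub>F n in sequentially. real (card {i. i < n \<and> P i}) \<le> real n * (c + \<epsilon>))"

lemma card_less_Suc: "card {j. j < Suc n \<and> P j} = card {j. j < n \<and> P j} + (if P n then 1 else 0)"
proof -
  have "{j. j < Suc n \<and> P j} = (if P n then insert n {j. j < n \<and> P j} else {j. j < n \<and> P j})"
    by (auto simp: less_Suc_eq)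
  then show ?thesis by simp
qed

lemma upper_density_le_residues:
  assumes M: "M > 0" and \<kappa>: "\<kappa> \<ge> 0"
    and res: "\<And>r. r < M \<Longrightarrow> \<forall>\<^sub>F n in sequentially. real (card {j. j < n \<and> P (s + r + j * M)}) \<le> real n * \<kappa>"
  shows "upper_density_le P \<kappa>"
  unfolding upper_density_le_def
proof (intro allI impI)
  fix \<epsilon> :: real assume \<epsilon>: "\<epsilon> > 0"
  have "\<forall>\<^sub>F n in sequentially. \<forall>r\<in>{..<M}. real (card {j. j < n \<and> P (s + r + j * M)}) \<le> real n * \<kappa>"
    using res by (intro eventually_ball_finite) auto
  then obtain n0 where n0: "\<And>n r. n \<ge> n0 \<Longrightarrow> r < M \<Longrightarrow> real (card {j. j < n \<and> P (s + r + j * M)}) \<le> real n * \<kappa>"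
    unfolding eventually_sequentially by blast
  obtain n1 where n1: "real n1 \<ge> (s + \<kappa> * M) / \<epsilon>" using real_arch_simple by blast
  show "\<forall>\<^sub>F n in sequentially. real (card {i. i < n \<and> P i}) \<le> real n * (\<kappa> + \<epsilon>)"
    unfolding eventually_sequentially
  proof (intro exI[of _ "max (n0 * M) n1"] allI impI)
    fix n assume n: "max (n0 * M) n1 \<le> n"
    define m where "m = n div M + 1"
    have "n0 * M div M \<le> n div M" using n by (intro div_le_mono) simp
    then have m0: "m \<ge> n0" using M by (simp add: m_def)
    have sub: "{i. i < n \<and> P i} \<subseteq> {..<s} \<union> (\<Union>r\<in>{..<M}. (\<lambda>j. s + r + j * M) ` {j. j < m \<and> P (s + r + j * M)})"
    proof
      fix i assume i: "i \<in> {i. i < n \<and> P i}"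
      show "i \<in> {..<s} \<union> (\<Union>r\<in>{..<M}. (\<lambda>j. s + r + j * M) ` {j. j < m \<and> P (s + r + j * M)})"
      proof (cases "i < s")
        case False
        define j r where "j = (i - s) div M" and "r = (i - s) mod M"
        have e: "i = s + r + j * M" using False div_mult_mod_eq[of "i - s" M] unfolding j_def r_def by linarith
        have "j \<le> n div M" unfolding j_def using i by (intro div_le_mono) auto
        then have "j < m" by (simp add: m_def)
        moreover have "r < M" using M by (simp add: r_def)
        ultimately show ?thesis using i e by blast
      qed auto
    qed
    have "card {i. i < n \<and> P i} \<le> card ({..<s} \<union> (\<Union>r\<in>{..<M}. (\<lambda>j. s + r + j * M) ` {j. j < m \<and> P (s + r + j * M)}))"
      by (rule card_mono[OF _ sub]) auto
    also have "\<dots> \<le> card {..<s} + card (\<Union>r\<in>{..<M}. (\<lambda>j. s + r + j * M) ` {j. j < m \<and> P (s + r + j * M)})"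
      by (rule card_Un_le)
    also have "card (\<Union>r\<in>{..<M}. (\<lambda>j. s + r + j * M) ` {j. j < m \<and> P (s + r + j * M)})
        \<le> (\<Sum>r\<in>{..<M}. card ((\<lambda>j. s + r + j * M) ` {j. j < m \<and> P (s + r + j * M)}))"
      by (rule card_UN_le) simp
    also have "\<dots> \<le> (\<Sum>r\<in>{..<M}. card {j. j < m \<and> P (s + r + j * M)})"
      by (intro sum_mono card_image_le) auto
    finally have "real (card {i. i < n \<and> P i}) \<le> real s + (\<Sum>r\<in>{..<M}. real (card {j. j < m \<and> P (s + r + j * M)}))"
      by (simp flip: of_nat_sum of_nat_add)
    also have "\<dots> \<le> real s + (\<Sum>r\<in>{..<M}. real m * \<kappa>)"
      using n0[OF m0] by (intro add_left_mono sum_mono) auto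
    also have "\<dots> = real s + \<kappa> * real (M * m)" by simp
    also have "M * m \<le> n + M" by (simp add: m_def)
    then have "real (M * m) \<le> real n + real M" by (metis of_nat_add of_nat_le_iff)
    then have "real s + \<kappa> * real (M * m) \<le> real s + \<kappa> * (real n + real M)"
      using \<kappa> by (intro add_left_mono mult_left_mono) auto
    also have "\<dots> \<le> real n * (\<kappa> + \<epsilon>)"
    proof -
      have "(s + \<kappa> * M) / \<epsilon> \<le> real n" using n1 n by linarith
      then have "s + \<kappa> * M \<le> real n * \<epsilon>" using \<epsilon> by (simp add: pos_divide_le_eq)
      then show ?thesis by (simp add: algebra_simps)
    qed
    finally show "real (card {i. i < n \<and> P i}) \<le> real n * (\<kappa> + \<epsilon>)" .
  qed
qed

lemma rare_large_values:
  fixes v :: "nat \<Rightarrow> real"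
  assumes v: "\<And>j. v j \<ge> 1" and C: "C \<ge> 0" and h: "2 * (1 + C) \<le> 2 ^ h"
    and ev: "\<forall>\<^sub>F n in sequentially. (\<Prod>j<n. v (Suc j) / (v j / 2 ^ k + C)) \<le> 2 ^ n"
  shows "\<forall>\<^sub>F n in sequentially. k * card {j. j < n \<and> v j \<ge> 2 ^ k} \<le> (h + 1) * n"
proof -
  define c where "c n = card {j. j < n \<and> v j \<ge> 2 ^ k}" for n
  define g where "g j = v j / 2 ^ k + C" for j
  have g: "g j > 0" for j
  proof -
    have "v j / 2 ^ k > 0" using v[of j] by simp
    then show ?thesis unfolding g_def using C by linarith
  qed
  have *: "2 ^ (k * c n) * v n \<le> v 0 * (1 + C) ^ n * (\<Prod>j<n. v (Suc j) / g j)" for n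
  proof (induction n)
    case (Suc n)
    define f :: real where "f = (if v n \<ge> 2 ^ k then 2 ^ k else 1)"
    have "f * g n \<le> (1 + C) * v n"
    proof (cases "v n \<ge> 2 ^ k")
      case True
      then have "C * 2 ^ k \<le> C * v n" using C by (intro mult_left_mono)
      moreover have "f * g n = v n + C * 2 ^ k" using True by (simp add: f_def g_def distrib_left)
      ultimately show ?thesis by (simp add: distrib_right)
    next
      case False
      have "v n / 2 ^ k \<le> v n" using v[of n] by (simp add: divide_le_eq mult_le_cancel_left1)
      moreover have "C \<le> C * v n" using C v[of n] by (simp add: mult_le_cancel_left1)
      ultimately show ?thesis using False by (simp add: f_def g_def algebra_simps)
    qed
    then have f: "f \<le> (1 + C) * v n / g n" using g[of n] by (simp add: pos_le_divide_eq)
    have "(2::real) ^ (k * c (Suc n)) = 2 ^ (k * c n) * f"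
      by (simp add: c_def card_less_Suc f_def power_add)
    then have "2 ^ (k * c (Suc n)) * v (Suc n) = 2 ^ (k * c n) * f * v (Suc n)" by simp
    also have "\<dots> \<le> 2 ^ (k * c n) * ((1 + C) * v n / g n) * v (Suc n)"
      using f v[of "Suc n"] by (intro mult_right_mono mult_left_mono) auto
    also have "\<dots> = (2 ^ (k * c n) * v n) * ((1 + C) * v (Suc n) / g n)" by simp
    also have "\<dots> \<le> (v 0 * (1 + C) ^ n * (\<Prod>j<n. v (Suc j) / g j)) * ((1 + C) * v (Suc n) / g n)"
      using Suc C v[of "Suc n"] g[of n] by (intro mult_right_mono) (auto intro!: divide_nonneg_pos)
    also have "\<dots> = v 0 * (1 + C) ^ Suc n * (\<Prod>j<Suc n. v (Suc j) / g j)" by simp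
    finally show ?case .
  qed (simp add: c_def)
  obtain n0 where n0: "v 0 < 2 ^ n0" using real_arch_pow[of 2 "v 0"] by auto
  show ?thesis using ev eventually_ge_at_top[of n0]
  proof eventually_elim
    case (elim n)
    have "(2::real) ^ n0 \<le> 2 ^ n" using elim(2) by (intro power_increasing) auto
    then have "v 0 \<le> 2 ^ n" using n0 by linarith
    have "(2::real) ^ (k * c n) * 1 \<le> 2 ^ (k * c n) * v n" using v by (intro mult_left_mono) auto
    also have "\<dots> \<le> v 0 * (1 + C) ^ n * (\<Prod>j<n. v (Suc j) / g j)" by (rule *)
    also have "\<dots> \<le> 2 ^ n * (1 + C) ^ n * 2 ^ n"
    proof (intro mult_mono)
      show "(\<Prod>j<n. v (Suc j) / g j) \<le> 2 ^ n" using elim(1) by (simp only: g_def)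
      show "0 \<le> (\<Prod>j<n. v (Suc j) / g j)"
        using g order_trans[OF zero_le_one v] by (intro prod_nonneg divide_nonneg_pos) auto
    qed (use \<open>v 0 \<le> 2 ^ n\<close> C in auto)
    also have "\<dots> = 2 ^ n * (2 * (1 + C)) ^ n" by (simp only: power_mult_distrib ac_simps)
    also have "\<dots> \<le> 2 ^ n * (2 ^ h) ^ n" using h C by (intro mult_left_mono power_mono) auto
    also have "\<dots> = 2 ^ ((h + 1) * n)" by (simp add: power_mult[symmetric] power_add[symmetric] algebra_simps)
    finally show "k * card {j. j < n \<and> v j \<ge> 2 ^ k} \<le> (h + 1) * n"
      unfolding c_def by (simp add: power_increasing_iff)
  qed
qed

lemma rare_hits:
  fixes p :: "nat \<Rightarrow> real" and \<epsilon> q :: real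
  assumes p: "\<And>j. 0 \<le> p j \<and> p j \<le> 1" and q: "q \<ge> 0" and good: "\<And>j. \<not> bad j \<Longrightarrow> p j \<le> q"
    and ev: "\<forall>\<^sub>F n in sequentially. (\<Prod>j<n. (if Y j then 2 else 1) / (1 + p j)) \<le> exp \<epsilon> ^ n" and \<epsilon>: "\<epsilon> \<ge> 0"
  shows "\<forall>\<^sub>F n in sequentially. real (card {j. j < n \<and> Y j}) \<le> real n * (2 * \<epsilon> + 2 * q) + real (card {j. j < n \<and> bad j})"
proof -
  define c b where "c n = card {j. j < n \<and> Y j}" and "b n = card {j. j < n \<and> bad j}" for n
  have *: "2 ^ c n \<le> (\<Prod>j<n. (if Y j then 2 else 1) / (1 + p j)) * exp (q * n) * 2 ^ b n" for n
  proof (induction n)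
    case (Suc n)
    define y f :: real where "y = (if Y n then 2 else 1)" and "f = (if bad n then 2 else 1)"
    have "1 + p n \<le> exp q * f"
    proof (cases "bad n")
      case True
      have "1 \<le> exp q" using q by simp
      then have "1 + p n \<le> exp q * 2" using p[of n] by linarith
      then show ?thesis using True by (simp add: f_def)
    next
      case False
      then have "1 + p n \<le> exp q" using good[OF False] exp_ge_add_one_self[of q] by linarith
      then show ?thesis using False by (simp add: f_def)
    qed
    then have y: "y \<le> y / (1 + p n) * (exp q * f)"
      using p[of n] by (simp add: y_def pos_le_divide_eq mult_left_mono)
    have "(2::real) ^ c (Suc n) = 2 ^ c n * y" by (simp add: c_def card_less_Suc y_def)
    also have "\<dots> \<le> ((\<Prod>j<n. (if Y j then 2 else 1) / (1 + p j)) * exp (q * n) * 2 ^ b n) * (y / (1 + p n) * (exp q * f))"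
      using Suc y by (intro mult_mono) (auto simp: y_def intro!: mult_nonneg_nonneg prod_nonneg divide_nonneg_nonneg add_nonneg_nonneg p[THEN conjunct1])
    also have "\<dots> = (\<Prod>j<Suc n. (if Y j then 2 else 1) / (1 + p j)) * exp (q * Suc n) * (2 ^ b n * f)"
      by (simp add: y_def exp_add algebra_simps)
    also have "2 ^ b n * f = 2 ^ b (Suc n)" by (simp add: b_def card_less_Suc f_def)
    finally show ?case .
  qed (simp add: c_def b_def)
  show ?thesis using ev
  proof eventually_elim
    case (elim n)
    have "2 ^ c n \<le> exp \<epsilon> ^ n * exp (q * n) * 2 ^ b n"
      using *[of n] elim by (intro order_trans[OF *[of n]] mult_right_mono) auto
    also have "\<dots> = exp (n * \<epsilon> + n * q) * 2 ^ b n" by (simp add: exp_add exp_of_nat_mult[symmetric] mult.commute)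
    finally have "ln (2 ^ c n) \<le> ln (exp (n * \<epsilon> + n * q) * 2 ^ b n)" by (subst ln_le_cancel_iff) auto
    then have "c n * ln 2 \<le> n * (\<epsilon> + q) + b n * ln 2"
      by (simp add: ln_mult ln_realpow algebra_simps)
    then have "(real (c n) - real (b n)) * ln 2 \<le> n * (\<epsilon> + q)" by (simp add: algebra_simps)
    then have "real (c n) - real (b n) \<le> n * (\<epsilon> + q) / ln 2" by (subst pos_le_divide_eq) auto
    also have "\<dots> \<le> n * (\<epsilon> + q) / (1 / 2)"
      using \<epsilon> q ln2_ge_two_thirds by (intro divide_left_mono) auto
    finally show ?case by (simp add: c_def b_def algebra_simps)
  qed
qed

context tent_curve begin

definition cell :: "nat \<Rightarrow> real \<Rightarrow> interval" where
  "cell n t = (THE w. w \<in> cells n \<and> t \<in> ivl w)"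

lemma cell_eq: "w \<in> cells n \<Longrightarrow> t \<in> ivl w \<Longrightarrow> cell n t = w"
  unfolding cell_def by (rule the_equality) (auto intro: cell_unique)

lemma cell_in: "t \<in> {u0..v0} \<Longrightarrow> t \<notin> Zs n \<Longrightarrow> cell n t \<in> cells n \<and> t \<in> ivl (cell n t)"
  using cell_cover[of t n] cell_eq by metis

lemma cell_const:
  assumes w: "w \<in> cells m" and i: "i \<le> m" and st: "s \<in> ivl w" "t \<in> ivl w"
  shows "cell i s = cell i t"
proof -
  have "w \<in> cells (i + (m - i))" using w i by simp
  then obtain w1 where w1: "w1 \<in> cells i" "w \<in> subcells i (m - i) w1" by (rule cell_parent)
  have "s \<in> ivl w1" "t \<in> ivl w1" using st w1 by (auto simp: subcells_def)
  then show ?thesis using cell_eq[OF w1(1)] by simp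
qed

lemma root_cell: "(u0, v0) \<in> cells 0"
  using uv by (auto simp: cells_def Zs_def)

lemma subcells_root: "subcells 0 m (u0, v0) = cells m"
  using cellD by (auto simp: subcells_def)

lemma mid_in_sub: "w' \<in> subcells n k w \<Longrightarrow> mid w' \<in> ivl w"
  using mid_in[OF subcells_cells[of w' n k w]] by (auto simp: subcells_def)

lemma cell_mid_level:
  assumes "w \<in> cells (r + n * M)" "j < n"
  shows "cell (r + Suc j * M) (mid w) \<in> cells (r + Suc j * M)"
proof -
  have "Suc j * M \<le> n * M" using assms(2) by (intro mult_le_mono1) simp
  then have "w \<in> cells (r + Suc j * M + (r + n * M - (r + Suc j * M)))" using assms(1) by simp
  then obtain w1 where w1: "w1 \<in> cells (r + Suc j * M)"
    "w \<in> subcells (r + Suc j * M) (r + n * M - (r + Suc j * M)) w1" by (rule cell_parent)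
  then show ?thesis using cell_eq[OF w1(1) mid_in_sub[OF w1(2)]] by simp
qed

text \<open>The products of the \<open>R j\<close> form a supermartingale with respect to the partitions into cells of
  level \<open>r + j * M\<close>.\<close>

lemma supermartingale_sum:
  assumes nonneg: "\<And>j w'. w' \<in> cells (r + Suc j * M) \<Longrightarrow> R j w' \<ge> (0::real)"
    and bound: "\<And>j w. w \<in> cells (r + j * M) \<Longrightarrow> (\<Sum>w'\<in>subcells (r + j * M) M w. R j w' * len w') \<le> len w"
  shows "(\<Sum>w\<in>cells (r + n * M). (\<Prod>j<n. R j (cell (r + Suc j * M) (mid w))) * len w) \<le> v0 - u0"
proof (induction n)
  case 0
  have "(\<Sum>w\<in>cells r. len w) \<le> len (u0, v0)"
    by (rule sum_len_subcells[OF root_cell, of _ r]) (simp add: subcells_root)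
  then show ?case by simp
next
  case (Suc n)
  let ?m = "r + n * M"
  let ?P = "\<lambda>n w. \<Prod>j<n. R j (cell (r + Suc j * M) (mid w))"
  have P0: "?P n' w \<ge> 0" if w: "w \<in> cells (r + n' * M)" for n' w
    using cell_mid_level[OF w] by (intro prod_nonneg nonneg) auto
  have "(\<Sum>w\<in>cells (r + Suc n * M). ?P (Suc n) w * len w) = (\<Sum>w\<in>subcells 0 (?m + M) (u0, v0). ?P (Suc n) w * len w)"
    by (simp only: subcells_root mult_Suc) (simp add: ac_simps)
  also have "\<dots> \<le> (\<Sum>w\<in>subcells 0 ?m (u0, v0). \<Sum>w'\<in>subcells (0 + ?m) M w. ?P (Suc n) w' * len w')"
  proof (rule sum_subcells_add[OF root_cell])
    fix w' assume "w' \<in> cells (0 + ?m + M)"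
    then have "w' \<in> cells (r + Suc n * M)" by (simp add: ac_simps)
    then show "0 \<le> ?P (Suc n) w' * len w'" using P0[of w' "Suc n"] cellD(2)[of w' "r + Suc n * M"]
      by (intro mult_nonneg_nonneg) simp_all
  qed
  also have "\<dots> = (\<Sum>w\<in>cells ?m. \<Sum>w'\<in>subcells ?m M w. ?P n w * (R n w' * len w'))"
    unfolding subcells_root add_0
  proof (intro sum.cong refl)
    fix w w' assume w: "w \<in> cells ?m" and w': "w' \<in> subcells ?m M w"
    have "?P n w' = ?P n w"
    proof (intro prod.cong refl)
      fix j assume j: "j \<in> {..<n}"
      then have "Suc j * M \<le> n * M" by (intro mult_le_mono1) auto
      then have "cell (r + Suc j * M) (mid w') = cell (r + Suc j * M) (mid w)"
        by (intro cell_const[OF w]) (use mid_in[OF w] mid_in_sub[OF w'] in auto)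
      then show "R j (cell (r + Suc j * M) (mid w')) = R j (cell (r + Suc j * M) (mid w))" by simp
    qed
    moreover have c': "w' \<in> cells (r + Suc n * M)" using subcells_cells[OF w'] by (simp add: ac_simps)
    have "cell (r + Suc n * M) (mid w') = w'" by (rule cell_eq[OF c' mid_in[OF c']])
    ultimately show "?P (Suc n) w' * len w' = ?P n w * (R n w' * len w')"
      unfolding prod.lessThan_Suc by (simp add: mult.assoc)
  qed
  also have "\<dots> \<le> (\<Sum>w\<in>cells ?m. ?P n w * len w)"
    unfolding sum_distrib_left[symmetric] using P0[of _ n] bound by (intro sum_mono mult_left_mono) auto
  also note Suc
  finally show ?case .
qed

lemma supermartingale_AE:
  assumes nonneg: "\<And>j w'. w' \<in> cells (r + Suc j * M) \<Longrightarrow> R j w' \<ge> (0::real)"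
    and bound: "\<And>j w. w \<in> cells (r + j * M) \<Longrightarrow> (\<Sum>w'\<in>subcells (r + j * M) M w. R j w' * len w') \<le> len w"
    and x: "x > 1"
  shows "AE t in lborel. t \<in> {u0..v0} - (\<Union>n. Zs n) \<longrightarrow>
    (\<forall>\<^sub>F n in sequentially. (\<Prod>j<n. R j (cell (r + Suc j * M) t)) \<le> x ^ n)"
proof -
  let ?P = "\<lambda>n t. \<Prod>j<n. R j (cell (r + Suc j * M) t)"
  define F where "F n = {w \<in> cells (r + n * M). ?P n (mid w) > x ^ n}" for n
  define A where "A n = (\<Union>w\<in>F n. ivl w)" for n
  have finF: "finite (F n)" for n using finite_cells' by (simp add: F_def)
  have Fc: "w \<in> cells (r + n * M)" if "w \<in> F n" for n w using that by (simp only: F_def mem_Collect_eq)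
  have meas: "measure lborel (A n) = (\<Sum>w\<in>F n. len w)" for n
    unfolding A_def by (rule sum_len_eq_measure[symmetric, OF finF cellD(2)[OF Fc] cells_disjoint])
      (use Fc in blast)+
  have Am: "A n \<in> sets lborel" for n unfolding A_def using finF by auto
  have Asub: "A n \<subseteq> {u0..v0}" for n unfolding A_def using ivl_sub[OF Fc] by blast
  have Afin: "emeasure lborel (A n) < \<infinity>" for n
    using emeasure_mono[OF Asub, of lborel n] uv by (auto simp: less_top[symmetric] top_unique)
  have le: "measure lborel (A n) \<le> (v0 - u0) * (1 / x) ^ n" for n
  proof -
    have "x ^ n * (\<Sum>w\<in>F n. len w) = (\<Sum>w\<in>F n. x ^ n * len w)" by (rule sum_distrib_left)
    also have "\<dots> \<le> (\<Sum>w\<in>F n. ?P n (mid w) * len w)"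
    proof (intro sum_mono mult_right_mono)
      fix w assume w: "w \<in> F n"
      then show "x ^ n \<le> ?P n (mid w)" by (simp add: F_def)
      show "0 \<le> len w" using cellD(2)[OF Fc[OF w]] by simp
    qed
    also have "\<dots> \<le> (\<Sum>w\<in>cells (r + n * M). ?P n (mid w) * len w)"
    proof (rule sum_mono2[OF finite_cells'])
      fix w assume w: "w \<in> cells (r + n * M) - F n"
      then have "0 \<le> ?P n (mid w)"
        using cell_mid_level[of w r n M] by (intro prod_nonneg nonneg) auto
      moreover have "len w \<ge> 0" using w cellD(2)[of w "r + n * M"] by auto
      ultimately show "0 \<le> ?P n (mid w) * len w" by simp
    qed (use Fc in blast)
    also have "\<dots> \<le> v0 - u0" by (rule supermartingale_sum[OF nonneg bound])
    finally show ?thesis using x unfolding meas by (simp add: power_one_over pos_le_divide_eq mult.commute)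
  qed
  have summ: "summable (\<lambda>n. measure lborel (A n))"
  proof (rule summable_comparison_test')
    show "summable (\<lambda>n. (v0 - u0) * (1 / x) ^ n)" using x by (intro summable_mult summable_geometric) auto
    show "norm (measure lborel (A n)) \<le> (v0 - u0) * (1 / x) ^ n" if "n \<ge> 0" for n using le[of n] by simp
  qed
  have "AE t in lborel. eventually (\<lambda>n. t \<in> space lborel - A n) sequentially"
    by (rule borel_cantelli_AE1[OF Am Afin summ])
  then show ?thesis
  proof (rule AE_mp, intro AE_I2 impI)
    fix t assume ev: "eventually (\<lambda>n. t \<in> space lborel - A n) sequentially" and t: "t \<in> {u0..v0} - (\<Union>n. Zs n)"
    from ev show "\<forall>\<^sub>F n in sequentially. ?P n t \<le> x ^ n"
    proof eventually_elim
      case (elim n)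
      define w where "w = cell (r + n * M) t"
      have w: "w \<in> cells (r + n * M)" "t \<in> ivl w" using cell_in[of t "r + n * M"] t unfolding w_def by blast+
      have "?P n t = ?P n (mid w)"
      proof (intro prod.cong refl)
        fix j assume j: "j \<in> {..<n}"
        then have "Suc j * M \<le> n * M" by (intro mult_le_mono1) auto
        then have "cell (r + Suc j * M) t = cell (r + Suc j * M) (mid w)"
          by (intro cell_const[OF w(1)]) (use mid_in[OF w(1)] w(2) in auto)
        then show "R j (cell (r + Suc j * M) t) = R j (cell (r + Suc j * M) (mid w))" by simp
      qed
      moreover have "w \<notin> F n" using elim w(2) unfolding A_def by blast
      ultimately show ?case using w(1) by (simp add: F_def not_less)
    qed
  qed
qed

end

context separated_tent_curve begin

lemma D_ge_2: "D \<ge> 2"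
  using mu by (simp add: D_def)

lemma N_pos: "N > 0"
  using N D_ge_2 by (cases N) auto

definition h0 :: nat where "h0 = nat \<lceil>2 * (1 + C0)\<rceil>"

lemma h0: "2 * (1 + C0) \<le> 2 ^ h0"
proof -
  have "2 * (1 + C0) \<le> real h0" unfolding h0_def by linarith
  also have "\<dots> \<le> 2 ^ h0" using of_nat_less_two_power[of h0, where 'a=real] by simp
  finally show ?thesis .
qed

definition hit_bound :: "nat \<Rightarrow> real \<Rightarrow> real \<Rightarrow> real" where
  "hit_bound k p q = (q - p + 2 * (D * Lam / mu ^ (k * N))) * (D / Lam)"

lemma hit_bound_nonneg: "p \<le> q \<Longrightarrow> hit_bound k p q \<ge> 0"
  using D_pos Lam mu by (simp add: hit_bound_def)

lemma AE_rare_small_cells: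
  assumes k: "k > 0"
  defines "M \<equiv> 2 * (k * N)"
  shows "AE t in lborel. t \<in> {u0..v0} - (\<Union>n. Zs n) \<longrightarrow>
    (\<forall>\<^sub>F n in sequentially. k * card {j. j < n \<and> V (r + j * M) (cell (r + j * M) t) \<ge> 2 ^ k} \<le> (h0 + 1) * n)"
proof -
  define R where "R j w' = V (r + Suc j * M) w' / (V (r + j * M) (cell (r + j * M) (mid w')) / 2 ^ k + C0)" for j w'
  have den: "V i w / 2 ^ k + C0 > 0" if "w \<in> cells i" for i w
  proof -
    have "V i w / 2 ^ k > 0" using V_ge_1[OF that] by simp
    then show ?thesis using C0_pos by simp
  qed
  have cell_mid: "cell (r + j * M) (mid w') = w" if "w \<in> cells (r + j * M)" "w' \<in> subcells (r + j * M) M w" for j w w'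
    by (rule cell_eq[OF that(1) mid_in_sub[OF that(2)]])
  have "AE t in lborel. t \<in> {u0..v0} - (\<Union>n. Zs n) \<longrightarrow>
    (\<forall>\<^sub>F n in sequentially. (\<Prod>j<n. R j (cell (r + Suc j * M) t)) \<le> 2 ^ n)"
  proof (rule supermartingale_AE)
    fix j w' assume w': "w' \<in> cells (r + Suc j * M)"
    then have "w' \<in> cells (r + j * M + M)" by (simp add: ac_simps)
    then obtain w where w: "w \<in> cells (r + j * M)" "w' \<in> subcells (r + j * M) M w" by (rule cell_parent)
    have "0 \<le> V (r + Suc j * M) w'" using V_ge_1[OF w'] by simp
    then show "0 \<le> R j w'" unfolding R_def cell_mid[OF w] using den[OF w(1)] by (intro divide_nonneg_pos)
  next
    fix j w assume w: "w \<in> cells (r + j * M)"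
    let ?l = "r + j * M"
    let ?g = "V ?l w / 2 ^ k + C0"
    have "(\<Sum>w'\<in>subcells ?l M w. R j w' * len w') = (\<Sum>w'\<in>subcells ?l M w. len w' * V (?l + M) w') / ?g"
      unfolding sum_divide_distrib
    proof (intro sum.cong refl)
      fix w' assume w': "w' \<in> subcells ?l M w"
      show "R j w' * len w' = len w' * V (?l + M) w' / ?g"
        unfolding R_def cell_mid[OF w w'] by (simp add: ac_simps)
    qed
    also have "\<dots> \<le> ((V ?l w / 2 ^ (2 * k) + C0) * len w) / ?g"
      using drift[OF w, of "2 * k"] den[OF w] by (intro divide_right_mono) (auto simp: M_def mult.assoc)
    also have "\<dots> \<le> (?g * len w) / ?g"
    proof -
      have "V ?l w / 2 ^ (2 * k) \<le> V ?l w / 2 ^ k"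
        using V_ge_1[OF w] by (intro divide_left_mono power_increasing) auto
      then show ?thesis using den[OF w] cellD(2)[OF w] by (intro divide_right_mono mult_right_mono) auto
    qed
    also have "\<dots> = len w" using den[OF w] by simp
    finally show "(\<Sum>w'\<in>subcells ?l M w. R j w' * len w') \<le> len w" .
  qed simp
  then show ?thesis
  proof (rule AE_mp, intro AE_I2 impI)
    fix t assume t: "t \<in> {u0..v0} - (\<Union>n. Zs n)" and "t \<in> {u0..v0} - (\<Union>n. Zs n) \<longrightarrow>
      (\<forall>\<^sub>F n in sequentially. (\<Prod>j<n. R j (cell (r + Suc j * M) t)) \<le> 2 ^ n)"
    then have ev: "\<forall>\<^sub>F n in sequentially. (\<Prod>j<n. R j (cell (r + Suc j * M) t)) \<le> 2 ^ n" by blast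
    have ci: "cell i t \<in> cells i" "t \<in> ivl (cell i t)" for i using cell_in[of t i] t by blast+
    have "R j (cell (r + Suc j * M) t) = V (r + Suc j * M) (cell (r + Suc j * M) t) / (V (r + j * M) (cell (r + j * M) t) / 2 ^ k + C0)" for j
    proof -
      have "cell (r + j * M) (mid (cell (r + Suc j * M) t)) = cell (r + j * M) t"
        by (rule cell_const[OF ci(1)[of "r + Suc j * M"] _ mid_in[OF ci(1)] ci(2)]) simp
      then show ?thesis by (simp add: R_def)
    qed
    then have ev': "\<forall>\<^sub>F n in sequentially. (\<Prod>j<n. V (r + Suc j * M) (cell (r + Suc j * M) t) /
       (V (r + j * M) (cell (r + j * M) t) / 2 ^ k + C0)) \<le> 2 ^ n" using ev by simp
    show "\<forall>\<^sub>F n in sequentially. k * card {j. j < n \<and> V (r + j * M) (cell (r + j * M) t) \<ge> 2 ^ k} \<le> (h0 + 1) * n"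
      by (rule rare_large_values[where v = "\<lambda>j. V (r + j * M) (cell (r + j * M) t)", OF V_ge_1[OF ci(1)] _ h0 ev'])
        (use C0_pos in simp)
  qed
qed

lemma AE_rare_hits:
  assumes k: "k > 0" and pq: "p \<le> q"
  defines "M \<equiv> 2 * (k * N)"
  shows "AE t in lborel. t \<in> {u0..v0} - (\<Union>n. Zs n) \<longrightarrow>
    (\<forall>\<^sub>F n in sequentially. real (card {j. j < n \<and> p \<le> z (k * N + r + j * M) t \<and> z (k * N + r + j * M) t \<le> q})
      \<le> real n * (real (h0 + 3) / k + 2 * (hit_bound k p q * (1 + C0))))"
proof -
  define pr where "pr i w = min 1 (hit_bound k p q * (V i w / 2 ^ k + C0))" for i w
  define R where "R j w' = (if hit (r + j * M + k * N) p q w' then 2 else 1) /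
    (1 + pr (r + j * M) (cell (r + j * M) (mid w')))" for j w'
  have pr: "0 \<le> pr i w \<and> pr i w \<le> 1" if "w \<in> cells i" for i w
  proof -
    have "0 \<le> V i w / 2 ^ k + C0" using V_ge_1[OF that] C0_pos by simp
    then show ?thesis using hit_bound_nonneg[OF pq] by (simp add: pr_def)
  qed
  have cell_mid: "cell (r + j * M) (mid w') = w" if "w \<in> cells (r + j * M)" "w' \<in> subcells (r + j * M) M w" for j w w'
    by (rule cell_eq[OF that(1) mid_in_sub[OF that(2)]])
  have "AE t in lborel. t \<in> {u0..v0} - (\<Union>n. Zs n) \<longrightarrow>
    (\<forall>\<^sub>F n in sequentially. (\<Prod>j<n. R j (cell (r + Suc j * M) t)) \<le> exp (1 / k) ^ n)"
  proof (rule supermartingale_AE)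
    fix j w' assume w': "w' \<in> cells (r + Suc j * M)"
    then have "w' \<in> cells (r + j * M + M)" by (simp add: ac_simps)
    then obtain w where w: "w \<in> cells (r + j * M)" "w' \<in> subcells (r + j * M) M w" by (rule cell_parent)
    show "0 \<le> R j w'" unfolding R_def cell_mid[OF w] using pr[OF w(1)] by simp
  next
    fix j w assume w: "w \<in> cells (r + j * M)"
    let ?l = "r + j * M"
    let ?S = "subcells ?l M w" and ?h = "hit (?l + k * N) p q"
    have lw: "len w \<ge> 0" using cellD(2)[OF w] by simp
    have MM: "M = k * N + k * N" by (simp add: M_def)
    have hs: "(\<Sum>w'\<in>{w'\<in>?S. ?h w'}. len w') \<le> pr ?l w * len w"
    proof -
      have "(\<Sum>w'\<in>{w'\<in>?S. ?h w'}. len w') \<le> len w" by (rule sum_len_subcells[OF w, of _ M]) auto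
      moreover have "(\<Sum>w'\<in>{w'\<in>?S. ?h w'}. len w') \<le> hit_bound k p q * (V ?l w / 2 ^ k + C0) * len w"
        using hit_prob[OF w pq, of k "k * N"] unfolding MM[symmetric] hit_bound_def .
      ultimately show ?thesis by (simp add: pr_def min_def)
    qed
    have "(\<Sum>w'\<in>?S. R j w' * len w') = (\<Sum>w'\<in>?S. len w' + (if ?h w' then len w' else 0)) / (1 + pr ?l w)"
      unfolding sum_divide_distrib
    proof (intro sum.cong refl)
      fix w' assume w': "w' \<in> ?S"
      show "R j w' * len w' = (len w' + (if ?h w' then len w' else 0)) / (1 + pr ?l w)"
        unfolding R_def cell_mid[OF w w'] by simp
    qed
    also have "(\<Sum>w'\<in>?S. len w' + (if ?h w' then len w' else 0)) = (\<Sum>w'\<in>?S. len w') + (\<Sum>w'\<in>{w'\<in>?S. ?h w'}. len w')"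
      using finite_subcells by (simp only: sum.distrib sum.inter_filter)
    also have "\<dots> / (1 + pr ?l w) \<le> (len w + pr ?l w * len w) / (1 + pr ?l w)"
      using hs sum_len_subcells[OF w order_refl, of M] pr[OF w] by (intro divide_right_mono add_mono) auto
    also have "len w + pr ?l w * len w = (1 + pr ?l w) * len w" by (simp only: distrib_right mult_1)
    also have "\<dots> / (1 + pr ?l w) = len w" using pr[OF w] by simp
    finally show "(\<Sum>w'\<in>?S. R j w' * len w') \<le> len w" .
  qed (use k in simp)
  moreover have "AE t in lborel. t \<in> {u0..v0} - (\<Union>n. Zs n) \<longrightarrow>
    (\<forall>\<^sub>F n in sequentially. k * card {j. j < n \<and> V (r + j * M) (cell (r + j * M) t) \<ge> 2 ^ k} \<le> (h0 + 1) * n)"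
    unfolding M_def by (rule AE_rare_small_cells[OF k])
  ultimately show ?thesis
  proof eventually_elim
    case (elim t)
    show ?case
    proof
      assume t: "t \<in> {u0..v0} - (\<Union>n. Zs n)"
      have ci: "cell i t \<in> cells i" "t \<in> ivl (cell i t)" for i using cell_in[of t i] t by blast+
      let ?p = "\<lambda>j. pr (r + j * M) (cell (r + j * M) t)"
      let ?Y = "\<lambda>j. hit (r + j * M + k * N) p q (cell (r + Suc j * M) t)"
      let ?b = "\<lambda>j. V (r + j * M) (cell (r + j * M) t) \<ge> 2 ^ k"
      have "R j (cell (r + Suc j * M) t) = (if ?Y j then 2 else 1) / (1 + ?p j)" for j
      proof -
        have "cell (r + j * M) (mid (cell (r + Suc j * M) t)) = cell (r + j * M) t"
          by (rule cell_const[OF ci(1)[of "r + Suc j * M"] _ mid_in[OF ci(1)] ci(2)]) simp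
        then show ?thesis by (simp add: R_def)
      qed
      then have ev: "\<forall>\<^sub>F n in sequentially. (\<Prod>j<n. (if ?Y j then 2 else 1) / (1 + ?p j)) \<le> exp (1 / k) ^ n"
        using elim(1) t by simp
      have "\<forall>\<^sub>F n in sequentially. real (card {j. j < n \<and> ?Y j})
        \<le> real n * (2 * (1 / k) + 2 * (hit_bound k p q * (1 + C0))) + real (card {j. j < n \<and> ?b j})"
      proof (rule rare_hits[OF _ _ _ ev])
        show "0 \<le> ?p j \<and> ?p j \<le> 1" for j by (rule pr[OF ci(1)])
        show "0 \<le> hit_bound k p q * (1 + C0)" using hit_bound_nonneg[OF pq] C0_pos by simp
        show "?p j \<le> hit_bound k p q * (1 + C0)" if "\<not> ?b j" for j
        proof -
          have "V (r + j * M) (cell (r + j * M) t) / 2 ^ k + C0 \<le> 1 + C0" using that by (simp add: divide_le_eq)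
          then have "hit_bound k p q * (V (r + j * M) (cell (r + j * M) t) / 2 ^ k + C0) \<le> hit_bound k p q * (1 + C0)"
            using hit_bound_nonneg[OF pq] by (intro mult_left_mono)
          then show ?thesis by (simp add: pr_def)
        qed
      qed simp
      moreover have "\<forall>\<^sub>F n in sequentially. k * card {j. j < n \<and> ?b j} \<le> (h0 + 1) * n" using elim(2) t by blast
      ultimately show "\<forall>\<^sub>F n in sequentially. real (card {j. j < n \<and> p \<le> z (k * N + r + j * M) t \<and> z (k * N + r + j * M) t \<le> q})
        \<le> real n * (real (h0 + 3) / k + 2 * (hit_bound k p q * (1 + C0)))"
      proof eventually_elim
        case (elim n)
        have "{j. j < n \<and> p \<le> z (k * N + r + j * M) t \<and> z (k * N + r + j * M) t \<le> q} \<subseteq> {j. j < n \<and> ?Y j}"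
          using ci(2) unfolding hit_def by (auto simp: ac_simps intro!: bexI[of _ t])
        then have "card {j. j < n \<and> p \<le> z (k * N + r + j * M) t \<and> z (k * N + r + j * M) t \<le> q} \<le> card {j. j < n \<and> ?Y j}"
          by (intro card_mono) auto
        then have "real (card {j. j < n \<and> p \<le> z (k * N + r + j * M) t \<and> z (k * N + r + j * M) t \<le> q})
          \<le> real n * (2 * (1 / k) + 2 * (hit_bound k p q * (1 + C0))) + real (card {j. j < n \<and> ?b j})"
          using elim(1) by linarith
        moreover have "real (card {j. j < n \<and> ?b j}) \<le> real n * (real (h0 + 1) / k)"
        proof -
          have "real k * real (card {j. j < n \<and> ?b j}) \<le> real (h0 + 1) * real n"
            using elim(2) by (simp only: of_nat_mult[symmetric] of_nat_le_iff)
          then show ?thesis using k by (simp add: field_simps)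
        qed
        ultimately have "real (card {j. j < n \<and> p \<le> z (k * N + r + j * M) t \<and> z (k * N + r + j * M) t \<le> q})
          \<le> real n * (2 * (1 / k) + 2 * (hit_bound k p q * (1 + C0))) + real n * (real (h0 + 1) / k)" by linarith
        also have "\<dots> = real n * (real (h0 + 3) / k + 2 * (hit_bound k p q * (1 + C0)))"
          by (simp add: add_divide_distrib distrib_left)
        finally show ?case .
      qed
    qed
  qed
qed

lemma null_Zs: "(\<Union>n. Zs n) \<in> null_sets lborel"
  by (rule countable_imp_null_set_lborel, rule countable_UN) (auto intro: countable_finite finite_Zs)

theorem AE_orbit_density:
  "AE t in lborel. t \<in> {u0..v0} \<longrightarrow> (\<forall>p\<in>\<rat>. \<forall>q\<in>\<rat>. p < q \<longrightarrow>
     upper_density_le (\<lambda>i. p \<le> z i t \<and> z i t \<le> q) (2 * (D / Lam) * (1 + C0) * (q - p)))"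
proof -
  have "AE t in lborel. \<forall>k\<in>{0<..}. \<forall>r\<in>UNIV. \<forall>p\<in>\<rat>. \<forall>q\<in>{q\<in>\<rat>. p < q}. t \<in> {u0..v0} - (\<Union>n. Zs n) \<longrightarrow>
    (\<forall>\<^sub>F n in sequentially. real (card {j. j < n \<and> p \<le> z (k * N + r + j * (2 * (k * N))) t \<and> z (k * N + r + j * (2 * (k * N))) t \<le> q})
      \<le> real n * (real (h0 + 3) / k + 2 * (hit_bound k p q * (1 + C0))))"
    by (intro AE_ball_countable[THEN iffD2] ballI AE_rare_hits)
      (auto simp: countable_rat intro: countable_subset[OF _ countable_rat])
  moreover have "AE t in lborel. t \<notin> (\<Union>n. Zs n)" using null_Zs by (rule AE_not_in)
  ultimately show ?thesis
  proof eventually_elim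
    case (elim t)
    show ?case
    proof (intro impI ballI)
      fix p q :: real assume t: "t \<in> {u0..v0}" and pq: "p \<in> \<rat>" "q \<in> \<rat>" "p < q"
      let ?c = "2 * (D / Lam) * (1 + C0) * (q - p)"
      let ?P = "\<lambda>i. p \<le> z i t \<and> z i t \<le> q"
      define \<kappa> where "\<kappa> k = real (h0 + 3) / real k + 2 * (hit_bound k p q * (1 + C0))" for k
      have le: "upper_density_le ?P (\<kappa> k)" if k: "k > 0" for k
      proof (rule upper_density_le_residues)
        show "2 * (k * N) > 0" using k N_pos by simp
        show "\<kappa> k \<ge> 0" using hit_bound_nonneg[of p q k] pq C0_pos by (simp add: \<kappa>_def)
        show "\<forall>\<^sub>F n in sequentially. real (card {j. j < n \<and> ?P (k * N + r + j * (2 * (k * N)))}) \<le> real n * \<kappa> k" for r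
          using elim t pq k unfolding \<kappa>_def by simp
      qed
      have "(\<lambda>k. \<kappa> k) \<longlonglongrightarrow> 0 + 2 * ((q - p + 2 * (D * Lam * 0)) * (D / Lam) * (1 + C0))"
      proof -
        have "(\<lambda>k. (1 / mu ^ N) ^ k) \<longlonglongrightarrow> 0"
          using mu N_pos by (intro LIMSEQ_realpow_zero) (auto simp: one_less_power)
        then have "(\<lambda>k. 1 / mu ^ (k * N)) \<longlonglongrightarrow> 0"
          by (simp add: power_one_over power_mult[symmetric] mult.commute)
        moreover have "(\<lambda>k. real (h0 + 3) / real k) \<longlonglongrightarrow> 0" by (rule lim_const_over_n)
        moreover have "\<kappa> = (\<lambda>k. real (h0 + 3) / real k + 2 * ((q - p + 2 * (D * Lam * (1 / mu ^ (k * N)))) * (D / Lam) * (1 + C0)))"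
          by (simp add: \<kappa>_def hit_bound_def fun_eq_iff)
        ultimately show ?thesis by (simp only:) (intro tendsto_intros)
      qed
      then have lim: "\<kappa> \<longlonglongrightarrow> ?c" by (simp add: mult_ac)
      show "upper_density_le ?P ?c" unfolding upper_density_le_def
      proof (intro allI impI)
        fix \<epsilon> :: real assume \<epsilon>: "\<epsilon> > 0"
        have "\<forall>\<^sub>F k in sequentially. \<kappa> k < ?c + \<epsilon> / 2" using order_tendstoD(2)[OF lim, of "?c + \<epsilon> / 2"] \<epsilon> by simp
        with eventually_gt_at_top[of "0::nat"] have "\<forall>\<^sub>F k in sequentially. k > 0 \<and> \<kappa> k < ?c + \<epsilon> / 2"
          by eventually_elim auto
        then obtain k where k: "k > 0" "\<kappa> k < ?c + \<epsilon> / 2" using eventually_happens'[OF sequentially_bot] by blast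
        have "\<forall>\<^sub>F n in sequentially. real (card {i. i < n \<and> ?P i}) \<le> real n * (\<kappa> k + \<epsilon> / 2)"
          using le[OF k(1)] \<epsilon> unfolding upper_density_le_def by (meson half_gt_zero)
        then show "\<forall>\<^sub>F n in sequentially. real (card {i. i < n \<and> ?P i}) \<le> real n * (?c + \<epsilon>)"
        proof eventually_elim
          case (elim n)
          have "real n * (\<kappa> k + \<epsilon> / 2) \<le> real n * (?c + \<epsilon>)" using k(2) by (intro mult_left_mono) auto
          then show ?case using elim by linarith
        qed
      qed
    qed
  qed
qed

end

section \<open>Limits of empirical measures\<close>

lemma continuous_skew_tent: "\<beta> > 1 \<Longrightarrow> continuous_on UNIV (skew_tent \<alpha> \<beta>)"
proof -
  have "skew_tent \<alpha> \<beta> x = 1 + \<alpha> * min (x - turning_point \<beta>) 0 - \<beta> * max (x - turning_point \<beta>) 0" for x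
    by (auto simp: skew_tent_def min_def max_def)
  then show ?thesis by (simp, intro continuous_intros)
qed

lemma emeasure_countable_disjoint_le:
  fixes M N :: "'a measure"
  assumes sub: "countable I" "disjoint_family_on X I" "\<And>i. i \<in> I \<Longrightarrow> X i \<in> sets M" "sets N = sets M"
    and le: "\<And>i. i \<in> I \<Longrightarrow> emeasure N (X i) \<le> c * emeasure M (X i)"
  shows "emeasure N (\<Union>i\<in>I. X i) \<le> c * emeasure M (\<Union>i\<in>I. X i)"
proof -
  have "emeasure N (\<Union>i\<in>I. X i) = (\<integral>\<^sup>+i. emeasure N (X i) \<partial>count_space I)"
    using sub by (intro emeasure_UN_countable) auto
  also have "\<dots> \<le> (\<integral>\<^sup>+i. c * emeasure M (X i) \<partial>count_space I)"
    using le by (intro nn_integral_mono) auto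
  also have "\<dots> = c * (\<integral>\<^sup>+i. emeasure M (X i) \<partial>count_space I)" by (rule nn_integral_cmult) simp
  also have "(\<integral>\<^sup>+i. emeasure M (X i) \<partial>count_space I) = emeasure M (\<Union>i\<in>I. X i)"
    using sub by (intro emeasure_UN_countable[symmetric]) auto
  finally show ?thesis .
qed

lemma null_if_interval_bound:
  fixes M :: "real measure"
  assumes M: "real_distribution M" and C: "C \<ge> 0"
    and bound: "\<And>p q. p < q \<Longrightarrow> measure M {p..q} \<le> C * (q - p)"
    and A: "A \<in> sets borel" "A \<subseteq> {0..1}" "emeasure lborel A = 0"
  shows "emeasure M A = 0"
proof -
  interpret real_distribution M by (rule M)
  have em: "emeasure M {p..q} \<le> ennreal C * emeasure lborel {p..q}" if "p < q" for p q
    using bound[OF that] that C by (simp add: emeasure_eq_measure ennreal_mult[symmetric])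
  have pt: "emeasure M {x} = 0" for x
  proof -
    have "measure M {x} \<le> e" if e: "e > 0" for e
    proof -
      define h where "h = e / (2 * (C + 1))"
      have h: "h > 0" using e C by (simp add: h_def)
      have "measure M {x} \<le> measure M {x - h..x + h}" using h by (intro finite_measure_mono) auto
      also have "\<dots> \<le> C * (x + h - (x - h))" using h by (intro bound) auto
      also have "\<dots> \<le> (C + 1) * (2 * h)" using h by (simp add: algebra_simps)
      also have "\<dots> = e" using C by (simp add: h_def field_simps)
      finally show ?thesis .
    qed
    then have "measure M {x} \<le> 0" by (meson dense_ge)
    then show ?thesis by (simp add: emeasure_eq_measure measure_le_0_iff)
  qed
  have ctb: "emeasure M S = 0" if "countable S" for S
  proof -
    have "(\<Union>x\<in>S. {x}) \<in> null_sets M" using that pt by (intro null_sets_UN') auto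
    then show ?thesis by auto
  qed
  have *: "emeasure M A \<le> ennreal e" if e: "e > 0" for e
  proof -
    have C1: "e / (C + 1) > 0" using e C by simp
    have Al: "A \<in> lmeasurable" "measure lebesgue A = 0"
      using A by (auto intro!: fmeasurableI simp: measure_def)
    have Ac: "A \<subseteq> cbox 0 1" using A by simp
    obtain \<D> where D: "countable \<D>" "\<And>K. K \<in> \<D> \<Longrightarrow> K \<subseteq> cbox 0 1 \<and> K \<noteq> {} \<and> (\<exists>c d. K = cbox c d)"
        "pairwise (\<lambda>A B. interior A \<inter> interior B = {}) \<D>"
        "A \<subseteq> \<Union>\<D>" "\<Union>\<D> \<in> lmeasurable" "measure lebesgue (\<Union>\<D>) \<le> measure lebesgue A + e / (C + 1)"
      by (rule measurable_outer_intervals_bounded[OF Al(1) Ac C1]) blast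
    have K: "\<exists>c d. c \<le> d \<and> K = {c..d}" if "K \<in> \<D>" for K using D(2)[OF that] by fastforce
    have intK: "interior K \<subseteq> K" for K :: "real set" by (rule interior_subset)
    have cd: "countable (\<Union>K\<in>\<D>. K - interior K)"
    proof (intro countable_UN D(1))
      fix K assume "K \<in> \<D>"
      then obtain c d where "K = {c..d}" using K by blast
      then have "K - interior K \<subseteq> {c, d}" by auto
      then show "countable (K - interior K)" by (meson countable_finite finite.emptyI finite.insertI finite_subset)
    qed
    have sub: "A \<subseteq> (\<Union>K\<in>\<D>. interior K) \<union> (\<Union>K\<in>\<D>. K - interior K)" using D(4) by blast
    have o: "(\<Union>K\<in>\<D>. interior K) \<in> sets borel" by (intro borel_open open_UN) auto
    have c: "(\<Union>K\<in>\<D>. K - interior K) \<in> sets borel" by (rule sets.countable[OF _ cd]) simp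
    have "emeasure M A \<le> emeasure M ((\<Union>K\<in>\<D>. interior K) \<union> (\<Union>K\<in>\<D>. K - interior K))"
      using sub o c by (intro emeasure_mono) auto
    also have "\<dots> \<le> emeasure M (\<Union>K\<in>\<D>. interior K) + emeasure M (\<Union>K\<in>\<D>. K - interior K)"
      using o c by (intro emeasure_subadditive) auto
    also have "\<dots> = emeasure M (\<Union>K\<in>\<D>. interior K)" using ctb[OF cd] by simp
    also have "\<dots> \<le> ennreal C * emeasure lborel (\<Union>K\<in>\<D>. interior K)"
    proof (rule emeasure_countable_disjoint_le[OF D(1)])
      show "disjoint_family_on interior \<D>" using D(3) by (auto simp: pairwise_def disjoint_family_on_def)
      fix K assume "K \<in> \<D>"
      then obtain c d where cd: "c \<le> d" "K = {c..d}" using K by blast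
      show "emeasure M (interior K) \<le> ennreal C * emeasure lborel (interior K)"
      proof (cases "c < d")
        case True
        have "emeasure M (interior K) \<le> emeasure M {c..d}" using cd intK by (intro emeasure_mono) auto
        also have "\<dots> \<le> ennreal C * emeasure lborel {c..d}" by (rule em[OF True])
        finally show ?thesis using cd by simp
      qed (use cd in simp)
    qed auto
    also have "emeasure lborel (\<Union>K\<in>\<D>. interior K) \<le> ennreal (e / (C + 1))"
    proof -
      have "emeasure lborel (\<Union>K\<in>\<D>. interior K) = emeasure lebesgue (\<Union>K\<in>\<D>. interior K)" using o by simp
      also have "\<dots> \<le> emeasure lebesgue (\<Union>\<D>)" using intK D(5) by (intro emeasure_mono) auto
      also have "\<dots> = ennreal (measure lebesgue (\<Union>\<D>))" using D(5) by (intro emeasure_eq_measure2) auto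
      finally show ?thesis using D(6) Al(2) by (simp add: ennreal_leI order_trans)
    qed
    then have "ennreal C * emeasure lborel (\<Union>K\<in>\<D>. interior K) \<le> ennreal C * ennreal (e / (C + 1))"
      by (rule mult_left_mono) simp
    also have "\<dots> = ennreal (C * (e / (C + 1)))" using C C1 by (intro ennreal_mult[symmetric]) auto
    also have "\<dots> \<le> ennreal e" using C e by (intro ennreal_leI) (simp add: field_simps)
    finally show ?thesis .
  qed
  have "emeasure M A \<le> 0" by (rule ennreal_le_epsilon) (use * in simp)
  then show ?thesis by simp
qed

definition trapezoid :: "real \<Rightarrow> real \<Rightarrow> real \<Rightarrow> real \<Rightarrow> real" where
  "trapezoid p q h x = max 0 (1 - max 0 (max (p - x) (x - q)) / h)"

lemma trapezoid:
  assumes "h > 0"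
  shows "continuous_on UNIV (trapezoid p q h)" "0 \<le> trapezoid p q h x" "trapezoid p q h x \<le> 1"
    "p \<le> x \<Longrightarrow> x \<le> q \<Longrightarrow> trapezoid p q h x = 1" "\<not> (p - h \<le> x \<and> x \<le> q + h) \<Longrightarrow> trapezoid p q h x = 0"
proof -
  show "continuous_on UNIV (trapezoid p q h)" unfolding trapezoid_def using assms by (intro continuous_intros) auto
  show "0 \<le> trapezoid p q h x" by (simp add: trapezoid_def)
  show "trapezoid p q h x \<le> 1" using assms by (auto simp: trapezoid_def)
  show "p \<le> x \<Longrightarrow> x \<le> q \<Longrightarrow> trapezoid p q h x = 1" by (simp add: trapezoid_def max_def)
  show "trapezoid p q h x = 0" if "\<not> (p - h \<le> x \<and> x \<le> q + h)"
  proof -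
    have "h \<le> max 0 (max (p - x) (x - q))" using that by auto
    then have "1 \<le> max 0 (max (p - x) (x - q)) / h" using assms by (simp add: pos_le_divide_eq)
    then show ?thesis by (simp add: trapezoid_def)
  qed
qed

lemma measurable_uniform_count_measure:
  "f \<in> A \<rightarrow> space M \<Longrightarrow> f \<in> measurable (uniform_count_measure A) M"
  by (auto simp: measurable_def space_uniform_count_measure sets_uniform_count_measure)

definition orbit_dist :: "(nat \<Rightarrow> real) \<Rightarrow> nat \<Rightarrow> real measure" where
  "orbit_dist x n = distr (uniform_count_measure {..<Suc n}) borel x"

lemma real_distribution_orbit_dist: "real_distribution (orbit_dist x n)"
proof -
  interpret prob_space "uniform_count_measure {..<Suc n}"
    by (rule prob_space_uniform_count_measure) auto
  show ?thesis unfolding orbit_dist_def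
    by (intro real_distribution_distr measurable_uniform_count_measure) simp
qed

lemma integral_orbit_dist:
  fixes f :: "real \<Rightarrow> 'b::{banach, second_countable_topology}"
  assumes "f \<in> borel_measurable borel"
  shows "integral\<^sup>L (orbit_dist x n) f = (1 / real (Suc n)) *\<^sub>R (\<Sum>i<Suc n. f (x i))"
proof -
  have m: "x \<in> measurable (uniform_count_measure {..<Suc n}) borel"
    by (rule measurable_uniform_count_measure) simp
  have "integral\<^sup>L (orbit_dist x n) f = (\<integral>i. f (x i) \<partial>uniform_count_measure {..<Suc n})"
    unfolding orbit_dist_def by (rule integral_distr[OF m assms])
  also have "\<dots> = (\<Sum>i<Suc n. (1 / real (Suc n)) *\<^sub>R f (x i))"
    unfolding uniform_count_measure_def by (subst lebesgue_integral_point_measure_finite) auto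
  finally show ?thesis by (simp only: scaleR_sum_right)
qed

lemma cont_measurable: "continuous_on UNIV f \<Longrightarrow> (f :: real \<Rightarrow> 'b::topological_space) \<in> borel_measurable borel"
  by (rule borel_measurable_continuous_onI)

locale limit_measure =
  fixes T :: "real \<Rightarrow> real" and x :: "nat \<Rightarrow> real" and C :: real and s :: "nat \<Rightarrow> nat" and M :: "real measure"
  assumes T: "continuous_on UNIV T" "\<And>y. y \<in> {0..1} \<Longrightarrow> T y \<in> {0..1}"
    and x: "\<And>i. x i \<in> {0..1}" "\<And>i. x (Suc i) = T (x i)"
    and C: "C \<ge> 0" "\<And>p q. p < q \<Longrightarrow> upper_density_le (\<lambda>i. p \<le> x i \<and> x i \<le> q) (C * (q - p))"
    and s: "strict_mono s" and M: "real_distribution M" and conv: "weak_conv_m (orbit_dist x \<circ> s) M"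
begin

sublocale real_distribution M by (rule M)

lemma lim:
  fixes f :: "real \<Rightarrow> 'b::{banach, second_countable_topology}"
  assumes f: "continuous_on UNIV f" "\<And>y. norm (f y) \<le> B"
  shows "(\<lambda>n. (1 / real (Suc (s n))) *\<^sub>R (\<Sum>i<Suc (s n). f (x i))) \<longlonglongrightarrow> integral\<^sup>L M f"
proof -
  have "(\<lambda>n. integral\<^sup>L ((orbit_dist x \<circ> s) n) f) \<longlonglongrightarrow> integral\<^sup>L M f"
  proof (rule weak_conv_imp_integral_bdd_continuous_conv[OF _ M conv])
    show "real_distribution ((orbit_dist x \<circ> s) n)" for n by (simp add: real_distribution_orbit_dist)
    show "isCont f y" for y using f(1) by (simp add: continuous_on_eq_continuous_at)
    show "norm (f y) \<le> B" for y by (rule f(2))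
  qed
  then show ?thesis by (simp add: integral_orbit_dist[OF cont_measurable[OF f(1)]] del: sum.lessThan_Suc)
qed

lemma integrable_cont:
  fixes f :: "real \<Rightarrow> 'b::{banach, second_countable_topology}"
  assumes f: "continuous_on UNIV f" "\<And>y. norm (f y) \<le> B"
  shows "integrable M f"
  by (rule integrable_const_bound[of _ B]) (use f cont_measurable[OF f(1)] in auto)

lemma s_large: "eventually P sequentially \<Longrightarrow> eventually (\<lambda>n. P (Suc (s n))) sequentially"
proof -
  assume "eventually P sequentially"
  then obtain N where N: "\<And>n. n \<ge> N \<Longrightarrow> P n" by (auto simp: eventually_sequentially)
  have "P (Suc (s n))" if "n \<ge> N" for n using N[of "Suc (s n)"] seq_suble[OF s, of n] that by simp
  then show ?thesis by (auto simp: eventually_sequentially)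
qed

lemma interval_bound:
  assumes pq: "p < q"
  shows "measure M {p..q} \<le> 2 * C * (q - p)"
proof -
  define h where "h = (q - p) / 2"
  have h: "h > 0" using pq by (simp add: h_def)
  let ?f = "trapezoid p q h"
  note f = trapezoid[OF h, where p = p and q = q]
  have nf: "norm (?f y) \<le> 1" for y using f(2,3)[of y] by simp
  have "measure M {p..q} = (\<integral>y. indicator {p..q} y \<partial>M)" by simp
  also have "\<dots> \<le> integral\<^sup>L M ?f"
  proof (rule integral_mono)
    show "integrable M (indicator {p..q} :: real \<Rightarrow> real)" by (simp add: less_top[symmetric])
    show "integrable M ?f" by (rule integrable_cont[OF f(1) nf])
    show "indicator {p..q} y \<le> ?f y" for y using f(2)[of y] f(4)[of y] by (auto simp: indicator_def)
  qed
  also have "\<dots> \<le> 2 * C * (q - p)"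
  proof (rule field_le_epsilon)
    fix e :: real assume e: "e > 0"
    have "upper_density_le (\<lambda>i. p - h \<le> x i \<and> x i \<le> q + h) (C * (q + h - (p - h)))" using h pq by (intro C(2)) auto
    also have "C * (q + h - (p - h)) = 2 * C * (q - p)" by (simp add: h_def)
    finally have "\<forall>\<^sub>F n in sequentially. real (card {i. i < n \<and> p - h \<le> x i \<and> x i \<le> q + h}) \<le> real n * (2 * C * (q - p) + e)"
      using e unfolding upper_density_le_def by blast
    from s_large[OF this] have "\<forall>\<^sub>F n in sequentially. (1 / real (Suc (s n))) *\<^sub>R (\<Sum>i<Suc (s n). ?f (x i)) \<le> 2 * C * (q - p) + e"
    proof eventually_elim
      case (elim n)
      have "(\<Sum>i<Suc (s n). ?f (x i)) \<le> (\<Sum>i<Suc (s n). if p - h \<le> x i \<and> x i \<le> q + h then 1 else 0)"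
        by (intro sum_mono) (use f(3,5) in auto)
      also have "\<dots> = real (card {i. i < Suc (s n) \<and> p - h \<le> x i \<and> x i \<le> q + h})"
        by (subst sum.inter_filter[symmetric]) (auto intro!: arg_cong[where f=card])
      also note elim
      finally show ?case by (simp add: pos_divide_le_eq mult.commute del: sum.lessThan_Suc of_nat_Suc)
    qed
    then show "integral\<^sup>L M ?f \<le> 2 * C * (q - p) + e"
      by (rule tendsto_upperbound[OF lim[OF f(1) nf]]) simp
  qed
  finally show ?thesis .
qed

lemma support: "AE y in M. y \<in> {0..1}"
proof -
  let ?f = "\<lambda>y::real. min 1 (max 0 (max (- y) (y - 1)))"
  have c: "continuous_on UNIV ?f" by (intro continuous_intros)
  have n: "norm (?f y) \<le> 1" for y by auto
  have "?f (x i) = 0" for i using x(1)[of i] by auto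
  then have "(\<lambda>n. 0) \<longlonglongrightarrow> integral\<^sup>L M ?f" using lim[OF c n] by simp
  then have "integral\<^sup>L M ?f = 0" by (simp add: LIMSEQ_const_iff)
  then have "AE y in M. ?f y = 0"
    using integral_nonneg_eq_0_iff_AE[OF integrable_cont[OF c n]] by simp
  then show ?thesis by eventually_elim (auto simp: min_def max_def split: if_splits)
qed

lemma invariant: "distr M borel T = M"
proof (rule Levy_uniqueness)
  have mT: "T \<in> borel_measurable borel" by (rule cont_measurable[OF T(1)])
  show "real_distribution (distr M borel T)" by (rule real_distribution_distr) (use mT in simp)
  show "real_distribution M" by (rule M)
  show "char (distr M borel T) = char M"
  proof
    fix t
    let ?f = "\<lambda>y. iexp (t * y)"
    have c: "continuous_on UNIV ?f" by (intro continuous_intros)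
    have cT: "continuous_on UNIV (\<lambda>y. ?f (T y))"
      using continuous_on_compose2[OF c T(1)] by simp
    have n: "norm (?f y) \<le> 1" for y by simp
    let ?A = "\<lambda>f n. (1 / real (Suc (s n))) *\<^sub>R (\<Sum>i<Suc (s n). f (x i))"
    have "(\<lambda>n. ?A (\<lambda>y. ?f (T y)) n - ?A ?f n) \<longlonglongrightarrow> integral\<^sup>L M (\<lambda>y. ?f (T y)) - integral\<^sup>L M ?f"
      by (intro tendsto_diff lim[OF c n] lim[OF cT n])
    moreover have "(\<lambda>n. ?A (\<lambda>y. ?f (T y)) n - ?A ?f n) \<longlonglongrightarrow> 0"
    proof (rule Lim_null_comparison)
      have "norm (?A (\<lambda>y. ?f (T y)) n - ?A ?f n) \<le> 2 / real (Suc (s n))" for n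
      proof -
        have "?A (\<lambda>y. ?f (T y)) n - ?A ?f n = (1 / real (Suc (s n))) *\<^sub>R (\<Sum>i<Suc (s n). ?f (x (Suc i)) - ?f (x i))"
          by (simp only: x(2) scaleR_diff_right sum_subtractf)
        also have "(\<Sum>i<Suc (s n). ?f (x (Suc i)) - ?f (x i)) = ?f (x (Suc (s n))) - ?f (x 0)"
          by (rule sum_lessThan_telescope)
        finally have eq: "?A (\<lambda>y. ?f (T y)) n - ?A ?f n = (1 / real (Suc (s n))) *\<^sub>R (?f (x (Suc (s n))) - ?f (x 0))" .
        have "norm (?f (x (Suc (s n))) - ?f (x 0)) \<le> 1 + 1" by (intro norm_triangle_le_diff) simp
        then show ?thesis unfolding eq by (simp add: divide_right_mono del: of_nat_Suc)
      qed
      then show "\<forall>\<^sub>F n in sequentially. norm (?A (\<lambda>y. ?f (T y)) n - ?A ?f n) \<le> 2 / real (Suc (s n))" by simp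
      have "(\<lambda>n. 2 / real (Suc n)) \<longlonglongrightarrow> 0" using LIMSEQ_Suc[OF lim_const_over_n[of 2]] .
      from LIMSEQ_subseq_LIMSEQ[OF this s] show "(\<lambda>n. 2 / real (Suc (s n))) \<longlonglongrightarrow> 0" by (simp add: o_def)
    qed
    ultimately have "integral\<^sup>L M (\<lambda>y. ?f (T y)) - integral\<^sup>L M ?f = 0" using LIMSEQ_unique by blast
    moreover have "integral\<^sup>L (distr M borel T) ?f = integral\<^sup>L M (\<lambda>y. ?f (T y))"
      by (rule integral_distr) (use mT cont_measurable[OF c] in simp_all)
    ultimately show "char (distr M borel T) t = char M t" by (simp add: char_def)
  qed
qed

lemma restriction_acip: "acip T (restrict_space M {0..1})"
proof -
  let ?N = "restrict_space M {0..1}"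
  have em: "emeasure ?N A = emeasure M A" if "A \<subseteq> {0..1}" "A \<in> sets borel" for A
    using that by (subst emeasure_restrict_space) auto
  have one: "emeasure M {0..1} = 1"
    using support by (intro emeasure_eq_1_AE) auto
  have sN: "sets ?N = sets unit_borel" by (rule sets_restrict_space_cong) simp
  have spN: "space ?N = {0..1}" by (simp add: space_restrict_space)
  have setsI: "A \<in> sets ?N \<longleftrightarrow> A \<subseteq> {0..1} \<and> A \<in> sets borel" for A
    using sets_restrict_space_iff[of "{0..1}" M A] by simp
  have P: "prob_space ?N" using one em[of "{0..1}"] by (intro prob_spaceI) (simp add: spN)
  have AC: "absolutely_continuous (restrict_space lborel {0..1}) ?N" unfolding absolutely_continuous_def
  proof
    fix A :: "real set" assume "A \<in> null_sets (restrict_space lborel {0..1})"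
    then have "A \<in> sets borel" "A \<subseteq> {0..1}" "emeasure lborel A = 0"
      by (auto simp: null_sets_restrict_space)
    then show "A \<in> null_sets ?N"
    proof (intro null_setsI)
      have C2: "0 \<le> 2 * C" using C(1) by simp
      have "emeasure M A = 0"
        by (rule null_if_interval_bound[OF M C2 interval_bound \<open>A \<in> sets borel\<close> \<open>A \<subseteq> {0..1}\<close> \<open>emeasure lborel A = 0\<close>])
      then show "emeasure ?N A = 0" using em[OF \<open>A \<subseteq> {0..1}\<close> \<open>A \<in> sets borel\<close>] by simp
      show "A \<in> sets ?N" unfolding setsI by (intro conjI) fact+
    qed
  qed
  have mT: "T \<in> borel_measurable borel" by (rule cont_measurable[OF T(1)])
  have TN: "T \<in> measurable ?N ?N"
  proof (rule measurable_restrict_space3)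
    show "T \<in> measurable M M" using mT by simp
    show "T \<in> {0..1} \<rightarrow> {0..1}" using T(2) by blast
  qed
  have inv: "distr ?N ?N T = ?N"
  proof (rule measure_eqI)
    show "sets (distr ?N ?N T) = sets ?N" by simp
    fix A assume "A \<in> sets (distr ?N ?N T)"
    then have A: "A \<in> sets ?N" "A \<subseteq> {0..1}" "A \<in> sets borel" using setsI by auto
    have v: "T -` A \<in> sets borel" using measurable_sets[OF mT A(3)] by simp
    have "emeasure (distr ?N ?N T) A = emeasure ?N (T -` A \<inter> {0..1})"
      using emeasure_distr[OF TN A(1)] by (simp add: spN)
    also have "\<dots> = emeasure M (T -` A \<inter> {0..1})" using v by (intro em) auto
    also have "\<dots> = emeasure M (T -` A)"
      using support v by (intro emeasure_eq_AE) auto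
    also have "\<dots> = emeasure (distr M borel T) A" using mT A(3) by (subst emeasure_distr) auto
    also have "\<dots> = emeasure ?N A" using em A invariant by simp
    finally show "emeasure (distr ?N ?N T) A = emeasure ?N A" .
  qed
  show ?thesis unfolding acip_def using P sN AC TN inv by blast
qed

end

theorem typical_if_density_bound:
  assumes T: "continuous_on UNIV T" "\<And>y. y \<in> {0..1} \<Longrightarrow> T y \<in> {0..1}" and y: "y \<in> {0..1}"
    and C: "C \<ge> 0" "\<And>p q. p < q \<Longrightarrow> upper_density_le (\<lambda>i. p \<le> (T ^^ i) y \<and> (T ^^ i) y \<le> q) (C * (q - p))"
    and \<mu>: "acip T \<mu>" and unique: "\<And>\<nu>. acip T \<nu> \<Longrightarrow> \<nu> = \<mu>"
  shows "typical T \<mu> y"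
proof -
  define x where "x i = (T ^^ i) y" for i
  have x: "x i \<in> {0..1}" for i unfolding x_def using T(2) y by (intro funpow_unit_interval) auto
  have xS: "x (Suc i) = T (x i)" for i by (simp add: x_def)
  have s\<mu>: "sets \<mu> = sets unit_borel" and p\<mu>: "prob_space \<mu>" using \<mu> by (auto simp: acip_def)
  have sp\<mu>: "space \<mu> = {0..1}" using sets_eq_imp_space_eq[OF s\<mu>] by (simp add: space_restrict_space)
  define M where "M = distr \<mu> borel (\<lambda>x. x)"
  have idm: "(\<lambda>x. x) \<in> borel_measurable \<mu>"
    unfolding measurable_cong_sets[OF s\<mu> refl] by (simp add: measurable_restrict_space1)
  have M: "real_distribution M" unfolding M_def
    using prob_space.real_distribution_distr[OF p\<mu> idm] .
  have eqM: "\<nu> = M" if \<nu>: "strict_mono s" "real_distribution \<nu>" "weak_conv_m (orbit_dist x \<circ> s) \<nu>" for s \<nu>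
  proof -
    have C': "upper_density_le (\<lambda>i. p \<le> x i \<and> x i \<le> q) (C * (q - p))" if "p < q" for p q
      unfolding x_def by (rule C(2)[OF that])
    interpret limit_measure T x C s \<nu>
      by (rule limit_measure.intro[OF T x xS C(1) C' \<nu>])
    have r: "restrict_space \<nu> {0..1} = \<mu>" by (rule unique[OF restriction_acip])
    interpret \<nu>: real_distribution \<nu> by (rule \<nu>(2))
    show "\<nu> = M"
    proof (rule measure_eqI)
      show "sets \<nu> = sets M" by (simp add: M_def)
      fix A assume "A \<in> sets \<nu>"
      then have A: "A \<in> sets borel" by simp
      have "emeasure M A = emeasure \<mu> (A \<inter> {0..1})"
        unfolding M_def using idm A sp\<mu> by (subst emeasure_distr) auto
      also have "\<dots> = emeasure \<nu> (A \<inter> {0..1})"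
        unfolding r[symmetric] using A by (subst emeasure_restrict_space) auto
      also have "\<dots> = emeasure \<nu> A" using support A by (intro emeasure_eq_AE) auto
      finally show "emeasure \<nu> A = emeasure M A" ..
    qed
  qed
  have tight: "tight (orbit_dist x)" unfolding tight_def
  proof (intro conjI allI impI real_distribution_orbit_dist)
    fix e :: real assume e: "e > 0"
    have "measure (orbit_dist x n) {-1<..2} = 1" for n
    proof -
      interpret prob_space "uniform_count_measure {..<Suc n}"
        by (rule prob_space_uniform_count_measure) auto
      have m: "x \<in> measurable (uniform_count_measure {..<Suc n}) borel"
        by (rule measurable_uniform_count_measure) simp
      have "x -` {-1<..2} \<inter> space (uniform_count_measure {..<Suc n}) = space (uniform_count_measure {..<Suc n})"
      proof -
        have "-1 < x i \<and> x i \<le> 2" for i using x[of i] by auto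
        then show ?thesis by auto
      qed
      then show ?thesis unfolding orbit_dist_def using m by (subst measure_distr) (auto simp: prob_space)
    qed
    then show "\<exists>a b. a < b \<and> (\<forall>n. 1 - e < measure (orbit_dist x n) {a<..b})"
      using e by (intro exI[of _ "-1"] exI[of _ 2]) simp
  qed
  have wc: "weak_conv_m (orbit_dist x) M"
  proof (rule tight_subseq_weak_converge[OF real_distribution_orbit_dist M tight])
    fix s \<nu> assume *: "strict_mono s" "real_distribution \<nu>" "weak_conv_m (orbit_dist x \<circ> s) \<nu>"
    then show "weak_conv_m (orbit_dist x \<circ> s) M" using eqM[OF *] by simp
  qed
  show ?thesis unfolding typical_def weak_star_conv_def
  proof (intro allI impI)
    fix f :: "real \<Rightarrow> real" assume f: "continuous_on {0..1} f"
    define g where "g y = f (max 0 (min 1 y))" for y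
    have g: "continuous_on UNIV g" unfolding g_def
      by (rule continuous_on_compose2[OF f]) (auto intro!: continuous_intros)
    have gf: "g y = f y" if "y \<in> {0..1}" for y using that by (simp add: g_def)
    obtain B where "\<forall>y\<in>f ` {0..1}. norm y \<le> B"
      using compact_imp_bounded[OF compact_continuous_image[OF f]] unfolding bounded_iff by blast
    then have B: "norm (f y) \<le> B" if "y \<in> {0..1}" for y using that by blast
    have gB: "norm (g y) \<le> B" for y unfolding g_def by (rule B) auto
    have "(\<lambda>n. integral\<^sup>L (orbit_dist x n) g) \<longlonglongrightarrow> integral\<^sup>L M g"
      by (rule weak_conv_imp_integral_bdd_continuous_conv[OF real_distribution_orbit_dist M wc _ gB])
        (use g in \<open>simp add: continuous_on_eq_continuous_at\<close>)
    moreover have "integral\<^sup>L M g = integral\<^sup>L \<mu> f"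
    proof -
      have "integral\<^sup>L M g = integral\<^sup>L \<mu> g"
        unfolding M_def by (rule integral_distr[OF idm cont_measurable[OF g]])
      also have "\<dots> = integral\<^sup>L \<mu> f" by (rule Bochner_Integration.integral_cong) (auto simp: sp\<mu> gf)
      finally show ?thesis .
    qed
    moreover have "integral\<^sup>L (orbit_dist x n) g = integral\<^sup>L (empirical_measure T y (Suc n)) f" for n
    proof -
      have m: "x \<in> measurable (uniform_count_measure {..<Suc n}) unit_borel"
        using x by (intro measurable_uniform_count_measure) (simp add: space_restrict_space)
      have fm: "f \<in> borel_measurable unit_borel" by (rule borel_measurable_continuous_on_restrict[OF f])
      have "integral\<^sup>L (empirical_measure T y (Suc n)) f = (\<integral>i. f (x i) \<partial>uniform_count_measure {..<Suc n})"
        unfolding empirical_measure_def x_def[symmetric] by (rule integral_distr[OF m fm])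
      also have "\<dots> = (\<integral>i. g (x i) \<partial>uniform_count_measure {..<Suc n})"
        by (rule Bochner_Integration.integral_cong) (auto simp: gf[OF x])
      also have "\<dots> = integral\<^sup>L (orbit_dist x n) g"
        unfolding orbit_dist_def
        by (rule integral_distr[symmetric, OF _ cont_measurable[OF g]])
          (rule measurable_uniform_count_measure, simp)
      finally show ?thesis ..
    qed
    ultimately have "(\<lambda>n. integral\<^sup>L (empirical_measure T y (Suc n)) f) \<longlonglongrightarrow> integral\<^sup>L \<mu> f" by simp
    then show "(\<lambda>n. integral\<^sup>L (empirical_measure T y n) f) \<longlonglongrightarrow> integral\<^sup>L \<mu> f" by (rule LIMSEQ_imp_Suc)
  qed
qed

section \<open>Uniqueness of the invariant measure\<close>

lemma emeasure_affine_preimage: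
  assumes "A \<in> sets borel" "(\<kappa>::real) \<noteq> 0"
  shows "emeasure lborel A = ennreal \<bar>\<kappa>\<bar> * emeasure lborel ((\<lambda>x. t + \<kappa> * x) -` A)"
proof -
  have m: "(\<lambda>x. t + \<kappa> * x) -` A \<in> sets borel"
    using measurable_sets[of "\<lambda>x. t + \<kappa> * x" borel borel A] assms(1) by simp
  have "emeasure lborel A = (\<integral>\<^sup>+x. indicator A x \<partial>lborel)" using assms by simp
  also have "\<dots> = ennreal \<bar>\<kappa>\<bar> * (\<integral>\<^sup>+x. indicator A (t + \<kappa> * x) \<partial>lborel)"
    using assms by (intro nn_integral_real_affine) auto
  also have "(\<integral>\<^sup>+x. indicator A (t + \<kappa> * x) \<partial>lborel) = (\<integral>\<^sup>+x. indicator ((\<lambda>x. t + \<kappa> * x) -` A) x \<partial>lborel)"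
    by (intro nn_integral_cong) (auto simp: indicator_def)
  also have "\<dots> = emeasure lborel ((\<lambda>x. t + \<kappa> * x) -` A)" using m by simp
  finally show ?thesis .
qed

lemma null_affine_preimage:
  assumes "A \<in> null_sets lborel" "(\<kappa>::real) \<noteq> 0"
  shows "(\<lambda>x. t + \<kappa> * x) -` A \<in> null_sets lborel"
proof (intro null_setsI)
  have A: "A \<in> sets borel" "emeasure lborel A = 0" using assms by auto
  have "0 = ennreal \<bar>\<kappa>\<bar> * emeasure lborel ((\<lambda>x. t + \<kappa> * x) -` A)"
    using emeasure_affine_preimage[OF A(1) assms(2), of t] unfolding A(2) .
  then show "emeasure lborel ((\<lambda>x. t + \<kappa> * x) -` A) = 0" using assms(2) by (simp del: vimage_def)
  show "(\<lambda>x. t + \<kappa> * x) -` A \<in> sets lborel"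
    using measurable_sets[of "\<lambda>x. t + \<kappa> * x" borel borel A] A by simp
qed

lemma affine_image_Ioo:
  assumes "(\<kappa>::real) \<noteq> 0" "a < b"
  obtains p q where "(\<lambda>x. t + \<kappa> * x) ` {a<..<b} = {p<..<q}" "q - p = \<bar>\<kappa>\<bar> * (b - a)"
proof (cases "\<kappa> > 0")
  case True
  have "(\<lambda>x. t + \<kappa> * x) ` {a<..<b} = {t + \<kappa> * a<..<t + \<kappa> * b}"
  proof (intro set_eqI iffI)
    fix y assume "y \<in> {t + \<kappa> * a<..<t + \<kappa> * b}"
    then have "(y - t) / \<kappa> \<in> {a<..<b}" using True by (auto simp: field_simps)
    moreover have "y = t + \<kappa> * ((y - t) / \<kappa>)" using True by simp
    ultimately show "y \<in> (\<lambda>x. t + \<kappa> * x) ` {a<..<b}" by blast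
  qed (use True in auto)
  then show ?thesis using that True by (simp add: algebra_simps)
next
  case False
  then have neg: "\<kappa> < 0" using assms by simp
  have "(\<lambda>x. t + \<kappa> * x) ` {a<..<b} = {t + \<kappa> * b<..<t + \<kappa> * a}"
  proof (intro set_eqI iffI)
    fix y assume "y \<in> {t + \<kappa> * b<..<t + \<kappa> * a}"
    then have "(y - t) / \<kappa> \<in> {a<..<b}" using neg by (auto simp: field_simps)
    moreover have "y = t + \<kappa> * ((y - t) / \<kappa>)" using neg by simp
    ultimately show "y \<in> (\<lambda>x. t + \<kappa> * x) ` {a<..<b}" by blast
  qed (use neg in auto)
  then show ?thesis using that neg by (simp add: algebra_simps)
qed

lemma affine_push:
  fixes g :: "real \<Rightarrow> real"
  assumes g: "\<And>x. x \<in> {a<..<b} \<Longrightarrow> g x = t + \<kappa> * x" and \<kappa>: "\<kappa> \<noteq> 0" and ab: "a < b" and P: "P \<in> sets borel"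
  obtains p q where "g ` {a<..<b} = {p<..<q}" "q - p = \<bar>\<kappa>\<bar> * (b - a)"
    "emeasure lborel ({p<..<q} - P) = ennreal \<bar>\<kappa>\<bar> * emeasure lborel {x \<in> {a<..<b}. g x \<notin> P}"
proof -
  obtain p q where pq: "(\<lambda>x. t + \<kappa> * x) ` {a<..<b} = {p<..<q}" "q - p = \<bar>\<kappa>\<bar> * (b - a)"
    by (rule affine_image_Ioo[OF \<kappa> ab])
  have img: "g ` {a<..<b} = {p<..<q}" using g pq(1) by (metis (no_types, lifting) image_cong)
  have e: "(\<lambda>x. t + \<kappa> * x) -` ({p<..<q} - P) = {x \<in> {a<..<b}. g x \<notin> P}"
  proof -
    have inj: "x \<in> {a<..<b}" if "t + \<kappa> * x \<in> {p<..<q}" for x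
    proof -
      have "t + \<kappa> * x \<in> (\<lambda>x. t + \<kappa> * x) ` {a<..<b}" using that pq(1) by simp
      then show ?thesis using \<kappa> by auto
    qed
    have "t + \<kappa> * x \<in> {p<..<q}" if "x \<in> {a<..<b}" for x using that pq(1) by blast
    then show ?thesis using inj g by (auto simp del: greaterThanLessThan_iff)
  qed
  have "{p<..<q} - P \<in> sets borel" using P by simp
  from emeasure_affine_preimage[OF this \<kappa>, of t] show ?thesis unfolding e by (rule that[OF img pq(2)])
qed

lemma acip_real_density:
  assumes "acip T \<mu>"
  obtains D where "D \<in> borel_measurable unit_borel" "\<And>x. 0 \<le> D x"
    "integrable (restrict_space lborel {0..1}) D"
    "\<mu> = density (restrict_space lborel {0..1}) (\<lambda>x. ennreal (D x))"
proof -
  let ?L = "restrict_space lborel {0..1} :: real measure"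
  have \<mu>: "prob_space \<mu>" "sets \<mu> = sets unit_borel" "absolutely_continuous ?L \<mu>"
    using assms by (auto simp: acip_def)
  have sL: "sets ?L = sets unit_borel" by (rule sets_restrict_space_cong) simp
  have fin: "finite_measure ?L"
    by (intro finite_measureI) (simp add: space_restrict_space emeasure_restrict_space)
  interpret finite_measure ?L by (rule fin)
  have s: "sets \<mu> = sets ?L" using \<mu>(2) sL by simp
  obtain D where D: "D \<in> borel_measurable ?L" "AE x in ?L. RN_deriv ?L \<mu> x = ennreal (D x)" "\<And>x. 0 \<le> D x"
    using real_RN_deriv[OF prob_space.finite_measure[OF \<mu>(1)] \<mu>(3) s] by metis
  have "\<mu> = density ?L (RN_deriv ?L \<mu>)" using density_RN_deriv[OF \<mu>(3) s] by simp
  also have "\<dots> = density ?L (\<lambda>x. ennreal (D x))"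
    by (rule density_cong) (use D in auto)
  finally have den: "\<mu> = density ?L (\<lambda>x. ennreal (D x))" .
  have "integrable ?L D"
  proof (rule integrableI_nonneg)
    have "(\<integral>\<^sup>+ x. ennreal (D x) \<partial>?L) = emeasure \<mu> (space ?L)"
      unfolding den using D(1)
      by (subst emeasure_density[OF _ sets.top]) (auto intro!: nn_integral_cong simp: indicator_def)
    also have "space ?L = space \<mu>" using sets_eq_imp_space_eq[OF s] by simp
    finally show "(\<integral>\<^sup>+ x. ennreal (D x) \<partial>?L) < \<infinity>" using prob_space.emeasure_space_1[OF \<mu>(1)] by simp
  qed (use D in auto)
  moreover have "D \<in> borel_measurable unit_borel" using D(1) measurable_cong_sets[OF sL refl] by simp
  ultimately show ?thesis using that D(3) den by blast
qed

lemma acip_density_difference: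
  assumes "acip T \<mu>" "acip T \<nu>"
    and D: "D1 \<in> borel_measurable unit_borel" "\<And>x. 0 \<le> D1 x" "integrable (restrict_space lborel {0..1}) D1"
    "\<mu> = density (restrict_space lborel {0..1}) (\<lambda>x. ennreal (D1 x))"
    and E: "D2 \<in> borel_measurable unit_borel" "\<And>x. 0 \<le> D2 x" "integrable (restrict_space lborel {0..1}) D2"
    "\<nu> = density (restrict_space lborel {0..1}) (\<lambda>x. ennreal (D2 x))"
    and ne: "\<mu> \<noteq> \<nu>"
  defines "P \<equiv> {x\<in>{0..1}. D1 x > D2 x}"
  shows "P \<in> sets borel" "P \<subseteq> {0..1}" "emeasure lborel P > 0" "{x\<in>P. T x \<notin> P} \<in> null_sets lborel"
proof -
  let ?L = "restrict_space lborel {0..1} :: real measure"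
  have sL: "sets ?L = sets unit_borel" by (rule sets_restrict_space_cong) simp
  have spL: "space ?L = {0..1}" by (simp add: space_restrict_space)
  have setsI: "A \<in> sets ?L \<longleftrightarrow> A \<subseteq> {0..1} \<and> A \<in> sets borel" for A
    using sets_restrict_space_iff[of "{0..1}" "lborel::real measure" A] by simp
  have em: "emeasure ?L A = emeasure lborel A" if "A \<subseteq> {0..1}" "A \<in> sets borel" for A
    using that by (subst emeasure_restrict_space) auto
  have D1m[measurable]: "D1 \<in> borel_measurable ?L" and D2m[measurable]: "D2 \<in> borel_measurable ?L"
    using D(1) E(1) measurable_cong_sets[OF sL refl] by auto
  have s\<mu>: "sets \<mu> = sets ?L" "space \<mu> = {0..1}" and s\<nu>: "sets \<nu> = sets ?L" "space \<nu> = {0..1}"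
    unfolding D(4) E(4) by (auto simp: spL)
  have p: "prob_space \<mu>" "prob_space \<nu>" using assms(1,2) by (auto simp: acip_def)
  have T\<mu>: "T \<in> measurable \<mu> \<mu>" "distr \<mu> \<mu> T = \<mu>" and T\<nu>: "T \<in> measurable \<nu> \<nu>" "distr \<nu> \<nu> T = \<nu>"
    using assms(1,2) by (auto simp: acip_def)
  have TL[measurable]: "T \<in> measurable ?L ?L" using T\<mu>(1) measurable_cong_sets[OF s\<mu>(1) s\<mu>(1)] by simp
  have P: "P \<in> sets ?L"
  proof -
    have "{x \<in> space ?L. D1 x > D2 x} \<in> sets ?L" by measurable
    then show ?thesis by (simp add: P_def spL)
  qed
  show Pb: "P \<in> sets borel" "P \<subseteq> {0..1}" using P setsI by auto
  have m1: "measure \<mu> A = (\<integral>x. D1 x * indicator A x \<partial>?L)" if A: "A \<in> sets ?L" for A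
  proof -
    have "emeasure \<mu> A = (\<integral>\<^sup>+x. ennreal (D1 x * indicator A x) \<partial>?L)"
      unfolding D(4) using A D(2) by (subst emeasure_density) (auto intro!: nn_integral_cong simp: indicator_def)
    also have "\<dots> = ennreal (\<integral>x. D1 x * indicator A x \<partial>?L)"
      using A D(2,3) by (intro nn_integral_eq_integral integrable_real_mult_indicator) auto
    finally show ?thesis using D(2) by (simp add: measure_def)
  qed
  have m2: "measure \<nu> A = (\<integral>x. D2 x * indicator A x \<partial>?L)" if A: "A \<in> sets ?L" for A
  proof -
    have "emeasure \<nu> A = (\<integral>\<^sup>+x. ennreal (D2 x * indicator A x) \<partial>?L)"
      unfolding E(4) using A E(2) by (subst emeasure_density) (auto intro!: nn_integral_cong simp: indicator_def)
    also have "\<dots> = ennreal (\<integral>x. D2 x * indicator A x \<partial>?L)"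
      using A E(2,3) by (intro nn_integral_eq_integral integrable_real_mult_indicator) auto
    finally show ?thesis using E(2) by (simp add: measure_def)
  qed
  have int: "integrable ?L (\<lambda>x. (D1 x - D2 x) * indicator A x)" if "A \<in> sets ?L" for A
    using that D(3) E(3) by (intro integrable_real_mult_indicator) auto
  have \<sigma>: "measure \<mu> A - measure \<nu> A = (\<integral>x. (D1 x - D2 x) * indicator A x \<partial>?L)" if A: "A \<in> sets ?L" for A
    unfolding m1[OF A] m2[OF A] left_diff_distrib using A D(3) E(3)
    by (intro Bochner_Integration.integral_diff[symmetric] integrable_real_mult_indicator) auto
  define A where "A = T -` P \<inter> {0..1}"
  have A: "A \<in> sets ?L" using measurable_sets[OF TL P] by (simp add: A_def spL)
  have "measure \<mu> A = measure \<mu> P"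
    using measure_distr[OF T\<mu>(1), of P] P s\<mu> T\<mu>(2) by (simp add: A_def)
  moreover have "measure \<nu> A = measure \<nu> P"
    using measure_distr[OF T\<nu>(1), of P] P s\<nu> T\<nu>(2) by (simp add: A_def)
  ultimately have "(\<integral>x. (D1 x - D2 x) * indicator P x \<partial>?L) - (\<integral>x. (D1 x - D2 x) * indicator A x \<partial>?L) = 0"
    using \<sigma>[OF P] \<sigma>[OF A] by simp
  then have z: "(\<integral>x. (D1 x - D2 x) * indicator P x - (D1 x - D2 x) * indicator A x \<partial>?L) = 0"
    using int[OF P] int[OF A] by simp
  have "AE x in ?L. (D1 x - D2 x) * indicator P x - (D1 x - D2 x) * indicator A x = 0"
  proof (subst integral_nonneg_eq_0_iff_AE[symmetric])
    show "integrable ?L (\<lambda>x. (D1 x - D2 x) * indicator P x - (D1 x - D2 x) * indicator A x)"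
      using int[OF P] int[OF A] by simp
    show "AE x in ?L. 0 \<le> (D1 x - D2 x) * indicator P x - (D1 x - D2 x) * indicator A x"
      by (intro AE_I2) (auto simp: indicator_def P_def spL)
  qed (rule z)
  then have "AE x in ?L. x \<notin> {x\<in>P. T x \<notin> P}"
  proof (rule AE_mp, intro AE_I2 impI)
    fix x assume "x \<in> space ?L" "(D1 x - D2 x) * indicator P x - (D1 x - D2 x) * indicator A x = 0"
    then show "x \<notin> {x\<in>P. T x \<notin> P}" by (auto simp: indicator_def P_def A_def split: if_splits)
  qed
  moreover have B: "{x\<in>P. T x \<notin> P} \<in> sets ?L"
  proof -
    have "{x\<in>P. T x \<notin> P} = P - A" using Pb by (auto simp: A_def)
    then show ?thesis using P A by simp
  qed
  ultimately have "emeasure ?L {x\<in>P. T x \<notin> P} = 0" using AE_iff_null_sets[OF B] by auto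
  then show "{x\<in>P. T x \<notin> P} \<in> null_sets lborel" using B setsI em by (intro null_setsI) auto
  show "emeasure lborel P > 0"
  proof (rule ccontr)
    assume "\<not> emeasure lborel P > 0"
    then have "P \<in> null_sets ?L" using em[OF Pb(2,1)] P by (intro null_setsI) auto
    then have "AE x in ?L. x \<notin> P" by (rule AE_not_in)
    then have le: "AE x in ?L. 0 \<le> D2 x - D1 x"
    proof (rule AE_mp, intro AE_I2 impI)
      fix x assume "x \<in> space ?L" "x \<notin> P"
      then show "0 \<le> D2 x - D1 x" by (simp add: P_def spL)
    qed
    have "(\<integral>x. D1 x \<partial>?L) = 1" "(\<integral>x. D2 x \<partial>?L) = 1"
    proof -
      have S: "space ?L \<in> sets ?L" by (rule sets.top)
      have "measure \<mu> (space ?L) = 1" "measure \<nu> (space ?L) = 1"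
        using prob_space.prob_space[OF p(1)] prob_space.prob_space[OF p(2)] s\<mu> s\<nu> spL by auto
      moreover have "(\<integral>x. D1 x * indicator (space ?L) x \<partial>?L) = (\<integral>x. D1 x \<partial>?L)"
        "(\<integral>x. D2 x * indicator (space ?L) x \<partial>?L) = (\<integral>x. D2 x \<partial>?L)"
        by (rule Bochner_Integration.integral_cong[OF refl], simp)+
      ultimately show "(\<integral>x. D1 x \<partial>?L) = 1" "(\<integral>x. D2 x \<partial>?L) = 1" using m1[OF S] m2[OF S] by auto
    qed
    then have "(\<integral>x. D2 x - D1 x \<partial>?L) = 0" using Bochner_Integration.integral_diff[OF E(3) D(3)] by linarith
    then have "AE x in ?L. D2 x - D1 x = 0"
      using integral_nonneg_eq_0_iff_AE[OF Bochner_Integration.integrable_diff[OF E(3) D(3)] le] by blast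
    then have "AE x in ?L. ennreal (D1 x) = ennreal (D2 x)" by eventually_elim simp
    then have "\<mu> = \<nu>" unfolding D(4) E(4) by (rule density_cong[rotated 2]) simp_all
    then show False using ne by simp
  qed
qed

lemma distinct_acips_disjoint_sets:
  assumes "acip T \<mu>" "acip T \<nu>" "\<mu> \<noteq> \<nu>"
  obtains P Q where "P \<in> sets borel" "P \<subseteq> {0..1}" "emeasure lborel P > 0" "{x\<in>P. T x \<notin> P} \<in> null_sets lborel"
    "Q \<in> sets borel" "Q \<subseteq> {0..1}" "emeasure lborel Q > 0" "{x\<in>Q. T x \<notin> Q} \<in> null_sets lborel"
    "P \<inter> Q = {}"
proof -
  obtain D1 where D1: "D1 \<in> borel_measurable unit_borel" "\<And>x. 0 \<le> D1 x"
    "integrable (restrict_space lborel {0..1}) D1"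
    "\<mu> = density (restrict_space lborel {0..1}) (\<lambda>x. ennreal (D1 x))" using acip_real_density[OF assms(1)] by metis
  obtain D2 where D2: "D2 \<in> borel_measurable unit_borel" "\<And>x. 0 \<le> D2 x"
    "integrable (restrict_space lborel {0..1}) D2"
    "\<nu> = density (restrict_space lborel {0..1}) (\<lambda>x. ennreal (D2 x))" using acip_real_density[OF assms(2)] by metis
  show ?thesis
    by (rule that[OF acip_density_difference[OF assms(1,2) D1 D2 assms(3)]
          acip_density_difference[OF assms(2,1) D2 D1 assms(3)[symmetric]]]) auto
qed

locale tent_map =
  fixes \<alpha> \<beta> :: real
  assumes \<alpha>: "\<alpha> > 1" and \<beta>: "\<beta> > 1" and \<alpha>\<beta>: "\<alpha> * \<beta> \<le> \<alpha> + \<beta>"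
    and crit_orbit_distinct: "\<And>p q. 1 \<le> p \<Longrightarrow> p < q \<Longrightarrow> (tent \<alpha> \<beta> ^^ p) 0 \<noteq> (tent \<alpha> \<beta> ^^ q) 0"
begin

abbreviation "c \<equiv> turning_point \<beta>"
abbreviation "T \<equiv> skew_tent \<alpha> \<beta>"

lemma params: "(\<alpha>, \<beta>) \<in> skew_tent_params"
proof -
  have "inverse \<alpha> + inverse \<beta> = (\<alpha> + \<beta>) / (\<alpha> * \<beta>)" using \<alpha> \<beta> by (simp add: field_simps)
  then show ?thesis using \<alpha> \<beta> \<alpha>\<beta> by (simp add: skew_tent_params_def)
qed

lemma T_range: "x \<in> {0..1} \<Longrightarrow> T x \<in> {0..1}"
  by (rule skew_tent_unit_interval[OF params])

lemma T_iter_range: "x \<in> {0..1} \<Longrightarrow> (T ^^ n) x \<in> {0..1}"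
  using T_range by (intro funpow_unit_interval) auto

lemma c: "\<beta> * c = \<beta> - 1" using \<beta> by (simp add: turning_point_def field_simps)

sublocale tent_curve "\<lambda>_. \<alpha>" "\<lambda>_. \<beta>" "\<lambda>_. 0" "\<lambda>_. 0" "\<lambda>t. \<beta> * (t - c)" "\<lambda>_. \<beta>" 0 1 "min \<alpha> \<beta>" "max \<alpha> \<beta>" 0 \<beta>
proof unfold_locales
  show "1 - \<beta> \<le> \<beta> * (t - c) \<and> \<beta> * (t - c) \<le> 1" if "t \<in> {0..1}" for t :: real
  proof -
    have "0 \<le> \<beta> * t" "\<beta> * t \<le> \<beta> * 1" using that \<beta> by (auto intro: mult_left_mono simp del: mult_1_right)
    then show ?thesis using c by (simp add: right_diff_distrib)
  qed
  show "((\<lambda>t. \<beta> * (t - c)) has_real_derivative \<beta>) (at t within {0..1})" for t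
    by (auto intro!: derivative_eq_intros)
qed (use \<alpha> \<beta> \<alpha>\<beta> in auto)

lemma tent_conj: "tent \<alpha> \<beta> (\<beta> * (x - c)) = \<beta> * (T x - c)"
proof -
  have *: "\<beta> * (x - c) \<le> 0 \<longleftrightarrow> x \<le> c" using \<beta> by (simp add: mult_le_0_iff)
  have "\<beta> * (T x - c) = \<beta> * T x - (\<beta> - 1)" using c by (simp add: right_diff_distrib)
  also have "\<dots> = tent \<alpha> \<beta> (\<beta> * (x - c))"
  proof (cases "x \<le> c")
    case True
    then show ?thesis unfolding tent_def * by (simp add: skew_tent_def distrib_left mult.left_commute)
  next
    case False
    then show ?thesis unfolding tent_def * by (simp add: skew_tent_def right_diff_distrib[of _ 1])
  qed
  finally show ?thesis ..
qed

lemma z_eq: "z n t = \<beta> * ((T ^^ n) t - c)"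
  by (induction n) (auto simp: tent_conj)

lemma ex_separated:
  "\<exists>N \<delta>. separated_tent_curve (\<lambda>_. \<alpha>) (\<lambda>_. \<beta>) (\<lambda>_. 0) (\<lambda>_. 0) (\<lambda>t. \<beta> * (t - c)) (\<lambda>_. \<beta>) 0 1 (min \<alpha> \<beta>) (max \<alpha> \<beta>) 0 \<beta> N \<delta>"
proof -
  obtain N where N: "4 * D < mu ^ N" using real_arch_pow[OF mu] by blast
  define h where "h = (\<lambda>(p, q). \<bar>(tent \<alpha> \<beta> ^^ p) 0 - (tent \<alpha> \<beta> ^^ q) 0\<bar>)"
  define I where "I = {w \<in> {1..N} \<times> {1..N}. fst w \<noteq> snd w}"
  define X where "X = insert 1 (h ` I)"
  have fin: "finite X" unfolding X_def I_def by simp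
  have pos: "x > 0" if x: "x \<in> X" for x
  proof (cases "x = 1")
    case False
    then obtain w where w: "w \<in> I" "x = h w" using x by (auto simp: X_def)
    then have "1 \<le> fst w" "1 \<le> snd w" "fst w < snd w \<or> snd w < fst w" by (auto simp: I_def)
    then have "(tent \<alpha> \<beta> ^^ fst w) 0 \<noteq> (tent \<alpha> \<beta> ^^ snd w) 0"
      using crit_orbit_distinct[of "fst w" "snd w"] crit_orbit_distinct[of "snd w" "fst w"] by metis
    then show ?thesis using w(2) by (simp add: h_def case_prod_unfold)
  qed simp
  have ne: "X \<noteq> {}" by (simp add: X_def)
  have "separated_tent_curve (\<lambda>_. \<alpha>) (\<lambda>_. \<beta>) (\<lambda>_. 0) (\<lambda>_. 0) (\<lambda>t. \<beta> * (t - c)) (\<lambda>_. \<beta>) 0 1 (min \<alpha> \<beta>) (max \<alpha> \<beta>) 0 \<beta> N (Min X)"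
  proof unfold_locales
    show "4 * D \<le> mu ^ N" using N by simp
    show "0 < Min X" using pos fin ne by simp
    show "Min X \<le> \<bar>crit p s - crit q t\<bar>"
      if "1 \<le> p" "p \<le> N" "1 \<le> q" "q \<le> N" "p \<noteq> q" for s t p q
    proof (rule Min_le[OF fin])
      have "(p, q) \<in> I" using that by (simp add: I_def)
      then have "h (p, q) \<in> X" by (simp add: X_def)
      then show "\<bar>crit p s - crit q t\<bar> \<in> X" by (simp add: h_def crit_def)
    qed
  qed
  then show ?thesis by blast
qed

lemma cell_affine:
  assumes w: "w \<in> cells n"
  obtains \<kappa> t0 where "\<kappa> \<noteq> 0" "\<And>x. x \<in> ivl w \<Longrightarrow> (T ^^ n) x = t0 + \<kappa> * x"
proof -
  have const: "\<exists>k. \<forall>t\<in>ivl w. d i t = k" if "i \<le> n" for i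
    using that
  proof (induction i)
    case (Suc i)
    then obtain k where k: "\<And>t. t \<in> ivl w \<Longrightarrow> d i t = k" by auto
    have "d (Suc i) t = (if z i (mid w) \<le> 0 then \<alpha> * k else - \<beta> * k)" if t: "t \<in> ivl w" for t
      using cell_sign[OF w, of i t "mid w"] Suc.prems t mid_in[OF w] k[OF t] by auto
    then show ?case by blast
  qed auto
  obtain k where k: "\<And>t. t \<in> ivl w \<Longrightarrow> d n t = k" using const[of n] by auto
  define m where "m = mid w"
  have m: "m \<in> ivl w" using mid_in[OF w] by (simp add: m_def)
  have k0: "k \<noteq> 0" using d_nonzero[OF ivl_sub[OF w m], of n] k[OF m] by simp
  have aff: "z n x = z n m + k * (x - m)" if x: "x \<in> ivl w" for x
  proof (cases x m rule: linorder_cases)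
    case less
    obtain r where "x < r" "r < m" "z n m - z n x = (m - x) * d n r"
      by (rule cell_mvt[OF w, of x m n]) (use less x m in auto)
    moreover have "r \<in> ivl w" using calculation x m by auto
    ultimately show ?thesis using k[of r] by (simp add: algebra_simps)
  next
    case greater
    obtain r where "m < r" "r < x" "z n x - z n m = (x - m) * d n r"
      by (rule cell_mvt[OF w, of m x n]) (use greater x m in auto)
    moreover have "r \<in> ivl w" using calculation x m by auto
    ultimately show ?thesis using k[of r] by (simp add: algebra_simps)
  qed simp
  show ?thesis
  proof (rule that[of "k / \<beta>" "(T ^^ n) m - k / \<beta> * m"])
    show "k / \<beta> \<noteq> 0" using k0 \<beta> by simp
    fix x assume "x \<in> ivl w"
    from aff[OF this, unfolded z_eq] have "\<beta> * (T ^^ n) x = \<beta> * (T ^^ n) m + k * (x - m)"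
      by (simp add: algebra_simps)
    then have "(T ^^ n) x = (\<beta> * (T ^^ n) m + k * (x - m)) / \<beta>" using \<beta> by (simp add: eq_divide_eq mult.commute)
    also have "\<dots> = (T ^^ n) m - k / \<beta> * m + k / \<beta> * x" using \<beta> by (simp add: field_simps)
    finally show "(T ^^ n) x = (T ^^ n) m - k / \<beta> * m + k / \<beta> * x" .
  qed
qed

lemma T_measurable: "T \<in> borel_measurable borel"
  by (rule cont_measurable[OF continuous_skew_tent[OF \<beta>]])

lemma T_iter_measurable: "(T ^^ n) \<in> borel_measurable borel"
proof (induction n)
  case (Suc n)
  have "(T ^^ Suc n) = (\<lambda>x. T ((T ^^ n) x))" by auto
  then show ?case using measurable_compose[OF Suc T_measurable] by simp
qed (simp add: id_def)

lemma null_preimage: "A \<in> null_sets lborel \<Longrightarrow> T -` A \<in> null_sets lborel"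
proof -
  assume A: "A \<in> null_sets lborel"
  have "T -` A \<subseteq> (\<lambda>x. (1 - \<alpha> * c) + \<alpha> * x) -` A \<union> (\<lambda>x. (1 + \<beta> * c) + (- \<beta>) * x) -` A"
  proof
    fix x assume x: "x \<in> T -` A"
    have "T x = (1 - \<alpha> * c) + \<alpha> * x \<or> T x = (1 + \<beta> * c) + (- \<beta>) * x"
      by (auto simp: skew_tent_def algebra_simps)
    then show "x \<in> (\<lambda>x. (1 - \<alpha> * c) + \<alpha> * x) -` A \<union> (\<lambda>x. (1 + \<beta> * c) + (- \<beta>) * x) -` A"
      using x by (elim disjE) (simp_all only: vimage_eq Un_iff simp_thms)
  qed
  moreover have "(\<lambda>x. (1 - \<alpha> * c) + \<alpha> * x) -` A \<union> (\<lambda>x. (1 + \<beta> * c) + (- \<beta>) * x) -` A \<in> null_sets lborel"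
    by (intro null_sets.Un null_affine_preimage A) (use \<alpha> \<beta> in auto)
  moreover have "T -` A \<in> sets lborel" using measurable_sets[OF T_measurable, of A] A by auto
  ultimately show ?thesis by (rule null_sets_subset[rotated 2])
qed

lemma null_preimage_iter: "A \<in> null_sets lborel \<Longrightarrow> (T ^^ n) -` A \<in> null_sets lborel"
proof (induction n arbitrary: A)
  case (Suc n)
  have "(T ^^ Suc n) -` A = (T ^^ n) -` (T -` A)" by auto
  then show ?case using Suc.IH[OF null_preimage[OF Suc.prems]] by (simp only:)
qed simp

definition almost_invariant :: "real set \<Rightarrow> bool" where
  "almost_invariant P \<longleftrightarrow> P \<in> sets borel \<and> P \<subseteq> {0..1} \<and> {x\<in>P. T x \<notin> P} \<in> null_sets lborel"

lemma almost_invariant_iter: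
  assumes P: "almost_invariant P"
  shows "{x\<in>P. (T ^^ n) x \<notin> P} \<in> null_sets lborel"
proof (induction n)
  case (Suc n)
  have Pb: "P \<in> sets borel" "{x\<in>P. T x \<notin> P} \<in> null_sets lborel" using P by (auto simp: almost_invariant_def)
  have "{x\<in>P. (T ^^ Suc n) x \<notin> P} \<subseteq> {x\<in>P. (T ^^ n) x \<notin> P} \<union> (T ^^ n) -` {x\<in>P. T x \<notin> P}" by auto
  moreover have "{x\<in>P. (T ^^ n) x \<notin> P} \<union> (T ^^ n) -` {x\<in>P. T x \<notin> P} \<in> null_sets lborel"
    by (intro null_sets.Un Suc null_preimage_iter Pb)
  moreover have "{x\<in>P. (T ^^ Suc n) x \<notin> P} \<in> sets lborel"
  proof -
    have "P - (T ^^ Suc n) -` P \<in> sets borel"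
      using measurable_sets[OF T_iter_measurable[of "Suc n"] Pb(1)] Pb(1) by (simp del: funpow.simps)
    moreover have "{x\<in>P. (T ^^ Suc n) x \<notin> P} = P - (T ^^ Suc n) -` P" by auto
    ultimately show ?thesis by simp
  qed
  ultimately show ?case by (rule null_sets_subset[rotated 2])
qed simp

lemma push_interval:
  assumes P: "almost_invariant P" and ab: "a < b"
    and aff: "\<And>x. x \<in> {a<..<b} \<Longrightarrow> (T ^^ n) x = t0 + \<kappa> * x" "\<kappa> \<noteq> 0"
  obtains p q where "(T ^^ n) ` {a<..<b} = {p<..<q}" "q - p = \<bar>\<kappa>\<bar> * (b - a)"
    "emeasure lborel ({p<..<q} - P) \<le> ennreal \<bar>\<kappa>\<bar> * emeasure lborel ({a<..<b} - P)"
proof -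
  have Pb: "P \<in> sets borel" using P by (simp add: almost_invariant_def)
  obtain p q where pq: "(T ^^ n) ` {a<..<b} = {p<..<q}" "q - p = \<bar>\<kappa>\<bar> * (b - a)"
    "emeasure lborel ({p<..<q} - P) = ennreal \<bar>\<kappa>\<bar> * emeasure lborel {x \<in> {a<..<b}. (T ^^ n) x \<notin> P}"
    by (rule affine_push[OF aff ab Pb])
  have "emeasure lborel {x \<in> {a<..<b}. (T ^^ n) x \<notin> P} \<le> emeasure lborel (({a<..<b} - P) \<union> {x\<in>P. (T ^^ n) x \<notin> P})"
    using Pb almost_invariant_iter[OF P, of n] by (intro emeasure_mono) auto
  also have "\<dots> = emeasure lborel ({a<..<b} - P)"
    using Pb almost_invariant_iter[OF P, of n] by (intro emeasure_Un_null_set) auto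
  finally have "ennreal \<bar>\<kappa>\<bar> * emeasure lborel {x \<in> {a<..<b}. (T ^^ n) x \<notin> P} \<le> ennreal \<bar>\<kappa>\<bar> * emeasure lborel ({a<..<b} - P)"
    by (rule mult_left_mono) simp
  then show ?thesis using that[OF pq(1,2)] pq(3) by simp
qed

text \<open>Intervals avoiding the turning point are stretched by a fixed factor, which cannot go on forever.\<close>

lemma almost_invariant_nbhd:
  assumes P: "almost_invariant P" and ab: "a < b" "{a<..<b} \<subseteq> {0..1}" "emeasure lborel ({a<..<b} - P) = 0"
  shows "\<exists>p q. p < c \<and> c < q \<and> emeasure lborel ({p<..<q} - P) = 0"
proof (rule ccontr)
  assume no: "\<not> ?thesis"
  define l where "l = min \<alpha> \<beta>"
  have l: "l > 1" "l \<le> \<alpha>" "l \<le> \<beta>" using \<alpha> \<beta> by (auto simp: l_def)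
  have ex: "\<exists>p q. q - p \<ge> l ^ n * (b - a) \<and> {p<..<q} \<subseteq> {0..1} \<and> emeasure lborel ({p<..<q} - P) = 0" for n
  proof (induction n)
    case 0
    show ?case by (intro exI[of _ a] exI[of _ b]) (use ab in simp)
  next
    case (Suc n)
    then obtain p q where pq: "q - p \<ge> l ^ n * (b - a)" "{p<..<q} \<subseteq> {0..1}" "emeasure lborel ({p<..<q} - P) = 0"
      by blast
    have pos: "l ^ n * (b - a) > 0" using l ab by simp
    then have lt: "p < q" using pq(1) by linarith
    have "\<not> (p < c \<and> c < q)" using no pq(3) by blast
    then consider "q \<le> c" | "c \<le> p" by linarith
    then obtain t0 \<kappa> where \<kappa>: "\<bar>\<kappa>\<bar> \<ge> l" "\<kappa> \<noteq> 0" "\<And>x. x \<in> {p<..<q} \<Longrightarrow> (T ^^ 1) x = t0 + \<kappa> * x"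
    proof cases
      case 1
      then show ?thesis by (intro that[of \<alpha> "1 - \<alpha> * c"]) (use l in \<open>auto simp: skew_tent_def algebra_simps\<close>)
    next
      case 2
      then show ?thesis by (intro that[of "- \<beta>" "1 + \<beta> * c"]) (use l in \<open>auto simp: skew_tent_def algebra_simps\<close>)
    qed
    obtain p' q' where p'q': "(T ^^ 1) ` {p<..<q} = {p'<..<q'}" "q' - p' = \<bar>\<kappa>\<bar> * (q - p)"
      "emeasure lborel ({p'<..<q'} - P) \<le> ennreal \<bar>\<kappa>\<bar> * emeasure lborel ({p<..<q} - P)"
      by (rule push_interval[OF P lt \<kappa>(3,2)])
    have "l ^ Suc n * (b - a) = l * (l ^ n * (b - a))" by simp
    also have "\<dots> \<le> \<bar>\<kappa>\<bar> * (q - p)" using \<kappa>(1) pq(1) l(1) pos by (intro mult_mono) linarith+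
    finally have "l ^ Suc n * (b - a) \<le> q' - p'" using p'q'(2) by simp
    moreover have "{p'<..<q'} \<subseteq> {0..1}" unfolding p'q'(1)[symmetric] using T_iter_range pq(2) by blast
    moreover have "emeasure lborel ({p'<..<q'} - P) = 0" using p'q'(3) pq(3) by simp
    ultimately show ?case by blast
  qed
  obtain n where n: "1 / (b - a) < l ^ n" using real_arch_pow[of "l" "1 / (b - a)"] l(1) by auto
  obtain p q where pq: "q - p \<ge> l ^ n * (b - a)" "{p<..<q} \<subseteq> {0..1}" using ex[of n] by blast
  have "1 < l ^ n * (b - a)" using n ab by (simp add: pos_divide_less_eq)
  then have "q - p > 1" using pq by linarith
  moreover have "q - p \<le> 1"
    using pq(2) \<open>q - p > 1\<close> by (simp add: greaterThanLessThan_subseteq_atLeastAtMost_iff)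
  ultimately show False by simp
qed

lemma good_cell:
  assumes P: "P \<in> sets borel" "P \<subseteq> {0..1}" "emeasure lborel P > 0"
  shows "\<exists>B>0. \<forall>\<eta>>0. \<exists>n. \<exists>w\<in>cells n. V n w \<le> B \<and> emeasure lborel (ivl w - P) \<le> ennreal (\<eta> * len w)"
proof -
  obtain N \<delta> where sep: "separated_tent_curve (\<lambda>_. \<alpha>) (\<lambda>_. \<beta>) (\<lambda>_. 0) (\<lambda>_. 0) (\<lambda>t. \<beta> * (t - c)) (\<lambda>_. \<beta>) 0 1 (min \<alpha> \<beta>) (max \<alpha> \<beta>) 0 \<beta> N \<delta>"
    using ex_separated by blast
  interpret S: separated_tent_curve "\<lambda>_. \<alpha>" "\<lambda>_. \<beta>" "\<lambda>_. 0" "\<lambda>_. 0" "\<lambda>t. \<beta> * (t - c)" "\<lambda>_. \<beta>" 0 1 "min \<alpha> \<beta>" "max \<alpha> \<beta>" 0 \<beta> N \<delta>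
    by (rule sep)
  obtain K where K: "compact K" "K \<subseteq> P" "measure lborel K > 0"
  proof -
    have Pl: "P \<in> sets lebesgue" using P by auto
    obtain e where e: "e > 0" "ennreal e < emeasure lborel P" using P(3)
      by (metis dense ennreal_cases ennreal_less_zero_iff less_ennreal.rep_eq not_less_zero top.extremum_strict ennreal_neg not_le order_less_le_trans zero_le)
    obtain K where K: "closed K" "K \<subseteq> P" "P - K \<in> lmeasurable" "emeasure lebesgue (P - K) < ennreal e"
      using sets_lebesgue_inner_closed[OF Pl e(1)] by metis
    have cK: "compact K" using K(1,2) P(2) bounded_subset[OF bounded_closed_interval[of 0 "1::real"]] compact_eq_bounded_closed by blast
    have "emeasure lborel K \<noteq> 0"
    proof
      assume z: "emeasure lborel K = 0"
      have "emeasure lborel P \<le> emeasure lborel (K \<union> (P - K))" using K(1) P(1) by (intro emeasure_mono) auto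
      also have "\<dots> \<le> emeasure lborel K + emeasure lborel (P - K)" using K(1) P(1) by (intro emeasure_subadditive) auto
      also have "\<dots> = emeasure lebesgue (P - K)" using z K(1) P(1) by simp
      finally show False using K(4) e(2) by (meson leD less_trans)
    qed
    moreover have "emeasure lborel K < \<infinity>" using emeasure_compact_finite[OF cK] .
    ultimately have "measure lborel K > 0" by (simp add: measure_def enn2real_positive_iff zero_less_iff_neq_zero)
    then show ?thesis using that cK K(2) by blast
  qed
  define m0 where "m0 = measure lborel K"
  define C2 where "C2 = V 0 (0, 1) + S.C0"
  define B where "B = 2 * C2 / m0"
  have m0: "m0 > 0" using K(3) by (simp add: m0_def)
  have C2: "C2 > 0" using V_ge_1[OF root_cell] S.C0_pos unfolding C2_def by linarith
  have B: "B > 0" using m0 C2 by (simp add: B_def)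
  have Kb: "K \<in> sets borel" using K(1) by (simp add: compact_imp_closed)
  have "\<exists>n. \<exists>w\<in>cells n. V n w \<le> B \<and> emeasure lborel (ivl w - P) \<le> ennreal (\<eta> * len w)" if \<eta>: "\<eta> > 0" for \<eta>
  proof (rule ccontr)
    assume no: "\<not> (\<exists>n. \<exists>w\<in>cells n. V n w \<le> B \<and> emeasure lborel (ivl w - P) \<le> ennreal (\<eta> * len w))"
    define \<epsilon> where "\<epsilon> = \<eta> * m0 / 2"
    have \<epsilon>: "\<epsilon> > 0" using \<eta> m0 by (simp add: \<epsilon>_def)
    obtain G where G: "open G" "K \<subseteq> G" "emeasure lborel (G - K) < ennreal \<epsilon>"
      by (rule outer_regular_lborel[OF Kb \<epsilon>])
    obtain r where r: "r > 0" "(\<Union>x\<in>K. ball x r) \<subseteq> G"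
      by (rule compact_subset_open_imp_ball_epsilon_subset[OF K(1) G(1,2)])
    define a where "a = max \<alpha> \<beta> / \<beta>"
    obtain j where j: "a / r < mu ^ j" using real_arch_pow[OF mu] by blast
    define n where "n = j * N"
    have "mu ^ j \<le> mu ^ n" unfolding n_def using mu S.N_pos by (intro power_increasing) auto
    then have "a / r < mu ^ n" using j by linarith
    then have an: "a / mu ^ n < r" using r(1) mu by (simp add: divide_simps mult.commute split: if_splits)
    have small: "len w < r" if w: "w \<in> cells n" for w
    proof -
      have "len w \<le> a / mu ^ n" using cell_len[OF w] by (simp add: a_def)
      then show ?thesis using an by linarith
    qed
    define Bad Good where "Bad = {w \<in> cells n. V n w > B}" and "Good = {w \<in> cells n. V n w \<le> B \<and> ivl w \<inter> K \<noteq> {}}"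
    have fin: "finite Bad" "finite Good" using finite_cells' by (auto simp: Bad_def Good_def)
    have cB: "w \<in> cells n" if "w \<in> Bad" for w using that unfolding Bad_def by blast
    have cG: "w \<in> cells n" if "w \<in> Good" for w using that unfolding Good_def by blast
    have mB: "measure lborel (\<Union>w\<in>Bad. ivl w) = sum len Bad"
      by (rule sum_len_eq_measure[symmetric, OF fin(1) cellD(2)[OF cB] cells_disjoint]) (use cB in blast)+
    have mG: "measure lborel (\<Union>w\<in>Good. ivl w) = sum len Good"
      by (rule sum_len_eq_measure[symmetric, OF fin(2) cellD(2)[OF cG] cells_disjoint]) (use cG in blast)+
    have oB: "(\<Union>w\<in>Bad. ivl w) \<in> sets lborel" and oG: "(\<Union>w\<in>Good. ivl w) \<in> sets lborel"
      and oZ: "Zs n \<in> sets lborel"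
      using open_UN[of Bad ivl] open_UN[of Good ivl] finite_imp_closed[OF finite_Zs[of n]] by auto
    have bad: "sum len Bad \<le> m0 / 2"
    proof -
      have "B * sum len Bad = (\<Sum>w\<in>Bad. B * len w)" by (rule sum_distrib_left)
      also have "\<dots> \<le> (\<Sum>w\<in>Bad. len w * V n w)"
      proof (rule sum_mono)
        fix w assume w: "w \<in> Bad"
        then have "B \<le> V n w" by (simp add: Bad_def)
        then show "B * len w \<le> len w * V n w" using mult_right_mono[of B "V n w" "len w"] cellD(2)[OF cB[OF w]] by (simp add: mult.commute)
      qed
      also have "\<dots> \<le> (\<Sum>w\<in>cells n. len w * V n w)"
      proof (rule sum_mono2[OF finite_cells'])
        show "Bad \<subseteq> cells n" using cB by blast
        fix w assume "w \<in> cells n - Bad"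
        then have w: "w \<in> cells n" by blast
        show "0 \<le> len w * V n w" using V_ge_1[OF w] cellD(2)[OF w] by (intro mult_nonneg_nonneg) auto
      qed
      also have "\<dots> \<le> (V 0 (0, 1) / 2 ^ j + S.C0) * len (0, 1)"
        using S.drift[OF root_cell, of j] unfolding subcells_root n_def by simp
      also have "\<dots> \<le> C2"
      proof -
        have "V 0 (0, 1) / 2 ^ j \<le> V 0 (0, 1) / 1" using V_ge_1[OF root_cell] by (intro divide_left_mono) auto
        then show ?thesis by (simp add: C2_def)
      qed
      finally show ?thesis using m0 C2 by (simp add: B_def field_simps)
    qed
    have "m0 \<le> measure lborel (Zs n \<union> ((\<Union>w\<in>Bad. ivl w) \<union> (\<Union>w\<in>Good. ivl w)))"
      unfolding m0_def
    proof (rule measure_mono_fmeasurable[OF _ _ fmeasurableI])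
      show "K \<subseteq> Zs n \<union> ((\<Union>w\<in>Bad. ivl w) \<union> (\<Union>w\<in>Good. ivl w))"
      proof
        fix x assume x: "x \<in> K"
        show "x \<in> Zs n \<union> ((\<Union>w\<in>Bad. ivl w) \<union> (\<Union>w\<in>Good. ivl w))"
        proof (cases "x \<in> Zs n")
          case False
          have "x \<in> {0..1}" using x K(2) P(2) by blast
          then obtain w where w: "w \<in> cells n" "x \<in> ivl w" using cell_cover[OF _ False] by metis
          then have "w \<in> Bad \<or> w \<in> Good" using x unfolding Bad_def Good_def by fastforce
          then show ?thesis using w(2) by blast
        qed blast
      qed
      show "Zs n \<union> ((\<Union>w\<in>Bad. ivl w) \<union> (\<Union>w\<in>Good. ivl w)) \<in> sets lborel"
        using oB oG oZ by (intro sets.Un)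
      have "Zs n \<union> ((\<Union>w\<in>Bad. ivl w) \<union> (\<Union>w\<in>Good. ivl w)) \<subseteq> {0..1}"
        using Zs_subset[of n] ivl_sub[OF cB] ivl_sub[OF cG] by blast
      from emeasure_mono[OF this, of lborel] show "emeasure lborel (Zs n \<union> ((\<Union>w\<in>Bad. ivl w) \<union> (\<Union>w\<in>Good. ivl w))) < \<infinity>"
        by (auto simp: order_le_less_trans)
    qed (use Kb in simp)
    also have "\<dots> \<le> measure lborel (Zs n) + (measure lborel (\<Union>w\<in>Bad. ivl w) + measure lborel (\<Union>w\<in>Good. ivl w))"
      using oB oG oZ by (intro order_trans[OF measure_Un_le] add_left_mono measure_Un_le sets.Un)
    also have "measure lborel (Zs n) = 0"
      using null_setsD1[OF finite_imp_null_set_lborel[OF finite_Zs[of n]]] by (simp add: measure_def)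
    finally have good: "m0 / 2 \<le> sum len Good" using bad mB mG by linarith
    have each: "\<eta> * len w \<le> measure lborel (ivl w - K)" if w: "w \<in> Good" for w
    proof (rule ccontr)
      assume "\<not> ?thesis"
      then have lt: "measure lborel (ivl w - K) \<le> \<eta> * len w" by simp
      have "emeasure lborel (ivl w - P) \<le> emeasure lborel (ivl w - K)" using K(2) Kb by (intro emeasure_mono) auto
      also have "\<dots> = ennreal (measure lborel (ivl w - K))"
      proof (rule emeasure_eq_ennreal_measure)
        have "emeasure lborel (ivl w - K) \<le> emeasure lborel (ivl w)" by (intro emeasure_mono) auto
        then show "emeasure lborel (ivl w - K) \<noteq> top" using cellD(2)[OF cG[OF w]] by (auto simp: top_unique)
      qed
      also have "\<dots> \<le> ennreal (\<eta> * len w)" using lt by (rule ennreal_leI)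
      finally show False using no cG[OF w] w unfolding Good_def by blast
    qed
    have sub: "(\<Union>w\<in>Good. ivl w - K) \<subseteq> G - K"
    proof
      fix x assume "x \<in> (\<Union>w\<in>Good. ivl w - K)"
      then obtain w where w: "w \<in> Good" "x \<in> ivl w" "x \<notin> K" by blast
      then obtain y where y: "y \<in> ivl w" "y \<in> K" unfolding Good_def by blast
      have "dist y x < r" using w(2) y(1) small[OF cG[OF w(1)]] by (auto simp: dist_real_def)
      then show "x \<in> G - K" using r(2) y(2) w(3) by (auto simp: subset_iff)
    qed
    have GK: "G - K \<in> fmeasurable lborel"
      using G Kb by (intro fmeasurableI) (auto simp: order_less_trans)
    have "\<epsilon> \<le> \<eta> * sum len Good" using good \<eta> by (simp add: \<epsilon>_def)
    also have "\<dots> = (\<Sum>w\<in>Good. \<eta> * len w)" by (rule sum_distrib_left)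
    also have "\<dots> \<le> (\<Sum>w\<in>Good. measure lborel (ivl w - K))" using each by (rule sum_mono)
    also have "\<dots> = measure lborel (\<Union>w\<in>Good. ivl w - K)"
    proof (rule measure_finite_Union[symmetric, OF fin(2)])
      show "(\<lambda>w. ivl w - K) ` Good \<subseteq> sets lborel" using Kb by auto
      have "disjoint_family_on ivl Good" using cG by (intro cells_disjoint) blast
      then show "disjoint_family_on (\<lambda>w. ivl w - K) Good" unfolding disjoint_family_on_def by blast
      fix w assume w: "w \<in> Good"
      have "emeasure lborel (ivl w - K) \<le> emeasure lborel (ivl w)" by (intro emeasure_mono) auto
      then show "emeasure lborel (ivl w - K) \<noteq> \<infinity>" using cellD(2)[OF cG[OF w]] by (auto simp: top_unique)
    qed
    also have "\<dots> \<le> measure lborel (G - K)"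
      using sub GK oG Kb by (intro measure_mono_fmeasurable) auto
    also have "\<dots> < \<epsilon>"
    proof -
      have "ennreal (measure lborel (G - K)) < ennreal \<epsilon>"
        using G(3) emeasure_eq_ennreal_measure[of lborel "G - K"] GK by (auto simp: fmeasurable_def)
      then show ?thesis using \<epsilon> by (simp add: ennreal_less_iff)
    qed
    finally show False by simp
  qed
  then show ?thesis using B by blast
qed

lemma almost_invariant_contains_interval:
  assumes P: "almost_invariant P" "emeasure lborel P > 0"
  shows "\<exists>a b. a < b \<and> {a<..<b} \<subseteq> {0..1} \<and> emeasure lborel ({a<..<b} - P) = 0"
proof -
  have Pb: "P \<in> sets borel" "P \<subseteq> {0..1}" using P(1) by (auto simp: almost_invariant_def)
  obtain B where B: "B > 0" "\<And>\<eta>. \<eta> > 0 \<Longrightarrow> \<exists>n. \<exists>w\<in>cells n. V n w \<le> B \<and> emeasure lborel (ivl w - P) \<le> ennreal (\<eta> * len w)"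
    using good_cell[OF Pb P(2)] by blast
  define l where "l = max \<alpha> \<beta> / (\<beta> * B)"
  have l: "l > 0" using B \<alpha> \<beta> by (simp add: l_def)
  have "\<exists>p q. l \<le> q - p \<and> 0 \<le> p \<and> q \<le> 1 \<and> emeasure lborel ({p<..<q} - P) \<le> ennreal (1 / Suc i)" for i
  proof -
    obtain n w where w: "w \<in> cells n" "V n w \<le> B" "emeasure lborel (ivl w - P) \<le> ennreal (1 / Suc i * len w)"
      using B(2)[of "1 / Suc i"] by auto
    obtain \<kappa> t0 where \<kappa>: "\<kappa> \<noteq> 0" "\<And>x. x \<in> ivl w \<Longrightarrow> (T ^^ n) x = t0 + \<kappa> * x" using cell_affine[OF w(1)] by metis
    obtain p q where pq: "(T ^^ n) ` ivl w = {p<..<q}" "q - p = \<bar>\<kappa>\<bar> * len w"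
      "emeasure lborel ({p<..<q} - P) \<le> ennreal \<bar>\<kappa>\<bar> * emeasure lborel (ivl w - P)"
      by (rule push_interval[OF P(1) cellD(2)[OF w(1)] \<kappa>(2,1)])
    have lw: "len w > 0" using cellD(2)[OF w(1)] by simp
    have lt: "p < q" using pq(2) lw \<kappa>(1) by (metis diff_gt_0_iff_gt mult_pos_pos zero_less_abs_iff)
    have "{p<..<q} \<subseteq> {0..1}" unfolding pq(1)[symmetric] using T_iter_range ivl_sub[OF w(1)] by blast
    then have r: "0 \<le> p" "q \<le> 1" using lt by (auto simp: greaterThanLessThan_subseteq_atLeastAtMost_iff)
    have "emeasure lborel ({p<..<q} - P) \<le> ennreal \<bar>\<kappa>\<bar> * ennreal (1 / Suc i * len w)"
      by (rule order_trans[OF pq(3) mult_left_mono[OF w(3)]]) simp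
    also have "\<dots> = ennreal (\<bar>\<kappa>\<bar> * (1 / Suc i * len w))" using lw by (intro ennreal_mult[symmetric]) auto
    also have "\<bar>\<kappa>\<bar> * (1 / Suc i * len w) = (q - p) * (1 / Suc i)" using pq(2) by simp
    also have "ennreal ((q - p) * (1 / Suc i)) \<le> ennreal (1 * (1 / Suc i))"
      using r by (intro ennreal_leI mult_right_mono) auto
    finally have 1: "emeasure lborel ({p<..<q} - P) \<le> ennreal (1 / Suc i)" by simp
    have k: "img n w = \<beta> * (q - p)"
    proof -
      have cont: "continuous_on {fst w..snd w} (z n)"
        using continuous_on_subset[OF continuous_z] cellD[OF w(1)] by auto
      have "continuous_on {fst w..snd w} (\<lambda>x. z n x - \<beta> * \<kappa> * x)" by (intro continuous_intros cont)
      moreover have "z n x - \<beta> * \<kappa> * x = \<beta> * (t0 - c)" if "x \<in> ivl w" for x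
        unfolding z_eq \<kappa>(2)[OF that] by (simp add: algebra_simps)
      ultimately have e: "z n x - \<beta> * \<kappa> * x = \<beta> * (t0 - c)" if "x \<in> {fst w..snd w}" for x
        using continuous_constant_on_closure[of "ivl w" "\<lambda>x. z n x - \<beta> * \<kappa> * x" "\<beta> * (t0 - c)" x] that cellD(2)[OF w(1)]
        by simp
      have "z n (snd w) - z n (fst w) = \<beta> * \<kappa> * len w"
        using e[of "snd w"] e[of "fst w"] cellD(2)[OF w(1)] by (simp add: algebra_simps)
      then show ?thesis unfolding img_def pq(2) using \<beta> lw by (simp add: abs_mult)
    qed
    have "max \<alpha> \<beta> / (\<beta> * (q - p)) \<le> B" using w(2) unfolding V_def k .
    then have "l \<le> q - p" using lt \<beta> B(1) by (simp add: l_def field_simps)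
    then show ?thesis using r 1 by blast
  qed
  then obtain p q where pq: "\<And>i. l \<le> q i - p i" "\<And>i. 0 \<le> p i" "\<And>i. q i \<le> 1"
    "\<And>i. emeasure lborel ({p i<..<q i} - P) \<le> ennreal (1 / Suc i)" by metis
  have "\<forall>i. (p i, q i) \<in> {0..1} \<times> {0..1}"
  proof
    fix i show "(p i, q i) \<in> {0..1} \<times> {0..1}" using pq(1,2,3)[of i] l by auto
  qed
  moreover have "seq_compact ({0..1::real} \<times> {0..1::real})" by (rule compact_imp_seq_compact[OF compact_Times]) auto
  ultimately obtain ab r where ab: "strict_mono r" "((\<lambda>i. (p i, q i)) \<circ> r) \<longlonglongrightarrow> ab"
    using seq_compactE[of "{0..1::real} \<times> {0..1::real}" "\<lambda>i. (p i, q i)"] by metis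
  define a b where "a = fst ab" and "b = snd ab"
  have lim: "(\<lambda>i. p (r i)) \<longlonglongrightarrow> a" "(\<lambda>i. q (r i)) \<longlonglongrightarrow> b"
    using tendsto_fst[OF ab(2)] tendsto_snd[OF ab(2)] by (auto simp: a_def b_def o_def)
  have lab: "l \<le> b - a" by (rule LIMSEQ_le_const[OF tendsto_diff[OF lim(2,1)]]) (use pq(1) in auto)
  define a' b' where "a' = a + l / 4" and "b' = b - l / 4"
  have lt: "a' < b'" using lab l by (simp add: a'_def b'_def)
  have "\<forall>\<^sub>F i in sequentially. p (r i) < a'" "\<forall>\<^sub>F i in sequentially. b' < q (r i)"
    using order_tendstoD(2)[OF lim(1), of a'] order_tendstoD(1)[OF lim(2), of b'] l by (auto simp: a'_def b'_def)
  then have ev: "\<forall>\<^sub>F i in sequentially. p (r i) < a' \<and> b' < q (r i)" by eventually_elim auto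
  then obtain i where "p (r i) < a'" "b' < q (r i)" using eventually_happens'[OF sequentially_bot] by blast
  then have "{a'<..<b'} \<subseteq> {0..1}" using pq(2,3)[of "r i"] by auto
  moreover have "emeasure lborel ({a'<..<b'} - P) \<le> 0"
  proof (rule tendsto_lowerbound)
    show "(\<lambda>i. ennreal (1 / Suc (r i))) \<longlonglongrightarrow> 0"
    proof -
      have "(\<lambda>n. 1 / real (Suc n)) \<longlonglongrightarrow> 0" using LIMSEQ_Suc[OF lim_const_over_n[of 1]] .
      from LIMSEQ_subseq_LIMSEQ[OF this ab(1)] have "(\<lambda>i. 1 / real (Suc (r i))) \<longlonglongrightarrow> 0" by (simp add: o_def)
      from tendsto_ennrealI[OF this] show ?thesis by simp
    qed
    show "\<forall>\<^sub>F i in sequentially. emeasure lborel ({a'<..<b'} - P) \<le> ennreal (1 / Suc (r i))" using ev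
    proof eventually_elim
      case (elim i)
      have "emeasure lborel ({a'<..<b'} - P) \<le> emeasure lborel ({p (r i)<..<q (r i)} - P)"
        using elim Pb(1) by (intro emeasure_mono) auto
      then show ?case using pq(4)[of "r i"] by (rule order_trans)
    qed
  qed simp
  ultimately show ?thesis using lt by (intro exI[of _ a'] exI[of _ b']) simp
qed

theorem acip_unique:
  assumes "acip T \<mu>" "acip T \<nu>"
  shows "\<mu> = \<nu>"
proof (rule ccontr)
  assume "\<mu> \<noteq> \<nu>"
  then obtain P Q where PQ: "P \<in> sets borel" "P \<subseteq> {0..1}" "emeasure lborel P > 0" "{x\<in>P. T x \<notin> P} \<in> null_sets lborel"
    "Q \<in> sets borel" "Q \<subseteq> {0..1}" "emeasure lborel Q > 0" "{x\<in>Q. T x \<notin> Q} \<in> null_sets lborel"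
    "P \<inter> Q = {}" by (rule distinct_acips_disjoint_sets[OF assms])
  have nb: "\<exists>p q. p < c \<and> c < q \<and> emeasure lborel ({p<..<q} - X) = 0"
    if X: "almost_invariant X" "emeasure lborel X > 0" for X
  proof -
    obtain a b where "a < b" "{a<..<b} \<subseteq> {0..1}" "emeasure lborel ({a<..<b} - X) = 0"
      using almost_invariant_contains_interval[OF X] by blast
    then show ?thesis by (rule almost_invariant_nbhd[OF X(1)])
  qed
  obtain p q where pq: "p < c" "c < q" "emeasure lborel ({p<..<q} - P) = 0"
    using nb[of P] PQ by (auto simp: almost_invariant_def)
  obtain p' q' where pq': "p' < c" "c < q'" "emeasure lborel ({p'<..<q'} - Q) = 0"
    using nb[of Q] PQ by (auto simp: almost_invariant_def)
  define s t where "s = max p p'" and "t = min q q'"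
  have st: "s < t" using pq pq' by (auto simp: s_def t_def)
  have "emeasure lborel {s<..<t} \<le> emeasure lborel (({p<..<q} - P) \<union> ({p'<..<q'} - Q))"
    using PQ by (intro emeasure_mono) (auto simp: s_def t_def)
  also have "\<dots> \<le> emeasure lborel ({p<..<q} - P) + emeasure lborel ({p'<..<q'} - Q)"
    using PQ by (intro emeasure_subadditive) auto
  also have "\<dots> = 0" using pq pq' by simp
  finally show False using st by simp
qed

end

section \<open>The parameter curve\<close>

lemma upper_density_le_mono:
  assumes P: "upper_density_le P c" and sub: "\<And>i. Q i \<Longrightarrow> P i" and c: "c \<le> c'"
  shows "upper_density_le Q c'"
  unfolding upper_density_le_def
proof (intro allI impI)
  fix \<epsilon> :: real assume "\<epsilon> > 0"
  then have "\<forall>\<^sub>F n in sequentially. real (card {i. i < n \<and> P i}) \<le> real n * (c + \<epsilon>)"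
    using P unfolding upper_density_le_def by blast
  then show "\<forall>\<^sub>F n in sequentially. real (card {i. i < n \<and> Q i}) \<le> real n * (c' + \<epsilon>)"
  proof eventually_elim
    case (elim n)
    have "card {i. i < n \<and> Q i} \<le> card {i. i < n \<and> P i}" using sub by (intro card_mono) auto
    moreover have "real n * (c + \<epsilon>) \<le> real n * (c' + \<epsilon>)" using c by (intro mult_left_mono) auto
    ultimately show ?case using elim by linarith
  qed
qed

lemma upper_density_le_shift:
  assumes P: "upper_density_le (\<lambda>i. P (m + i)) c"
  shows "upper_density_le P c"
  unfolding upper_density_le_def
proof (intro allI impI)
  fix \<epsilon> :: real assume \<epsilon>: "\<epsilon> > 0"
  then have ev: "\<forall>\<^sub>F n in sequentially. real (card {i. i < n \<and> P (m + i)}) \<le> real n * (c + \<epsilon> / 2)"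
    using P unfolding upper_density_le_def by (meson half_gt_zero)
  obtain n1 where n1: "real m / (\<epsilon> / 2) \<le> real n1" using real_arch_simple by blast
  from ev eventually_ge_at_top[of n1] show "\<forall>\<^sub>F n in sequentially. real (card {i. i < n \<and> P i}) \<le> real n * (c + \<epsilon>)"
  proof eventually_elim
    case (elim n)
    have "{i. i < n \<and> P i} \<subseteq> {..<m} \<union> (\<lambda>i. m + i) ` {i. i < n \<and> P (m + i)}"
    proof
      fix i assume i: "i \<in> {i. i < n \<and> P i}"
      show "i \<in> {..<m} \<union> (\<lambda>i. m + i) ` {i. i < n \<and> P (m + i)}"
      proof (cases "i < m")
        case False
        then have "i = m + (i - m)" by simp
        then show ?thesis using i by (intro UnI2 image_eqI[of _ _ "i - m"]) auto
      qed simp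
    qed
    then have "card {i. i < n \<and> P i} \<le> card ({..<m} \<union> (\<lambda>i. m + i) ` {i. i < n \<and> P (m + i)})"
      by (intro card_mono) auto
    also have "\<dots> \<le> card {..<m} + card ((\<lambda>i. m + i) ` {i. i < n \<and> P (m + i)})" by (rule card_Un_le)
    also have "card ((\<lambda>i. m + i) ` {i. i < n \<and> P (m + i)}) \<le> card {i. i < n \<and> P (m + i)}"
      by (rule card_image_le) simp
    finally have "real (card {i. i < n \<and> P i}) \<le> real m + real n * (c + \<epsilon> / 2)" using elim(1) by simp
    moreover have "real m \<le> real n * (\<epsilon> / 2)"
    proof -
      have "real m / (\<epsilon> / 2) \<le> real n" using n1 elim(2) by linarith
      then show ?thesis using \<epsilon> by (simp add: pos_divide_le_eq)
    qed
    moreover have "real n * (c + \<epsilon>) = real n * (c + \<epsilon> / 2) + real n * (\<epsilon> / 2)" by (simp add: algebra_simps)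
    ultimately show ?case by linarith
  qed
qed

lemma eventually_nhds_rational_interval:
  assumes "eventually P (nhds (a::real))"
  shows "\<exists>u\<in>\<rat>. \<exists>v\<in>\<rat>. u < a \<and> a < v \<and> (\<forall>x\<in>{u..v}. P x)"
proof -
  obtain e where e: "e > 0" "\<And>x. dist x a < e \<Longrightarrow> P x" using assms unfolding eventually_nhds_metric by blast
  obtain u where u: "u \<in> \<rat>" "a - e < u" "u < a" using Rats_dense_in_real[of "a - e" a] e(1) by auto
  obtain v where v: "v \<in> \<rat>" "a < v" "v < a + e" using Rats_dense_in_real[of a "a + e"] e(1) by auto
  have "P x" if "x \<in> {u..v}" for x using that u v by (intro e(2)) (auto simp: dist_real_def)
  then show ?thesis using u v by blast
qed

lemma countable_isolated:
  fixes S :: "real set"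
  assumes "\<And>a. a \<in> S \<Longrightarrow> eventually (\<lambda>x. x \<notin> S) (at a)"
  shows "countable S"
proof -
  have "\<exists>w\<in>\<rat> \<times> \<rat>. fst w < a \<and> a < snd w \<and> {fst w..snd w} \<inter> S = {a}" if a: "a \<in> S" for a
  proof -
    have "eventually (\<lambda>x. x \<noteq> a \<longrightarrow> x \<notin> S) (nhds a)" using assms[OF a] by (simp add: eventually_at_filter)
    from eventually_nhds_rational_interval[OF this]
    obtain u v where uv: "u \<in> \<rat>" "v \<in> \<rat>" "u < a" "a < v" "\<forall>x\<in>{u..v}. x \<noteq> a \<longrightarrow> x \<notin> S" by blast
    have "{u..v} \<inter> S = {a}"
    proof (intro equalityI subsetI)
      fix x assume "x \<in> {u..v} \<inter> S"
      then show "x \<in> {a}" using uv(5) by blast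
    qed (use a uv in simp)
    then show ?thesis using uv by (intro bexI[of _ "(u, v)"]) simp_all
  qed
  then have "\<forall>a\<in>S. \<exists>w. w \<in> \<rat> \<times> \<rat> \<and> {fst w..snd w} \<inter> S = {a}" by blast
  from bchoice[OF this] obtain w where w: "\<forall>a\<in>S. w a \<in> \<rat> \<times> \<rat> \<and> {fst (w a)..snd (w a)} \<inter> S = {a}" by blast
  have "inj_on w S"
  proof (rule inj_onI)
    fix a b assume ab: "a \<in> S" "b \<in> S" "w a = w b"
    then have "{a} = {b}" using w by metis
    then show "a = b" by simp
  qed
  moreover have "countable (w ` S)"
  proof (rule countable_subset)
    show "w ` S \<subseteq> \<rat> \<times> \<rat>" using w by blast
    show "countable (\<rat> \<times> (\<rat> :: real set))" by (intro countable_SIGMA countable_rat)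
  qed
  ultimately show ?thesis by (rule countable_image_inj_on[rotated])
qed

lemma isolated_zero:
  fixes f :: "real \<Rightarrow> real"
  assumes "(f has_real_derivative l) (at a)" "l \<noteq> 0" "f a = 0"
  shows "eventually (\<lambda>x. f x \<noteq> 0) (at a)"
proof -
  have "((\<lambda>x. (f x - f a) / (x - a)) \<longlongrightarrow> l) (at a)" using assms(1) by (simp add: has_field_derivative_iff)
  from tendsto_imp_eventually_ne[OF this assms(2)] show ?thesis by eventually_elim (use assms(3) in auto)
qed

locale tent_family =
  fixes \<alpha> \<beta> \<alpha>' \<beta>' :: "real \<Rightarrow> real" and lam Lam :: real
  assumes lam: "lam > 1"
    and params: "\<And>t. t \<in> {0..1} \<Longrightarrow>
      lam \<le> \<alpha> t \<and> \<alpha> t \<le> Lam \<and> lam \<le> \<beta> t \<and> \<beta> t \<le> Lam \<and> \<alpha> t * \<beta> t \<le> \<alpha> t + \<beta> t"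
    and \<alpha>_deriv: "\<And>t. t \<in> {0..1} \<Longrightarrow> (\<alpha> has_real_derivative \<alpha>' t) (at t within {0..1})"
    and \<beta>_deriv: "\<And>t. t \<in> {0..1} \<Longrightarrow> (\<beta> has_real_derivative \<beta>' t) (at t within {0..1})"
    and cont': "continuous_on {0..1} \<alpha>'" "continuous_on {0..1} \<beta>'"
    and mono: "\<And>t. t \<in> {0..1} \<Longrightarrow> \<alpha>' t \<ge> 0 \<and> \<beta>' t \<ge> 0 \<and> (\<alpha>' t > 0 \<or> \<beta>' t > 0)"
begin

primrec eta :: "nat \<Rightarrow> real \<Rightarrow> real" where
  "eta 0 t = 0"
| "eta (Suc n) t = tent (\<alpha> t) (\<beta> t) (eta n t)"

primrec de :: "nat \<Rightarrow> real \<Rightarrow> real" where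
  "de 0 t = 0"
| "de (Suc n) t = (if eta n t \<le> 0 then \<alpha> t * de n t + \<alpha>' t * eta n t else - \<beta> t * de n t - \<beta>' t * eta n t)"

lemma eta_funpow: "eta n t = (tent (\<alpha> t) (\<beta> t) ^^ n) 0"
  by (induction n) auto

lemma eta_range: "t \<in> {0..1} \<Longrightarrow> 1 - \<beta> t \<le> eta n t \<and> eta n t \<le> 1"
proof (induction n)
  case 0
  then show ?case using params[of t] lam by auto
next
  case (Suc n)
  then show ?case using tent_range[of "\<alpha> t" "\<beta> t" "eta n t"] params[of t] lam by auto
qed

lemma de_unbounded:
  assumes t: "t \<in> {0..1}"
  shows "\<exists>n. \<bar>de n t\<bar> > K"
proof -
  have "pseudo_orbit (\<alpha> t) (\<beta> t) (\<alpha>' t) (\<beta>' t) (\<lambda>n. eta (Suc n) t) (\<lambda>n. de (Suc n) t)"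
    unfolding pseudo_orbit_def
  proof (intro conjI allI)
    show "eta (Suc 0) t = 1" "de (Suc 0) t = 0" by (auto simp: tent_def)
    fix n
    show "eta (Suc n) t \<le> 0 \<and> eta (Suc (Suc n)) t = 1 + \<alpha> t * eta (Suc n) t \<and>
        de (Suc (Suc n)) t = \<alpha> t * de (Suc n) t + \<alpha>' t * eta (Suc n) t \<or>
      0 \<le> eta (Suc n) t \<and> eta (Suc (Suc n)) t = 1 - \<beta> t * eta (Suc n) t \<and>
        de (Suc (Suc n)) t = - \<beta> t * de (Suc n) t - \<beta>' t * eta (Suc n) t"
    proof -
      have step: "y \<le> 0 \<and> y' = 1 + a * y \<and> e' = a * e + a' * y \<or> 0 \<le> y \<and> y' = 1 - b * y \<and> e' = - b * e - b' * y"
        if "y' = tent a b y" "e' = (if y \<le> 0 then a * e + a' * y else - b * e - b' * y)" for y y' e e' a b a' b'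
        using that by (auto simp: tent_def)
      show ?thesis by (rule step[OF eta.simps(2) de.simps(2)])
    qed
  qed
  then have "\<exists>n. \<bar>de (Suc n) t\<bar> > K"
    by (rule pseudo_orbit_growth) (use params[OF t] mono[OF t] lam in auto)
  then show ?thesis by blast
qed

lemma de_distinct:
  assumes t: "t \<in> {0..1}" and pq: "p < q" "eta p t = eta q t"
  shows "de p t \<noteq> de q t"
proof
  assume e: "de p t = de q t"
  have per: "\<exists>m<q. de n t = de m t \<and> eta n t = eta m t" for n
  proof (induction n)
    case 0
    then show ?case using pq by (intro exI[of _ 0]) auto
  next
    case (Suc n)
    then obtain m where m: "m < q" "de n t = de m t" "eta n t = eta m t" by blast
    have s: "de (Suc n) t = de (Suc m) t" "eta (Suc n) t = eta (Suc m) t" using m by auto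
    show ?case
    proof (cases "Suc m = q")
      case True
      then show ?thesis using s e pq by (intro exI[of _ p]) auto
    next
      case False
      then show ?thesis using s m(1) by (intro exI[of _ "Suc m"]) auto
    qed
  qed
  have "\<bar>de n t\<bar> \<le> Max ((\<lambda>m. \<bar>de m t\<bar>) ` {..<q})" for n
  proof -
    obtain m where "m < q" "de n t = de m t" using per[of n] by blast
    then show ?thesis by (intro Max_ge) auto
  qed
  then show False using de_unbounded[OF t] by (meson not_le)
qed

lemma continuous_params: "continuous_on {0..1} \<alpha>" "continuous_on {0..1} \<beta>"
  by (rule DERIV_continuous_on, erule \<alpha>_deriv) (rule DERIV_continuous_on, erule \<beta>_deriv)

lemma isCont_params:
  assumes "t \<in> {0<..<1}"
  shows "isCont \<alpha> t" "isCont \<beta> t" "isCont \<alpha>' t" "isCont \<beta>' t"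
  using assms continuous_params cont' by (auto intro!: continuous_on_interior)

lemma isCont_eta: "t \<in> {0<..<1} \<Longrightarrow> isCont (eta n) t"
proof (induction n)
  case (Suc n)
  have "eta (Suc n) = (\<lambda>t. 1 + \<alpha> t * min (eta n t) 0 - \<beta> t * max (eta n t) 0)"
    by (rule ext) (simp add: tent_altdef)
  then show ?case using Suc.IH[OF Suc.prems] isCont_params[OF Suc.prems] by (simp only:) (intro continuous_intros)
next
  case 0
  have "eta 0 = (\<lambda>_. 0)" by (rule ext) simp
  then show ?case by simp
qed

lemma tendsto_eta: "t \<in> {0<..<1} \<Longrightarrow> (eta n \<longlongrightarrow> eta n t) (nhds t)"
  using isCont_eta[of t n] tendsto_at_iff_tendsto_nhds isCont_def by metis

lemma eta_deriv_cont:
  assumes t: "t \<in> {0<..<1}" and nz: "\<And>i. 1 \<le> i \<Longrightarrow> i < n \<Longrightarrow> eta i t \<noteq> 0"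
  shows "(eta n has_real_derivative de n t) (at t) \<and> isCont (de n) t"
  using nz
proof (induction n)
  case 0
  have "eta 0 = (\<lambda>_. 0)" "de 0 = (\<lambda>_. 0)" by (auto simp: fun_eq_iff)
  then show ?case by simp
next
  case (Suc n)
  have D: "(eta n has_real_derivative de n t) (at t)" "isCont (de n) t" using Suc by auto
  have p: "(\<alpha> has_real_derivative \<alpha>' t) (at t)" "(\<beta> has_real_derivative \<beta>' t) (at t)"
    using \<alpha>_deriv[of t] \<beta>_deriv[of t] t by (auto simp: at_within_Icc_at)
  note c = isCont_params[OF t] isCont_eta[OF t, of n] D(2)
  consider "n = 0" | "n \<ge> 1" "eta n t < 0" | "n \<ge> 1" "eta n t > 0" using Suc.prems[of n] by fastforce
  then show ?case
  proof cases
    case 1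
    have "eta (Suc n) = (\<lambda>_. 1)" "de (Suc n) = (\<lambda>_. 0)" using 1 by (auto simp: fun_eq_iff tent_def)
    then show ?thesis by simp
  next
    case 2
    have ev: "eventually (\<lambda>s. eta n s < 0) (nhds t)" using order_tendstoD(2)[OF tendsto_eta[OF t] 2(2)] .
    have "((\<lambda>s. 1 + \<alpha> s * eta n s) has_real_derivative de (Suc n) t) (at t)"
      using 2 by (auto intro!: derivative_eq_intros D p)
    then have "(eta (Suc n) has_real_derivative de (Suc n) t) (at t)"
      by (subst DERIV_cong_ev[OF refl _ refl]) (use ev in eventually_elim, simp add: tent_def)
    moreover have "eventually (\<lambda>s. de (Suc n) s = \<alpha> s * de n s + \<alpha>' s * eta n s) (nhds t)" using ev by eventually_elim simp
    then have "isCont (de (Suc n)) t \<longleftrightarrow> isCont (\<lambda>s. \<alpha> s * de n s + \<alpha>' s * eta n s) t" by (rule isCont_cong)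
    moreover have "isCont (\<lambda>s. \<alpha> s * de n s + \<alpha>' s * eta n s) t" using c by (intro continuous_intros)
    ultimately show ?thesis by blast
  next
    case 3
    have ev: "eventually (\<lambda>s. eta n s > 0) (nhds t)" using order_tendstoD(1)[OF tendsto_eta[OF t] 3(2)] .
    have "((\<lambda>s. 1 - \<beta> s * eta n s) has_real_derivative de (Suc n) t) (at t)"
      using 3 by (auto intro!: derivative_eq_intros D p)
    then have "(eta (Suc n) has_real_derivative de (Suc n) t) (at t)"
      by (subst DERIV_cong_ev[OF refl _ refl]) (use ev in eventually_elim, simp add: tent_def)
    moreover have "eventually (\<lambda>s. de (Suc n) s = - \<beta> s * de n s - \<beta>' s * eta n s) (nhds t)" using ev by eventually_elim simp
    then have "isCont (de (Suc n)) t \<longleftrightarrow> isCont (\<lambda>s. - \<beta> s * de n s - \<beta>' s * eta n s) t" by (rule isCont_cong)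
    moreover have "isCont (\<lambda>s. - \<beta> s * de n s - \<beta>' s * eta n s) t" using c by (intro continuous_intros)
    ultimately show ?thesis by blast
  qed
qed

definition generic :: "real \<Rightarrow> bool" where
  "generic t \<longleftrightarrow> t \<in> {0<..<1} \<and> (\<forall>i\<ge>1. eta i t \<noteq> 0) \<and> (\<forall>p q. 1 \<le> p \<and> p < q \<longrightarrow> eta p t \<noteq> eta q t)"

lemma countable_nongeneric: "countable {t \<in> {0<..<1}. \<not> generic t}"
proof -
  define Z where "Z n = {t \<in> {0<..<1}. eta n t = 0 \<and> (\<forall>i. 1 \<le> i \<and> i < n \<longrightarrow> eta i t \<noteq> 0)}" for n
  define E where "E p q = {t \<in> {0<..<1}. eta p t - eta q t = 0 \<and> (\<forall>i\<ge>1. eta i t \<noteq> 0)}" for p q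
  have Z: "countable (Z n)" if n: "n \<ge> 1" for n
  proof (rule countable_isolated)
    fix t assume t: "t \<in> Z n"
    then have "(eta n has_real_derivative de n t) (at t)" using eta_deriv_cont[of t n] by (auto simp: Z_def)
    moreover have "de n t \<noteq> 0" using de_distinct[of t 0 n] t n by (auto simp: Z_def)
    moreover have "eta n t = 0" using t by (simp add: Z_def)
    ultimately have "eventually (\<lambda>x. eta n x \<noteq> 0) (at t)" by (rule isolated_zero)
    then show "eventually (\<lambda>x. x \<notin> Z n) (at t)" by eventually_elim (simp add: Z_def)
  qed
  have E: "countable (E p q)" if pq: "p < q" for p q
  proof (rule countable_isolated)
    fix t assume t: "t \<in> E p q"
    then have "(eta p has_real_derivative de p t) (at t)" "(eta q has_real_derivative de q t) (at t)"
      using eta_deriv_cont[of t p] eta_deriv_cont[of t q] by (auto simp: E_def)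
    then have "((\<lambda>t. eta p t - eta q t) has_real_derivative de p t - de q t) (at t)" by (rule DERIV_diff)
    moreover have "de p t - de q t \<noteq> 0" using de_distinct[of t p q] t pq by (auto simp: E_def)
    moreover have "eta p t - eta q t = 0" using t by (simp add: E_def)
    ultimately have "eventually (\<lambda>x. eta p x - eta q x \<noteq> 0) (at t)" by (rule isolated_zero)
    then show "eventually (\<lambda>x. x \<notin> E p q) (at t)" by eventually_elim (simp add: E_def)
  qed
  have "{t \<in> {0<..<1}. \<not> generic t} \<subseteq> (\<Union>n\<in>{1..}. Z n) \<union> (\<Union>(p, q)\<in>{(p, q). p < q}. E p q)"
  proof
    fix t assume t: "t \<in> {t \<in> {0<..<1}. \<not> generic t}"
    show "t \<in> (\<Union>n\<in>{1..}. Z n) \<union> (\<Union>(p, q)\<in>{(p, q). p < q}. E p q)"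
    proof (cases "\<exists>i\<ge>1. eta i t = 0")
      case True
      define n where "n = (LEAST i. i \<ge> 1 \<and> eta i t = 0)"
      have n: "n \<ge> 1 \<and> eta n t = 0" unfolding n_def using True by (rule LeastI_ex)
      have "eta i t \<noteq> 0" if "1 \<le> i" "i < n" for i using not_less_Least[of i "\<lambda>i. i \<ge> 1 \<and> eta i t = 0"] that by (auto simp: n_def)
      then have "t \<in> Z n" using t n by (auto simp: Z_def)
      then show ?thesis using n by auto
    next
      case False
      then obtain p q where "1 \<le> p" "p < q" "eta p t = eta q t" using t by (auto simp: generic_def)
      then have "t \<in> E p q" using t False by (auto simp: E_def)
      then show ?thesis using \<open>p < q\<close> by auto
    qed
  qed
  moreover have "countable ((\<Union>n\<in>{1..}. Z n) \<union> (\<Union>(p, q)\<in>{(p, q). p < q}. E p q))"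
    using Z E by (intro countable_Un countable_UN) (auto intro: countableI_type)
  ultimately show ?thesis by (rule countable_subset)
qed

lemma tent_map_generic: "generic t \<Longrightarrow> tent_map (\<alpha> t) (\<beta> t)"
proof
  assume g: "generic t"
  then have t: "t \<in> {0..1}" by (auto simp: generic_def)
  show "1 < \<alpha> t" "1 < \<beta> t" "\<alpha> t * \<beta> t \<le> \<alpha> t + \<beta> t" using params[OF t] lam by auto
  show "(tent (\<alpha> t) (\<beta> t) ^^ p) 0 \<noteq> (tent (\<alpha> t) (\<beta> t) ^^ q) 0" if "1 \<le> p" "p < q" for p q
    using g that unfolding generic_def eta_funpow[symmetric] by blast
qed

lemma local_curve:
  assumes g: "generic t0"
  obtains u v n0 L K0 N \<delta> where "u \<in> \<rat>" "v \<in> \<rat>" "u < t0" "t0 < v"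
    "separated_tent_curve \<alpha> \<beta> \<alpha>' \<beta>' (eta n0) (de n0) u v lam Lam L K0 N \<delta>"
proof -
  have t0: "t0 \<in> {0<..<1}" and nz: "\<And>i. 1 \<le> i \<Longrightarrow> eta i t0 \<noteq> 0"
    and dist: "\<And>p q. 1 \<le> p \<Longrightarrow> p < q \<Longrightarrow> eta p t0 \<noteq> eta q t0" using g by (auto simp: generic_def)
  have t0': "t0 \<in> {0..1}" using t0 by auto
  obtain L1 where "\<forall>y\<in>\<alpha>' ` {0..1}. norm y \<le> L1"
    using compact_imp_bounded[OF compact_continuous_image[OF cont'(1)]] unfolding bounded_iff by blast
  then have L1: "\<And>t. t \<in> {0..1} \<Longrightarrow> \<bar>\<alpha>' t\<bar> \<le> L1" by auto
  obtain L2 where "\<forall>y\<in>\<beta>' ` {0..1}. norm y \<le> L2"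
    using compact_imp_bounded[OF compact_continuous_image[OF cont'(2)]] unfolding bounded_iff by blast
  then have L2: "\<And>t. t \<in> {0..1} \<Longrightarrow> \<bar>\<beta>' t\<bar> \<le> L2" by auto
  define L where "L = max L1 L2"
  have L: "\<bar>\<alpha>' t\<bar> \<le> L \<and> \<bar>\<beta>' t\<bar> \<le> L" if "t \<in> {0..1}" for t using L1[OF that] L2[OF that] by (auto simp: L_def)
  define K0 where "K0 = max 1 (max (4 * L * Lam) (2 * L * Lam / (lam - 1)))"
  have K0: "K0 > 0" "4 * L * Lam \<le> K0" "2 * L * Lam \<le> K0 * (lam - 1)"
  proof -
    show "K0 > 0" "4 * L * Lam \<le> K0" by (auto simp: K0_def)
    have "2 * L * Lam / (lam - 1) \<le> K0" by (auto simp: K0_def)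
    then show "2 * L * Lam \<le> K0 * (lam - 1)" using lam by (simp add: pos_divide_le_eq)
  qed
  obtain n0 where n0: "\<bar>de n0 t0\<bar> > 2 * K0" using de_unbounded[OF t0'] by blast
  define M where "M = \<bar>de n0 t0\<bar>"
  have M: "M > 2 * K0" "M > 0" using n0 K0(1) by (auto simp: M_def)
  define G where "G t \<longleftrightarrow> t \<in> {0<..<1} \<and> (\<forall>i\<in>{1..<n0}. eta i t \<noteq> 0) \<and> 2 / 3 * M < \<bar>de n0 t\<bar> \<and> \<bar>de n0 t\<bar> < 4 / 3 * M" for t
  have evG: "eventually G (nhds t0)"
  proof -
    have 1: "eventually (\<lambda>t. t \<in> {0<..<1}) (nhds t0)" using t0 by (intro eventually_nhds_in_open) auto
    have 2: "eventually (\<lambda>t. \<forall>i\<in>{1..<n0}. eta i t \<noteq> 0) (nhds t0)"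
    proof (intro eventually_ball_finite ballI)
      fix i assume "i \<in> {1..<n0}"
      then show "eventually (\<lambda>t. eta i t \<noteq> 0) (nhds t0)"
        using tendsto_imp_eventually_ne[OF tendsto_eta[OF t0]] nz[of i] by auto
    qed simp
    have "isCont (de n0) t0" using eta_deriv_cont[OF t0, of n0] nz by blast
    then have "(de n0 \<longlongrightarrow> de n0 t0) (nhds t0)" using tendsto_at_iff_tendsto_nhds isCont_def by metis
    then have lim: "((\<lambda>t. \<bar>de n0 t\<bar>) \<longlongrightarrow> M) (nhds t0)" unfolding M_def by (rule tendsto_rabs)
    have 3: "eventually (\<lambda>t. 2 / 3 * M < \<bar>de n0 t\<bar>) (nhds t0)" using M by (intro order_tendstoD(1)[OF lim]) simp
    have 4: "eventually (\<lambda>t. \<bar>de n0 t\<bar> < 4 / 3 * M) (nhds t0)" using M by (intro order_tendstoD(2)[OF lim]) simp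
    from 1 2 3 4 show ?thesis unfolding G_def by eventually_elim blast
  qed
  have curve: "tent_curve \<alpha> \<beta> \<alpha>' \<beta>' (eta n0) (de n0) u v lam Lam L K0"
    if uv: "u < v" and GG: "\<And>t. t \<in> {u..v} \<Longrightarrow> G t" for u v
  proof
    fix t assume tuv: "t \<in> {u..v}"
    have sub: "{u..v} \<subseteq> {0..1}"
    proof
      fix x assume "x \<in> {u..v}"
      then show "x \<in> {0..1}" using GG[of x] by (auto simp: G_def)
    qed
    then have t: "t \<in> {0..1}" using tuv by blast
    show "lam \<le> \<alpha> t \<and> \<alpha> t \<le> Lam \<and> lam \<le> \<beta> t \<and> \<beta> t \<le> Lam \<and> \<alpha> t * \<beta> t \<le> \<alpha> t + \<beta> t" by (rule params[OF t])
    show "(\<alpha> has_real_derivative \<alpha>' t) (at t within {u..v})" by (rule DERIV_subset[OF \<alpha>_deriv[OF t] sub])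
    show "(\<beta> has_real_derivative \<beta>' t) (at t within {u..v})" by (rule DERIV_subset[OF \<beta>_deriv[OF t] sub])
    have "(eta n0 has_real_derivative de n0 t) (at t)"
      using eta_deriv_cont[of t n0] GG[OF tuv] by (auto simp: G_def)
    then show "(eta n0 has_real_derivative de n0 t) (at t within {u..v})" by (rule has_field_derivative_at_within)
    show "\<bar>\<alpha>' t\<bar> \<le> L \<and> \<bar>\<beta>' t\<bar> \<le> L" by (rule L[OF t])
    show "1 - \<beta> t \<le> eta n0 t \<and> eta n0 t \<le> 1" by (rule eta_range[OF t])
    show "K0 \<le> \<bar>de n0 t\<bar>" using GG[OF tuv] M K0(1) by (auto simp: G_def)
    fix s assume "s \<in> {u..v}"
    then show "\<bar>de n0 s\<bar> \<le> 2 * \<bar>de n0 t\<bar>" using GG[OF tuv] GG[of s] by (auto simp: G_def)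
  qed (use uv lam K0 in auto)
  obtain u1 v1 where uv1: "u1 < t0" "t0 < v1" "\<forall>t\<in>{u1..v1}. G t"
    using eventually_nhds_rational_interval[OF evG] by blast
  interpret T1: tent_curve \<alpha> \<beta> \<alpha>' \<beta>' "eta n0" "de n0" u1 v1 lam Lam L K0
  proof (rule curve)
    show "u1 < v1" using uv1(1,2) by linarith
    show "G t" if "t \<in> {u1..v1}" for t using uv1(3) that by blast
  qed
  obtain N where N: "4 * T1.D < T1.mu ^ N" using real_arch_pow[OF T1.mu] by blast
  have "\<exists>\<delta>>0. \<forall>w\<in>{1..N} \<times> {1..N}. fst w \<noteq> snd w \<longrightarrow> 3 * \<delta> \<le> \<bar>eta (fst w) t0 - eta (snd w) t0\<bar>"
  proof -
    define X where "X = insert 1 ((\<lambda>w. \<bar>eta (fst w) t0 - eta (snd w) t0\<bar>) ` {w \<in> {1..N} \<times> {1..N}. fst w \<noteq> snd w})"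
    have fin: "finite X" by (simp add: X_def)
    have "x > 0" if x: "x \<in> X" for x
    proof (cases "x = 1")
      case False
      then obtain w where w: "w \<in> {1..N} \<times> {1..N}" "fst w \<noteq> snd w" "x = \<bar>eta (fst w) t0 - eta (snd w) t0\<bar>"
        using x by (auto simp: X_def)
      then have "1 \<le> fst w" "1 \<le> snd w" "fst w < snd w \<or> snd w < fst w" by auto
      then have "eta (fst w) t0 \<noteq> eta (snd w) t0" using dist[of "fst w" "snd w"] dist[of "snd w" "fst w"] by metis
      then show ?thesis using w(3) by simp
    qed simp
    then have m: "Min X > 0" using fin by (simp add: X_def)
    show ?thesis
    proof (intro exI[of _ "Min X / 3"] conjI ballI impI)
      show "0 < Min X / 3" using m by simp
      fix w assume "w \<in> {1..N} \<times> {1..N}" "fst w \<noteq> snd w"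
      then have "\<bar>eta (fst w) t0 - eta (snd w) t0\<bar> \<in> X" unfolding X_def by blast
      then show "3 * (Min X / 3) \<le> \<bar>eta (fst w) t0 - eta (snd w) t0\<bar>" using Min_le[OF fin] by simp
    qed
  qed
  then obtain \<delta> where \<delta>: "\<delta> > 0"
    "\<And>p q. p \<in> {1..N} \<Longrightarrow> q \<in> {1..N} \<Longrightarrow> p \<noteq> q \<Longrightarrow> 3 * \<delta> \<le> \<bar>eta p t0 - eta q t0\<bar>" by fastforce
  have "eventually (\<lambda>t. \<forall>p\<in>{1..N}. \<bar>eta p t - eta p t0\<bar> < \<delta>) (nhds t0)"
  proof (intro eventually_ball_finite ballI)
    fix p
    show "eventually (\<lambda>t. \<bar>eta p t - eta p t0\<bar> < \<delta>) (nhds t0)"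
      using tendstoD[OF tendsto_eta[OF t0] \<delta>(1), of p] by (simp add: dist_real_def)
  qed simp
  with evG have "eventually (\<lambda>t. G t \<and> (\<forall>p\<in>{1..N}. \<bar>eta p t - eta p t0\<bar> < \<delta>)) (nhds t0)" by eventually_elim blast
  from eventually_nhds_rational_interval[OF this]
  obtain u v where uv: "u \<in> \<rat>" "v \<in> \<rat>" "u < t0" "t0 < v"
    and close: "\<forall>t\<in>{u..v}. G t \<and> (\<forall>p\<in>{1..N}. \<bar>eta p t - eta p t0\<bar> < \<delta>)"
    by blast
  interpret T2: tent_curve \<alpha> \<beta> \<alpha>' \<beta>' "eta n0" "de n0" u v lam Lam L K0
  proof (rule curve)
    show "u < v" using uv(3,4) by linarith
    show "G t" if "t \<in> {u..v}" for t using close that by blast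
  qed
  have "separated_tent_curve \<alpha> \<beta> \<alpha>' \<beta>' (eta n0) (de n0) u v lam Lam L K0 N \<delta>"
  proof unfold_locales
    show "4 * T1.D \<le> T1.mu ^ N" using N by simp
    show "0 < \<delta>" by (rule \<delta>(1))
    fix s t p q assume st: "s \<in> {u..v}" "t \<in> {u..v}" and pq: "1 \<le> p" "p \<le> N" "1 \<le> q" "q \<le> N" "p \<noteq> q"
    have "\<bar>eta p s - eta p t0\<bar> < \<delta>" "\<bar>eta q t - eta q t0\<bar> < \<delta>" using bspec[OF close st(1)] bspec[OF close st(2)] pq by auto
    moreover have "3 * \<delta> \<le> \<bar>eta p t0 - eta q t0\<bar>" using \<delta>(2)[of p q] pq by auto
    ultimately show "\<delta> \<le> \<bar>T2.crit p s - T2.crit q t\<bar>" unfolding T2.crit_def eta_funpow[symmetric] by linarith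
  qed
  then show ?thesis using that uv(1-4) by blast
qed

definition density_bound :: "real \<Rightarrow> real \<Rightarrow> bool" where
  "density_bound C t \<longleftrightarrow> (\<forall>p\<in>\<rat>. \<forall>q\<in>\<rat>. p < q \<longrightarrow>
     upper_density_le (\<lambda>i. p \<le> eta i t \<and> eta i t \<le> q) (C * (q - p)))"

lemma local_density_bound:
  assumes g: "generic t0"
  shows "\<exists>u\<in>\<rat>. \<exists>v\<in>\<rat>. u < t0 \<and> t0 < v \<and> (AE t in lborel. t \<in> {u..v} \<longrightarrow> (\<exists>C\<ge>0. density_bound C t))"
proof -
  obtain u v n0 L K0 N \<delta> where uv: "u \<in> \<rat>" "v \<in> \<rat>" "u < t0" "t0 < v"
    "separated_tent_curve \<alpha> \<beta> \<alpha>' \<beta>' (eta n0) (de n0) u v lam Lam L K0 N \<delta>" by (rule local_curve[OF g])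
  interpret S: separated_tent_curve \<alpha> \<beta> \<alpha>' \<beta>' "eta n0" "de n0" u v lam Lam L K0 N \<delta> by (rule uv(5))
  have z: "S.z i t = eta (n0 + i) t" for i t by (induction i) auto
  define C where "C = 2 * (S.D / Lam) * (1 + S.C0)"
  have C: "C \<ge> 0" using S.D_pos S.Lam S.C0_pos by (simp add: C_def)
  have "AE t in lborel. t \<in> {u..v} \<longrightarrow> (\<exists>C\<ge>0. density_bound C t)"
    using S.AE_orbit_density
  proof eventually_elim
    case (elim t)
    show ?case
    proof
      assume t: "t \<in> {u..v}"
      have "density_bound C t" unfolding density_bound_def
      proof (intro ballI impI)
        fix p q :: real assume "p \<in> \<rat>" "q \<in> \<rat>" "p < q"
        then have "upper_density_le (\<lambda>i. p \<le> S.z i t \<and> S.z i t \<le> q) (C * (q - p))" using elim t unfolding C_def by blast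
        then show "upper_density_le (\<lambda>i. p \<le> eta i t \<and> eta i t \<le> q) (C * (q - p))"
          unfolding z by (rule upper_density_le_shift)
      qed
      then show "\<exists>C\<ge>0. density_bound C t" using C by blast
    qed
  qed
  then show ?thesis using uv by blast
qed

lemma AE_generic_density_bound: "AE t in lborel. t \<in> {0..1} \<longrightarrow> generic t \<and> (\<exists>C\<ge>0. density_bound C t)"
proof -
  define W where "W = {w \<in> \<rat> \<times> \<rat>. AE t in lborel. t \<in> {fst w..snd w} \<longrightarrow> (\<exists>C\<ge>0. density_bound C t)}"
  have "countable W" unfolding W_def by (rule countable_subset[of _ "\<rat> \<times> \<rat>"]) (auto intro: countable_rat)
  then have "AE t in lborel. \<forall>w\<in>W. t \<in> {fst w..snd w} \<longrightarrow> (\<exists>C\<ge>0. density_bound C t)"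
    by (rule AE_ball_countable[THEN iffD2]) (simp add: W_def)
  moreover have "AE t in lborel. t \<notin> {t \<in> {0<..<1}. \<not> generic t} \<union> {0, 1}"
    using countable_nongeneric by (intro AE_not_in countable_imp_null_set_lborel) simp
  ultimately show ?thesis
  proof eventually_elim
    case (elim t)
    show ?case
    proof
      assume t: "t \<in> {0..1}"
      have "t \<noteq> 0" "t \<noteq> 1" using elim(2) by auto
      then have "t \<in> {0<..<1}" using t by (auto simp: less_le)
      then have g: "generic t" using elim(2) by auto
      obtain u v where uv: "u \<in> \<rat>" "v \<in> \<rat>" "u < t" "t < v" "AE t in lborel. t \<in> {u..v} \<longrightarrow> (\<exists>C\<ge>0. density_bound C t)"
        using local_density_bound[OF g] by blast
      then have "(u, v) \<in> W" by (simp add: W_def)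
      moreover have "t \<in> {u..v}" using uv by simp
      ultimately have "\<exists>C\<ge>0. density_bound C t" using elim(1) by fastforce
      then show "generic t \<and> (\<exists>C\<ge>0. density_bound C t)" using g by blast
    qed
  qed
qed

lemma typical_generic:
  assumes g: "generic t" and C: "C \<ge> 0" "density_bound C t" and \<mu>: "acip (skew_tent (\<alpha> t) (\<beta> t)) \<mu>"
  shows "typical (skew_tent (\<alpha> t) (\<beta> t)) \<mu> (turning_point (\<beta> t))"
proof -
  interpret M: tent_map "\<alpha> t" "\<beta> t" by (rule tent_map_generic[OF g])
  let ?b = "\<beta> t"
  have b: "?b > 1" by (rule M.\<beta>)
  have eta: "eta i t = ?b * ((M.T ^^ i) M.c - M.c)" for i
    by (induction i) (auto simp: M.tent_conj)
  show ?thesis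
  proof (rule typical_if_density_bound[where C = "2 * C * ?b"])
    show "continuous_on UNIV M.T" by (rule continuous_skew_tent[OF b])
    show "M.T y \<in> {0..1}" if "y \<in> {0..1}" for y by (rule M.T_range[OF that])
    show "M.c \<in> {0..1}" using b by (simp add: turning_point_def)
    show "0 \<le> 2 * C * ?b" using C(1) b by simp
    show "acip M.T \<mu>" by (rule \<mu>)
    show "\<nu> = \<mu>" if "acip M.T \<nu>" for \<nu> by (rule M.acip_unique[OF that \<mu>])
    fix p q :: real assume pq: "p < q"
    define h where "h = ?b * (q - p) / 2"
    have h: "h > 0" using pq b by (simp add: h_def)
    obtain p' where p': "p' \<in> \<rat>" "?b * (p - M.c) - h < p'" "p' < ?b * (p - M.c)"
      using Rats_dense_in_real[of "?b * (p - M.c) - h" "?b * (p - M.c)"] h by auto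
    obtain q' where q': "q' \<in> \<rat>" "?b * (q - M.c) < q'" "q' < ?b * (q - M.c) + h"
      using Rats_dense_in_real[of "?b * (q - M.c)" "?b * (q - M.c) + h"] h by auto
    have lt: "?b * (p - M.c) < ?b * (q - M.c)" using pq b by simp
    have "?b * (q - M.c) - ?b * (p - M.c) = ?b * (q - p)" by (simp add: algebra_simps)
    moreover have "2 * h = ?b * (q - p)" by (simp add: h_def)
    ultimately have "q' - p' \<le> 2 * (?b * (q - p))" using p' q' by linarith
    then have "C * (q' - p') \<le> C * (2 * (?b * (q - p)))" using C(1) by (intro mult_left_mono)
    then have le: "C * (q' - p') \<le> 2 * C * ?b * (q - p)" by (simp only: mult_ac)
    have "p' < q'" using p' q' lt by linarith
    then have up: "upper_density_le (\<lambda>i. p' \<le> eta i t \<and> eta i t \<le> q') (C * (q' - p'))"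
      using C(2) p'(1) q'(1) unfolding density_bound_def by blast
    show "upper_density_le (\<lambda>i. p \<le> (M.T ^^ i) M.c \<and> (M.T ^^ i) M.c \<le> q) (2 * C * ?b * (q - p))"
    proof (rule upper_density_le_mono[OF up _ le])
      fix i assume i: "p \<le> (M.T ^^ i) M.c \<and> (M.T ^^ i) M.c \<le> q"
      then have "?b * (p - M.c) \<le> eta i t" "eta i t \<le> ?b * (q - M.c)" unfolding eta using b by auto
      then show "p' \<le> eta i t \<and> eta i t \<le> q'" using p' q' by linarith
    qed
  qed
qed

end

theorem theorem1p3:
  fixes \<alpha>\<^sub>0 \<beta>\<^sub>0 \<alpha>\<^sub>1 \<beta>\<^sub>1 :: real
    and \<alpha> \<beta> \<alpha>' \<beta>' :: "real \<Rightarrow> real"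
    and \<mu> :: "real \<Rightarrow> real measure"
  assumes "(\<alpha>\<^sub>0, \<beta>\<^sub>0) \<in> skew_tent_params" and "(\<alpha>\<^sub>1, \<beta>\<^sub>1) \<in> skew_tent_params"
    and "\<alpha>\<^sub>1 \<ge> \<alpha>\<^sub>0" and "\<beta>\<^sub>1 \<ge> \<beta>\<^sub>0" and "\<alpha>\<^sub>1 > \<alpha>\<^sub>0 \<or> \<beta>\<^sub>1 > \<beta>\<^sub>0"
    and "\<alpha> \<in> {0..1} \<rightarrow> {\<alpha>\<^sub>0..\<alpha>\<^sub>1}" and "\<beta> \<in> {0..1} \<rightarrow> {\<beta>\<^sub>0..\<beta>\<^sub>1}"
    and "\<And>a. a \<in> {0..1} \<Longrightarrow> (\<alpha> has_real_derivative \<alpha>' a) (at a within {0..1})"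
    and "continuous_on {0..1} \<alpha>'"
    and "\<And>a. a \<in> {0..1} \<Longrightarrow> (\<beta> has_real_derivative \<beta>' a) (at a within {0..1})"
    and "continuous_on {0..1} \<beta>'"
    and "(\<alpha> 0, \<beta> 0) = (\<alpha>\<^sub>0, \<beta>\<^sub>0)" and "(\<alpha> 1, \<beta> 1) = (\<alpha>\<^sub>1, \<beta>\<^sub>1)"
    and "\<And>a. a \<in> {0..1} \<Longrightarrow> \<alpha>\<^sub>0 \<noteq> \<alpha>\<^sub>1 \<Longrightarrow> \<alpha>' a > 0"
    and "\<And>a. a \<in> {0..1} \<Longrightarrow> \<beta>\<^sub>0 \<noteq> \<beta>\<^sub>1 \<Longrightarrow> \<beta>' a > 0"
    and "\<And>a. a \<in> {0..1} \<Longrightarrow> acip (skew_tent (\<alpha> a) (\<beta> a)) (\<mu> a)"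
  shows "AE a in lebesgue_on {0..1}.
    typical (skew_tent (\<alpha> a) (\<beta> a)) (\<mu> a) (turning_point (\<beta> a))"
proof -
  have p0: "\<alpha>\<^sub>0 > 1" "\<beta>\<^sub>0 > 1" and p1: "\<alpha>\<^sub>1 > 1" "\<beta>\<^sub>1 > 1" "inverse \<alpha>\<^sub>1 + inverse \<beta>\<^sub>1 \<ge> 1"
    using assms(1,2) by (auto simp: skew_tent_params_def)
  have ab: "\<alpha>\<^sub>0 \<le> \<alpha> t" "\<alpha> t \<le> \<alpha>\<^sub>1" "\<beta>\<^sub>0 \<le> \<beta> t" "\<beta> t \<le> \<beta>\<^sub>1" if "t \<in> {0..1}" for t
    using assms(6,7) that by (auto simp: Pi_iff)
  have const: "f' t = 0"
    if "\<And>a. a \<in> {0..1} \<Longrightarrow> (f has_real_derivative f' a) (at a within {0..1})" "\<And>a. a \<in> {0..1} \<Longrightarrow> f a = k"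
      and t: "t \<in> {0..1}" for f f' :: "real \<Rightarrow> real" and k t
  proof -
    have "((\<lambda>_. k) has_real_derivative f' t) (at t within {0..1})"
      by (rule has_field_derivative_transform_within[OF that(1)[OF t] zero_less_one t]) (rule that(2))
    moreover have "((\<lambda>_. k) has_real_derivative 0) (at t within {0..1})" by simp
    moreover have "at t within {0..1} \<noteq> bot" using t by (simp add: trivial_limit_within islimpt_Icc)
    ultimately show ?thesis by (metis has_real_derivative_iff_has_vector_derivative vector_derivative_unique_within)
  qed
  interpret F: tent_family \<alpha> \<beta> \<alpha>' \<beta>' "min \<alpha>\<^sub>0 \<beta>\<^sub>0" "max \<alpha>\<^sub>1 \<beta>\<^sub>1"
  proof
    show "1 < min \<alpha>\<^sub>0 \<beta>\<^sub>0" using p0 by simp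
    fix t :: real assume t: "t \<in> {0..1}"
    have g1: "\<alpha> t > 1" "\<beta> t > 1" using ab[OF t] p0 by auto
    have "1 \<le> inverse (\<alpha> t) + inverse (\<beta> t)"
      using p1 ab[OF t] g1 le_imp_inverse_le[of "\<alpha> t" \<alpha>\<^sub>1] le_imp_inverse_le[of "\<beta> t" \<beta>\<^sub>1] by linarith
    then have "\<alpha> t * \<beta> t \<le> \<alpha> t + \<beta> t" using g1 by (simp add: field_simps)
    then show "min \<alpha>\<^sub>0 \<beta>\<^sub>0 \<le> \<alpha> t \<and> \<alpha> t \<le> max \<alpha>\<^sub>1 \<beta>\<^sub>1 \<and> min \<alpha>\<^sub>0 \<beta>\<^sub>0 \<le> \<beta> t \<and> \<beta> t \<le> max \<alpha>\<^sub>1 \<beta>\<^sub>1 \<and> \<alpha> t * \<beta> t \<le> \<alpha> t + \<beta> t"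
      using ab[OF t] by auto
    have "\<alpha>' t = 0" if e: "\<alpha>\<^sub>0 = \<alpha>\<^sub>1"
    proof (rule const[OF assms(8) _ t])
      show "\<alpha> a = \<alpha>\<^sub>0" if "a \<in> {0..1}" for a using ab(1,2)[OF that] e by linarith
    qed
    moreover have "\<beta>' t = 0" if e: "\<beta>\<^sub>0 = \<beta>\<^sub>1"
    proof (rule const[OF assms(10) _ t])
      show "\<beta> a = \<beta>\<^sub>0" if "a \<in> {0..1}" for a using ab(3,4)[OF that] e by linarith
    qed
    ultimately show "\<alpha>' t \<ge> 0 \<and> \<beta>' t \<ge> 0 \<and> (\<alpha>' t > 0 \<or> \<beta>' t > 0)"
      using assms(5) assms(14)[OF t] assms(15)[OF t] by force
  qed (use assms(8-11) in auto)
  have "AE a in lborel. a \<in> {0..1} \<longrightarrow> typical (skew_tent (\<alpha> a) (\<beta> a)) (\<mu> a) (turning_point (\<beta> a))"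
    using F.AE_generic_density_bound
  proof eventually_elim
    case (elim a)
    then show ?case using F.typical_generic assms(16) by blast
  qed
  then have "AE a in lebesgue. a \<in> {0..1} \<longrightarrow> typical (skew_tent (\<alpha> a) (\<beta> a)) (\<mu> a) (turning_point (\<beta> a))"
    by (rule AE_completion)
  then show ?thesis by (subst AE_restrict_space_iff) auto
qed

end
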